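(* In $\mathsf{P}$, the following are equivalent: (a) $\mathsf{STP}$; (b) $\mathsf{STP}_{\mathbb{R}}$; (c) $(\forall^{\mathrm{st}}g^2)(\exists^{\mathrm{st}}w^{1^*},k^0)(\forall T^1\le_11)\big[(\forall\alpha^1\in w)(\overline{\alpha}g(\alpha)\notin T)\to(\forall\beta\le_11)(\exists i\le k)(\overline{\beta}i\notin T)\big]$; (d) $(\forall^{\mathrm{st}}g^2)(\exists^{\mathrm{st}}w^{1^*},k^0)(\forall z\in\mathbb{R})\big[(\forall y\in(w\cap[0,1]))(|y-z|>_{\mathbb{R}}\frac1{g(y)})\to(\forall x\in[0,1])(|x-z|>_{\mathbb{R}}\frac1k)\big]$.
   Context: $\mathsf{P}$ is the nonstandard extension of $\mathsf{E\text{-}PA}^{\omega*}$ (Peano arithmetic in all finite types with extensionality and types $\rho^*$ of finite sequences; "$\alpha\in w$" means $\alpha$ is an entry of $w$) by a predicate $\mathrm{st}$ with axioms: $\mathrm{st}(x)\wedge x=y\to\mathrm{st}(y)$; $\mathrm{st}(t)$ for closed terms $t$; $\mathrm{st}(f)\wedge\mathrm{st}(x)\to\mathrm{st}(f(x))$; external induction $\Phi(0)\wedge(\forall^{\mathrm{st}}n)(\Phi(n)\to\Phi(n+1))\to(\forall^{\mathrm{st}}n)\Phi(n)$; $\mathsf{HAC}_{\mathrm{int}}$ (st-free $\varphi$: $(\forall^{\mathrm{st}}x)(\exists^{\mathrm{st}}y)\varphi\to(\exists^{\mathrm{st}}F)(\forall^{\mathrm{st}}x)(\exists y\in F(x))\varphi(x,y)$);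 idealisation $\mathsf{I}$ (st-free $\varphi$: $(\forall^{\mathrm{st}}x^{\sigma^*})(\exists y)(\forall z\in x)\varphi(z,y)\to(\exists y)(\forall^{\mathrm{st}}x^\sigma)\varphi(x,y)$). For $\alpha^1$: $\alpha\le_11$ means $\alpha(n)\le1$ for all $n$; $\alpha\approx_1\beta$ means $(\forall^{\mathrm{st}}n)\alpha(n)=\beta(n)$; $\overline{\alpha}n=\langle\alpha(0),\dots,\alpha(n)\rangle$. $T^1\le_11$ means $T$ is a binary tree (given by a characteristic function on codes of finite sequences). Reals are fast-converging Cauchy sequences of rationals (type 1 objects); $x\approx y$ iff $|q_n-r_n|\le2^{-n+1}$ for all standard $n$. $\mathsf{STP}$: $(\forall\alpha^1\le_11)(\exists^{\mathrm{st}}\beta^1\le_11)(\alpha\approx_1\beta)$. $\mathsf{STP}_{\mathbb{R}}$: $(\forall x\in[0,1])(\exists^{\mathrm{st}}y\in[0,1])(x\approx y)$. *)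

theory Defs
  imports Main
begin

text \<open>
  The theorem asserts derivability in the formal system P, so types, terms, formulas and
  derivations of P are represented as data. Free variables are named and bound variables are
  de Bruijn indices (locally nameless): alpha-equivalent formulas are equal, and substitution for
  a free variable cannot capture. Formulas are always written with the quantifier \<open>all x\<close>, which
  binds the named variable \<open>x\<close>; the raw constructors \<open>Bound\<close> and \<open>Forall\<close> are not used directly.
\<close>

section \<open>Types and terms\<close>

text \<open>\<open>Tn\<close> is the type 0 and \<open>Tseq \<sigma>\<close> the type of finite sequences of objects of type \<open>\<sigma>\<close>.\<close>

datatype ty = Tn | Tfun ty ty (infixr "\<rightarrow>" 200) | Tseq ty

abbreviation T1 :: ty where "T1 \<equiv> Tn \<rightarrow> Tn"
abbreviation T2 :: ty where "T2 \<equiv> T1 \<rightarrow> Tn"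

text \<open>Zero and successor, the combinators, the recursors, the empty sequence, the prepending of an
  entry, and the recursors over finite sequences.\<close>

datatype cnst =
    Zero | Succ
  | Kc ty ty | Sc ty ty ty | Rc ty
  | Nilc ty | Consc ty | Lc ty ty

text \<open>A variable is a name together with a type; variables with the same name and different types
  are different.\<close>

type_synonym var = "nat \<times> ty"

datatype tm = V var | Bound nat | Cn cnst | App tm tm (infixl "\<cdot>" 90)

fun cty :: "cnst \<Rightarrow> ty" where
  "cty Zero = Tn"
| "cty Succ = Tn \<rightarrow> Tn"
| "cty (Kc \<sigma> \<tau>) = \<sigma> \<rightarrow> \<tau> \<rightarrow> \<sigma>"
| "cty (Sc \<rho> \<sigma> \<tau>) = (\<rho> \<rightarrow> \<sigma> \<rightarrow> \<tau>) \<rightarrow> (\<rho> \<rightarrow> \<sigma>) \<rightarrow> \<rho> \<rightarrow> \<tau>"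
| "cty (Rc \<rho>) = Tn \<rightarrow> \<rho> \<rightarrow> (\<rho> \<rightarrow> Tn \<rightarrow> \<rho>) \<rightarrow> \<rho>"
| "cty (Nilc \<sigma>) = Tseq \<sigma>"
| "cty (Consc \<sigma>) = \<sigma> \<rightarrow> Tseq \<sigma> \<rightarrow> Tseq \<sigma>"
| "cty (Lc \<sigma> \<rho>) = Tseq \<sigma> \<rightarrow> \<rho> \<rightarrow> (\<rho> \<rightarrow> \<sigma> \<rightarrow> \<rho>) \<rightarrow> \<rho>"

text \<open>The type of a term is meaningful only for well-typed terms.\<close>

fun tyof :: "tm \<Rightarrow> ty" where
  "tyof (V x) = snd x"
| "tyof (Bound i) = Tn"
| "tyof (Cn c) = cty c"
| "tyof (s \<cdot> t) = (case tyof s of \<sigma> \<rightarrow> \<tau> \<Rightarrow> \<tau> | _ \<Rightarrow> Tn)"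

fun wt :: "tm \<Rightarrow> bool" where
  "wt (V x) = True"
| "wt (Bound i) = False"
| "wt (Cn c) = True"
| "wt (s \<cdot> t) = (wt s \<and> wt t \<and> (case tyof s of \<sigma> \<rightarrow> \<tau> \<Rightarrow> tyof t = \<sigma> | _ \<Rightarrow> False))"

fun fvt :: "tm \<Rightarrow> var set" where
  "fvt (V x) = {x}"
| "fvt (Bound i) = {}"
| "fvt (Cn c) = {}"
| "fvt (s \<cdot> t) = fvt s \<union> fvt t"

fun substt :: "var \<Rightarrow> tm \<Rightarrow> tm \<Rightarrow> tm" where
  "substt x u (V y) = (if x = y then u else V y)"
| "substt x u (Bound i) = Bound i"
| "substt x u (Cn c) = Cn c"
| "substt x u (s \<cdot> t) = substt x u s \<cdot> substt x u t"

fun closet :: "var \<Rightarrow> nat \<Rightarrow> tm \<Rightarrow> tm" where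
  "closet x k (V y) = (if x = y then Bound k else V y)"
| "closet x k (Bound i) = Bound i"
| "closet x k (Cn c) = Cn c"
| "closet x k (s \<cdot> t) = closet x k s \<cdot> closet x k t"

section \<open>Formulas\<close>

text \<open>Equality and the standardness predicate are primitive at all types.\<close>

datatype fm = Fls | Eq tm tm (infix "\<doteq>" 60) | St tm | Imp fm fm (infixr "\<longrightarrow>\<^sub>f" 45) | Forall ty fm

primrec fv :: "fm \<Rightarrow> var set" where
  "fv Fls = {}"
| "fv (s \<doteq> t) = fvt s \<union> fvt t"
| "fv (St t) = fvt t"
| "fv (\<phi> \<longrightarrow>\<^sub>f \<psi>) = fv \<phi> \<union> fv \<psi>"
| "fv (Forall \<sigma> \<phi>) = fv \<phi>"

primrec subst :: "var \<Rightarrow> tm \<Rightarrow> fm \<Rightarrow> fm" where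
  "subst x u Fls = Fls"
| "subst x u (s \<doteq> t) = (substt x u s \<doteq> substt x u t)"
| "subst x u (St t) = St (substt x u t)"
| "subst x u (\<phi> \<longrightarrow>\<^sub>f \<psi>) = (subst x u \<phi> \<longrightarrow>\<^sub>f subst x u \<psi>)"
| "subst x u (Forall \<sigma> \<phi>) = Forall \<sigma> (subst x u \<phi>)"

primrec close :: "var \<Rightarrow> nat \<Rightarrow> fm \<Rightarrow> fm" where
  "close x k Fls = Fls"
| "close x k (s \<doteq> t) = (closet x k s \<doteq> closet x k t)"
| "close x k (St t) = St (closet x k t)"
| "close x k (\<phi> \<longrightarrow>\<^sub>f \<psi>) = (close x k \<phi> \<longrightarrow>\<^sub>f close x k \<psi>)"
| "close x k (Forall \<sigma> \<phi>) = Forall \<sigma> (close x (Suc k) \<phi>)"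

definition all :: "var \<Rightarrow> fm \<Rightarrow> fm" where
  "all x \<phi> = Forall (snd x) (close x 0 \<phi>)"

definition Neg :: "fm \<Rightarrow> fm" ("\<not>\<^sub>f _" [70] 70) where
  "\<not>\<^sub>f \<phi> = (\<phi> \<longrightarrow>\<^sub>f Fls)"

definition Conj :: "fm \<Rightarrow> fm \<Rightarrow> fm" (infixr "\<and>\<^sub>f" 55) where
  "\<phi> \<and>\<^sub>f \<psi> = \<not>\<^sub>f (\<phi> \<longrightarrow>\<^sub>f \<not>\<^sub>f \<psi>)"

definition Disj :: "fm \<Rightarrow> fm \<Rightarrow> fm" (infixr "\<or>\<^sub>f" 50) where
  "\<phi> \<or>\<^sub>f \<psi> = (\<not>\<^sub>f \<phi> \<longrightarrow>\<^sub>f \<psi>)"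

definition Iff :: "fm \<Rightarrow> fm \<Rightarrow> fm" (infix "\<longleftrightarrow>\<^sub>f" 40) where
  "(\<phi> \<longleftrightarrow>\<^sub>f \<psi>) = ((\<phi> \<longrightarrow>\<^sub>f \<psi>) \<and>\<^sub>f (\<psi> \<longrightarrow>\<^sub>f \<phi>))"

definition ex :: "var \<Rightarrow> fm \<Rightarrow> fm" where
  "ex x \<phi> = \<not>\<^sub>f (all x (\<not>\<^sub>f \<phi>))"

definition allst :: "var \<Rightarrow> fm \<Rightarrow> fm" where
  "allst x \<phi> = all x (St (V x) \<longrightarrow>\<^sub>f \<phi>)"

definition exst :: "var \<Rightarrow> fm \<Rightarrow> fm" where
  "exst x \<phi> = ex x (St (V x) \<and>\<^sub>f \<phi>)"

text \<open>The well-typed formulas, without dangling bound variables.\<close>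

inductive wff :: "fm \<Rightarrow> bool" where
  wff_Fls: "wff Fls"
| wff_Eq: "\<lbrakk>wt s; wt t; tyof s = tyof t\<rbrakk> \<Longrightarrow> wff (s \<doteq> t)"
| wff_St: "wt t \<Longrightarrow> wff (St t)"
| wff_Imp: "\<lbrakk>wff \<phi>; wff \<psi>\<rbrakk> \<Longrightarrow> wff (\<phi> \<longrightarrow>\<^sub>f \<psi>)"
| wff_all: "wff \<phi> \<Longrightarrow> wff (all x \<phi>)"

text \<open>The internal (st-free) formulas.\<close>

primrec internal :: "fm \<Rightarrow> bool" where
  "internal Fls = True"
| "internal (s \<doteq> t) = True"
| "internal (St t) = False"
| "internal (\<phi> \<longrightarrow>\<^sub>f \<psi>) = (internal \<phi> \<and> internal \<psi>)"
| "internal (Forall \<sigma> \<phi>) = internal \<phi>"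

section \<open>Defined terms: arithmetic and finite sequences\<close>

text \<open>Lambda abstraction is the usual abbreviation in terms of the combinators.\<close>

fun lam :: "var \<Rightarrow> tm \<Rightarrow> tm" where
  "lam x (V y) =
    (if x = y
     then Cn (Sc (snd x) (snd x \<rightarrow> snd x) (snd x)) \<cdot> Cn (Kc (snd x) (snd x \<rightarrow> snd x)) \<cdot> Cn (Kc (snd x) (snd x))
     else Cn (Kc (snd y) (snd x)) \<cdot> V y)"
| "lam x (Bound i) = Bound i"
| "lam x (Cn c) = Cn (Kc (cty c) (snd x)) \<cdot> Cn c"
| "lam x (s \<cdot> t) =
    (if x \<in> fvt s \<union> fvt t
     then Cn (Sc (snd x) (tyof t) (tyof (s \<cdot> t))) \<cdot> lam x s \<cdot> lam x t
     else Cn (Kc (tyof (s \<cdot> t)) (snd x)) \<cdot> (s \<cdot> t))"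

definition zero :: tm where "zero = Cn Zero"
definition suc :: "tm \<Rightarrow> tm" where "suc t = Cn Succ \<cdot> t"
definition one :: tm where "one = suc zero"
definition two :: tm where "two = suc one"

definition nrec :: "tm \<Rightarrow> tm \<Rightarrow> tm \<Rightarrow> tm" where
  "nrec n y z = Cn (Rc (tyof y)) \<cdot> n \<cdot> y \<cdot> z"

definition elty :: "tm \<Rightarrow> ty" where
  "elty w = (case tyof w of Tseq \<sigma> \<Rightarrow> \<sigma> | _ \<Rightarrow> Tn)"

definition lrec :: "tm \<Rightarrow> tm \<Rightarrow> tm \<Rightarrow> tm" where
  "lrec w y z = Cn (Lc (elty w) (tyof y)) \<cdot> w \<cdot> y \<cdot> z"

definition plus_tm :: tm where
  "plus_tm = (let m = (0, Tn); n = (1, Tn); r = (2, Tn); i = (3, Tn) in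
     lam m (lam n (nrec (V n) (V m) (lam r (lam i (suc (V r)))))))"
definition plus :: "tm \<Rightarrow> tm \<Rightarrow> tm" where "plus s t = plus_tm \<cdot> s \<cdot> t"

definition pred_tm :: tm where
  "pred_tm = (let n = (1, Tn); r = (2, Tn); i = (3, Tn) in
     lam n (nrec (V n) zero (lam r (lam i (V i)))))"
definition pred :: "tm \<Rightarrow> tm" where "pred t = pred_tm \<cdot> t"

text \<open>Truncated subtraction.\<close>

definition monus_tm :: tm where
  "monus_tm = (let m = (0, Tn); n = (1, Tn); r = (2, Tn); i = (3, Tn) in
     lam m (lam n (nrec (V n) (V m) (lam r (lam i (pred (V r)))))))"
definition monus :: "tm \<Rightarrow> tm \<Rightarrow> tm" where "monus s t = monus_tm \<cdot> s \<cdot> t"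

definition times_tm :: tm where
  "times_tm = (let m = (0, Tn); n = (1, Tn); r = (2, Tn); i = (3, Tn) in
     lam m (lam n (nrec (V n) zero (lam r (lam i (plus (V r) (V m)))))))"
definition times :: "tm \<Rightarrow> tm \<Rightarrow> tm" where "times s t = times_tm \<cdot> s \<cdot> t"

definition pow2_tm :: tm where
  "pow2_tm = (let n = (1, Tn); r = (2, Tn); i = (3, Tn) in
     lam n (nrec (V n) one (lam r (lam i (plus (V r) (V r))))))"
definition pow2 :: "tm \<Rightarrow> tm" where "pow2 t = pow2_tm \<cdot> t"

definition leq :: "tm \<Rightarrow> tm \<Rightarrow> fm" (infix "\<le>\<^sub>0" 60) where "(s \<le>\<^sub>0 t) = (monus s t \<doteq> zero)"
definition less :: "tm \<Rightarrow> tm \<Rightarrow> fm" (infix "<\<^sub>0" 60) where "(s <\<^sub>0 t) = (suc s \<le>\<^sub>0 t)"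

definition nil :: "ty \<Rightarrow> tm" where "nil \<sigma> = Cn (Nilc \<sigma>)"
definition cons :: "tm \<Rightarrow> tm \<Rightarrow> tm" where "cons a w = Cn (Consc (tyof a)) \<cdot> a \<cdot> w"

definition append_tm :: "ty \<Rightarrow> tm" where
  "append_tm \<sigma> = (let v = (0, Tseq \<sigma>); w = (1, Tseq \<sigma>); r = (2, Tseq \<sigma>); a = (3, \<sigma>) in
     lam v (lam w (lrec (V v) (V w) (lam r (lam a (cons (V a) (V r)))))))"
definition append :: "tm \<Rightarrow> tm \<Rightarrow> tm" where "append v w = append_tm (elty v) \<cdot> v \<cdot> w"

definition len_tm :: "ty \<Rightarrow> tm" where
  "len_tm \<sigma> = (let w = (0, Tseq \<sigma>); r = (1, Tn); a = (2, \<sigma>) in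
     lam w (lrec (V w) zero (lam r (lam a (suc (V r))))))"
definition len :: "tm \<Rightarrow> tm" where "len w = len_tm (elty w) \<cdot> w"

primrec default :: "ty \<Rightarrow> tm" where
  "default Tn = zero"
| "default (\<sigma> \<rightarrow> \<tau>) = Cn (Kc \<tau> \<sigma>) \<cdot> default \<tau>"
| "default (Tseq \<sigma>) = nil \<sigma>"

text \<open>The entry of a sequence at a position, with a default beyond its length. The recursion over
  the sequence computes the function from positions to entries.\<close>

definition nth_tm :: "ty \<Rightarrow> tm" where
  "nth_tm \<sigma> =
    (let w = (0, Tseq \<sigma>); r = (1, Tn \<rightarrow> \<sigma>); a = (2, \<sigma>); i = (3, Tn); q = (4, \<sigma>); j = (5, Tn) in
     lam w (lrec (V w) (lam i (default \<sigma>))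
       (lam r (lam a (lam i (nrec (V i) (V a) (lam q (lam j (V r \<cdot> V j)))))))))"
definition nth :: "tm \<Rightarrow> tm \<Rightarrow> tm" where "nth w i = nth_tm (elty w) \<cdot> w \<cdot> i"

text \<open>A name that is larger than all names of free variables in the given terms, used for the
  variables bound in defined formulas.\<close>

fun above :: "tm \<Rightarrow> nat" where
  "above (V x) = Suc (fst x)"
| "above (Bound i) = 0"
| "above (Cn c) = 0"
| "above (s \<cdot> t) = max (above s) (above t)"

definition fresh :: "tm list \<Rightarrow> nat" where
  "fresh ts = foldr (\<lambda>t m. max (above t) m) ts 0"

definition mem :: "tm \<Rightarrow> tm \<Rightarrow> fm" (infix "\<in>\<^sub>f" 60) where
  "(s \<in>\<^sub>f w) = (let i = (fresh [s, w], Tn) in ex i ((V i <\<^sub>0 len w) \<and>\<^sub>f (s \<doteq> nth w (V i))))"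

section \<open>The system P\<close>

text \<open>Axioms are the well-formed instances of the following schemes. Induction
  (\<open>ax_ind\<close>) is restricted to internal formulas, as P extends the internal system; the formulas
  of internal induction, HAC-int and idealisation may contain further free variables
  (parameters), standard or not.\<close>

inductive_set P_axioms :: "fm set" where
  ax_refl: "(t \<doteq> t) \<in> P_axioms"
| ax_sym: "((s \<doteq> t) \<longrightarrow>\<^sub>f (t \<doteq> s)) \<in> P_axioms"
| ax_trans: "((s \<doteq> t) \<longrightarrow>\<^sub>f (t \<doteq> u) \<longrightarrow>\<^sub>f (s \<doteq> u)) \<in> P_axioms"
| ax_cong: "((f \<doteq> g) \<longrightarrow>\<^sub>f (s \<doteq> t) \<longrightarrow>\<^sub>f (f \<cdot> s \<doteq> g \<cdot> t)) \<in> P_axioms"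
| ax_ext: "x \<notin> fvt f \<union> fvt g \<Longrightarrow> (all x (f \<cdot> V x \<doteq> g \<cdot> V x) \<longrightarrow>\<^sub>f (f \<doteq> g)) \<in> P_axioms"
| ax_K: "(Cn (Kc \<sigma> \<tau>) \<cdot> s \<cdot> t \<doteq> s) \<in> P_axioms"
| ax_S: "(Cn (Sc \<rho> \<sigma> \<tau>) \<cdot> r \<cdot> s \<cdot> t \<doteq> r \<cdot> t \<cdot> (s \<cdot> t)) \<in> P_axioms"
| ax_R_zero: "(Cn (Rc \<rho>) \<cdot> zero \<cdot> y \<cdot> z \<doteq> y) \<in> P_axioms"
| ax_R_suc: "(Cn (Rc \<rho>) \<cdot> suc n \<cdot> y \<cdot> z \<doteq> z \<cdot> (Cn (Rc \<rho>) \<cdot> n \<cdot> y \<cdot> z) \<cdot> n) \<in> P_axioms"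
| ax_L_nil: "(Cn (Lc \<sigma> \<rho>) \<cdot> nil \<sigma> \<cdot> y \<cdot> z \<doteq> y) \<in> P_axioms"
| ax_L_cons: "(Cn (Lc \<sigma> \<rho>) \<cdot> (Cn (Consc \<sigma>) \<cdot> a \<cdot> w) \<cdot> y \<cdot> z \<doteq> z \<cdot> (Cn (Lc \<sigma> \<rho>) \<cdot> w \<cdot> y \<cdot> z) \<cdot> a) \<in> P_axioms"
| ax_suc_neq: "(\<not>\<^sub>f (suc t \<doteq> zero)) \<in> P_axioms"
| ax_suc_inj: "((suc s \<doteq> suc t) \<longrightarrow>\<^sub>f (s \<doteq> t)) \<in> P_axioms"
| ax_seq: "\<lbrakk>snd w = Tseq \<sigma>; snd a = \<sigma>; snd v = Tseq \<sigma>; v \<noteq> w\<rbrakk> \<Longrightarrow>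
    ((V w \<doteq> nil \<sigma>) \<or>\<^sub>f ex a (ex v (V w \<doteq> cons (V a) (V v)))) \<in> P_axioms"
| ax_ind: "\<lbrakk>snd n = Tn; internal \<phi>\<rbrakk> \<Longrightarrow>
    ((subst n zero \<phi> \<and>\<^sub>f all n (\<phi> \<longrightarrow>\<^sub>f subst n (suc (V n)) \<phi>)) \<longrightarrow>\<^sub>f all n \<phi>) \<in> P_axioms"
| ax_st_eq: "((St s \<and>\<^sub>f (s \<doteq> t)) \<longrightarrow>\<^sub>f St t) \<in> P_axioms"
| ax_st_closed: "fvt t = {} \<Longrightarrow> St t \<in> P_axioms"
| ax_st_app: "((St f \<and>\<^sub>f St t) \<longrightarrow>\<^sub>f St (f \<cdot> t)) \<in> P_axioms"
| ax_ext_ind: "snd n = Tn \<Longrightarrow>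
    ((subst n zero \<phi> \<and>\<^sub>f allst n (\<phi> \<longrightarrow>\<^sub>f subst n (suc (V n)) \<phi>)) \<longrightarrow>\<^sub>f allst n \<phi>) \<in> P_axioms"
| ax_HAC: "\<lbrakk>internal \<phi>; x \<noteq> y; snd F = snd x \<rightarrow> Tseq (snd y); F \<notin> fv \<phi>\<rbrakk> \<Longrightarrow>
    (allst x (exst y \<phi>) \<longrightarrow>\<^sub>f exst F (allst x (ex y ((V y \<in>\<^sub>f V F \<cdot> V x) \<and>\<^sub>f \<phi>)))) \<in> P_axioms"
| ax_I: "\<lbrakk>internal \<phi>; x \<noteq> y; snd w = Tseq (snd x); w \<noteq> y; w \<notin> fv \<phi>\<rbrakk> \<Longrightarrow>
    (allst w (ex y (all x ((V x \<in>\<^sub>f V w) \<longrightarrow>\<^sub>f \<phi>))) \<longrightarrow>\<^sub>f ex y (allst x \<phi>)) \<in> P_axioms"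

text \<open>Derivability in P from assumptions, by classical natural deduction.\<close>

inductive derives :: "fm set \<Rightarrow> fm \<Rightarrow> bool" (infix "\<turnstile>\<^sub>P" 35) where
  Ax: "\<lbrakk>\<phi> \<in> P_axioms; wff \<phi>\<rbrakk> \<Longrightarrow> \<Gamma> \<turnstile>\<^sub>P \<phi>"
| Assm: "\<lbrakk>\<phi> \<in> \<Gamma>; wff \<phi>\<rbrakk> \<Longrightarrow> \<Gamma> \<turnstile>\<^sub>P \<phi>"
| ImpI: "\<lbrakk>wff \<phi>; insert \<phi> \<Gamma> \<turnstile>\<^sub>P \<psi>\<rbrakk> \<Longrightarrow> \<Gamma> \<turnstile>\<^sub>P (\<phi> \<longrightarrow>\<^sub>f \<psi>)"
| ImpE: "\<lbrakk>\<Gamma> \<turnstile>\<^sub>P (\<phi> \<longrightarrow>\<^sub>f \<psi>); \<Gamma> \<turnstile>\<^sub>P \<phi>\<rbrakk> \<Longrightarrow> \<Gamma> \<turnstile>\<^sub>P \<psi>"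
| Contr: "\<lbrakk>wff \<phi>; insert (\<not>\<^sub>f \<phi>) \<Gamma> \<turnstile>\<^sub>P Fls\<rbrakk> \<Longrightarrow> \<Gamma> \<turnstile>\<^sub>P \<phi>"
| AllI: "\<lbrakk>\<Gamma> \<turnstile>\<^sub>P \<phi>; \<forall>\<psi>\<in>\<Gamma>. x \<notin> fv \<psi>\<rbrakk> \<Longrightarrow> \<Gamma> \<turnstile>\<^sub>P all x \<phi>"
| AllE: "\<lbrakk>\<Gamma> \<turnstile>\<^sub>P all x \<phi>; wff \<phi>; wt t; tyof t = snd x\<rbrakk> \<Longrightarrow> \<Gamma> \<turnstile>\<^sub>P subst x t \<phi>"

section \<open>Cantor space and binary trees\<close>

text \<open>\<open>binary \<alpha>\<close> and \<open>\<alpha> \<approx>\<^sub>1 \<beta>\<close> are the relations \<open>\<alpha> \<le>\<^sub>1 1\<close> and \<open>\<alpha> \<approx>\<^sub>1 \<beta>\<close> for objects of type 1.\<close>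

definition binary :: "tm \<Rightarrow> fm" where
  "binary a = (let n = (fresh [a], Tn) in all n (a \<cdot> V n \<le>\<^sub>0 one))"

definition approx1 :: "tm \<Rightarrow> tm \<Rightarrow> fm" (infix "\<approx>\<^sub>1" 60) where
  "(a \<approx>\<^sub>1 b) = (let n = (fresh [a, b], Tn) in allst n (a \<cdot> V n \<doteq> b \<cdot> V n))"

text \<open>The initial segment with the \<open>n + 1\<close> entries \<open>\<alpha>(0), \<dots>, \<alpha>(n)\<close>.\<close>

definition seg_tm :: tm where
  "seg_tm = (let a = (0, T1); n = (1, Tn); r = (2, Tseq Tn); i = (3, Tn) in
     lam a (lam n (nrec (V n) (cons (V a \<cdot> zero) (nil Tn))
       (lam r (lam i (append (V r) (cons (V a \<cdot> suc (V i)) (nil Tn))))))))"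
definition seg :: "tm \<Rightarrow> tm \<Rightarrow> tm" where "seg a n = seg_tm \<cdot> a \<cdot> n"

text \<open>The bijective coding of finite sequences of numbers by numbers: the empty sequence has code
  \<open>0\<close>, and prepending \<open>a\<close> to a sequence with code \<open>r\<close> gives the code \<open>2^a * (2 * r + 1)\<close>.\<close>

definition code_tm :: tm where
  "code_tm = (let w = (0, Tseq Tn); r = (1, Tn); a = (2, Tn) in
     lam w (lrec (V w) zero (lam r (lam a (times (pow2 (V a)) (suc (times two (V r))))))))"
definition code :: "tm \<Rightarrow> tm" where "code w = code_tm \<cdot> w"

text \<open>Membership of a finite sequence in a tree with characteristic function \<open>T\<close>.\<close>

definition in_tree :: "tm \<Rightarrow> tm \<Rightarrow> fm" where
  "in_tree s T = (T \<cdot> code s \<doteq> one)"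

definition binary_tree :: "tm \<Rightarrow> fm" where
  "binary_tree T =
    (let s = (fresh [T], Tseq Tn); t = (Suc (fresh [T]), Tseq Tn); m = (fresh [T], Tn) in
     binary T
     \<and>\<^sub>f all s (all t (in_tree (append (V s) (V t)) T \<longrightarrow>\<^sub>f in_tree (V s) T))
     \<and>\<^sub>f all s (in_tree (V s) T \<longrightarrow>\<^sub>f all m ((V m \<in>\<^sub>f V s) \<longrightarrow>\<^sub>f (V m \<le>\<^sub>0 one))))"

section \<open>Rational and real numbers\<close>

text \<open>Cantor's pairing \<open>(a + b) * (a + b + 1) div 2 + b\<close>; its inverse is computed by walking
  along the diagonals, from \<open>(0, b)\<close> to \<open>(b + 1, 0)\<close> and from \<open>(a + 1, b)\<close> to \<open>(a, b + 1)\<close>, with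
  the current pair stored as a sequence of length two.\<close>

definition tri_tm :: tm where
  "tri_tm = (let n = (1, Tn); r = (2, Tn); i = (3, Tn) in
     lam n (nrec (V n) zero (lam r (lam i (plus (V r) (suc (V i)))))))"

definition pair_tm :: tm where
  "pair_tm = (let a = (0, Tn); b = (1, Tn) in
     lam a (lam b (plus (tri_tm \<cdot> plus (V a) (V b)) (V b))))"
definition pair :: "tm \<Rightarrow> tm \<Rightarrow> tm" where "pair s t = pair_tm \<cdot> s \<cdot> t"

text \<open>\<open>ifz s t u\<close> is \<open>t\<close> if \<open>s\<close> is zero, and \<open>u\<close> otherwise.\<close>

definition ifz_tm :: "ty \<Rightarrow> tm" where
  "ifz_tm \<sigma> = (let n = (0, Tn); x = (1, \<sigma>); y = (2, \<sigma>); r = (3, \<sigma>); i = (4, Tn) in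
     lam n (lam x (lam y (nrec (V n) (V x) (lam r (lam i (V y)))))))"
definition ifz :: "tm \<Rightarrow> tm \<Rightarrow> tm \<Rightarrow> tm" where "ifz s t u = ifz_tm (tyof t) \<cdot> s \<cdot> t \<cdot> u"

definition list2 :: "tm \<Rightarrow> tm \<Rightarrow> tm" where "list2 s t = cons s (cons t (nil Tn))"

definition unpair_tm :: tm where
  "unpair_tm = (let n = (0, Tn); s = (1, Tseq Tn); i = (2, Tn) in
     lam n (nrec (V n) (list2 zero zero)
       (lam s (lam i (ifz (nth (V s) zero)
         (list2 (suc (nth (V s) one)) zero)
         (list2 (pred (nth (V s) zero)) (suc (nth (V s) one))))))))"

definition pfst :: "tm \<Rightarrow> tm" where "pfst t = nth (unpair_tm \<cdot> t) zero"
definition psnd :: "tm \<Rightarrow> tm" where "psnd t = nth (unpair_tm \<cdot> t) one"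

text \<open>A code \<open>c\<close> represents the rational number \<open>(qpos c - qneg c) / qden c\<close>, so every number is
  a code of a rational and every rational has a code. \<open>quot p q d\<close> is a code of \<open>(p - q) / d\<close>
  for \<open>d \<ge> 1\<close>.\<close>

definition qpos :: "tm \<Rightarrow> tm" where "qpos c = pfst (pfst c)"
definition qneg :: "tm \<Rightarrow> tm" where "qneg c = psnd (pfst c)"
definition qden :: "tm \<Rightarrow> tm" where "qden c = suc (psnd c)"
definition quot :: "tm \<Rightarrow> tm \<Rightarrow> tm \<Rightarrow> tm" where "quot p q d = pair (pair p q) (pred d)"

definition qless :: "tm \<Rightarrow> tm \<Rightarrow> fm" (infix "<\<^sub>Q" 60) where
  "(s <\<^sub>Q t) = (plus (times (qpos s) (qden t)) (times (qneg t) (qden s)) <\<^sub>0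
               plus (times (qpos t) (qden s)) (times (qneg s) (qden t)))"

definition qleq :: "tm \<Rightarrow> tm \<Rightarrow> fm" (infix "\<le>\<^sub>Q" 60) where
  "(s \<le>\<^sub>Q t) = (plus (times (qpos s) (qden t)) (times (qneg t) (qden s)) \<le>\<^sub>0
               plus (times (qpos t) (qden s)) (times (qneg s) (qden t)))"

definition qplus_tm :: tm where
  "qplus_tm = (let s = (0, Tn); t = (1, Tn) in
     lam s (lam t (quot
       (plus (times (qpos (V s)) (qden (V t))) (times (qpos (V t)) (qden (V s))))
       (plus (times (qneg (V s)) (qden (V t))) (times (qneg (V t)) (qden (V s))))
       (times (qden (V s)) (qden (V t))))))"
definition qplus :: "tm \<Rightarrow> tm \<Rightarrow> tm" where "qplus s t = qplus_tm \<cdot> s \<cdot> t"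

text \<open>The distance \<open>\<bar>s - t\<bar>\<close> of two rationals, where \<open>s - t\<close> has the numerator \<open>a - b\<close>.\<close>

definition qdist_tm :: tm where
  "qdist_tm =
    (let s = (0, Tn); t = (1, Tn);
         a = plus (times (qpos (V s)) (qden (V t))) (times (qneg (V t)) (qden (V s)));
         b = plus (times (qneg (V s)) (qden (V t))) (times (qpos (V t)) (qden (V s)))
     in lam s (lam t
          (quot (plus (monus a b) (monus b a)) zero (times (qden (V s)) (qden (V t))))))"
definition qdist :: "tm \<Rightarrow> tm \<Rightarrow> tm" where "qdist s t = qdist_tm \<cdot> s \<cdot> t"

text \<open>\<open>2^(-n)\<close> and \<open>2^(-n+1)\<close>.\<close>

definition inv_pow2 :: "tm \<Rightarrow> tm" where "inv_pow2 n = quot one zero (pow2 n)"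
definition two_inv_pow2 :: "tm \<Rightarrow> tm" where "two_inv_pow2 n = quot two zero (pow2 n)"

text \<open>A real is an object \<open>q\<close> of type 1, read as a sequence of codes of rationals, such that
  \<open>\<bar>q(n) - q(n + i)\<bar> < 2^(-n)\<close> for all \<open>n\<close> and \<open>i\<close>. Correspondingly \<open>x <\<^sub>R y\<close> iff
  \<open>x(n) + 2^(-n+1) < y(n)\<close> for some \<open>n\<close>, and \<open>x \<le>\<^sub>R y\<close> is the negation of \<open>y <\<^sub>R x\<close>.\<close>

definition is_real :: "tm \<Rightarrow> fm" where
  "is_real x = (let n = (fresh [x], Tn); i = (Suc (fresh [x]), Tn) in
     all n (all i (qdist (x \<cdot> V n) (x \<cdot> plus (V n) (V i)) <\<^sub>Q inv_pow2 (V n))))"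

definition rless :: "tm \<Rightarrow> tm \<Rightarrow> fm" (infix "<\<^sub>R" 60) where
  "(x <\<^sub>R y) = (let n = (fresh [x, y], Tn) in
     ex n (qplus (x \<cdot> V n) (two_inv_pow2 (V n)) <\<^sub>Q y \<cdot> V n))"

definition rleq :: "tm \<Rightarrow> tm \<Rightarrow> fm" (infix "\<le>\<^sub>R" 60) where
  "(x \<le>\<^sub>R y) = (\<not>\<^sub>f (y <\<^sub>R x))"

definition approxR :: "tm \<Rightarrow> tm \<Rightarrow> fm" (infix "\<approx>\<^sub>R" 60) where
  "(x \<approx>\<^sub>R y) = (let n = (fresh [x, y], Tn) in
     allst n (qdist (x \<cdot> V n) (y \<cdot> V n) \<le>\<^sub>Q two_inv_pow2 (V n)))"

definition rzero :: tm where "rzero = lam (0, Tn) (quot zero zero one)"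
definition rone :: tm where "rone = lam (0, Tn) (quot one zero one)"

definition unit_interval :: "tm \<Rightarrow> fm" where
  "unit_interval x = (is_real x \<and>\<^sub>f (rzero \<le>\<^sub>R x) \<and>\<^sub>f (x \<le>\<^sub>R rone))"

text \<open>The real \<open>\<bar>x - y\<bar>\<close>; the shift to index \<open>n + 1\<close> makes it converge at the required rate.\<close>

definition rdist_tm :: tm where
  "rdist_tm = (let x = (0, T1); y = (1, T1); n = (2, Tn) in
     lam x (lam y (lam n (qdist (V x \<cdot> suc (V n)) (V y \<cdot> suc (V n))))))"
definition rdist :: "tm \<Rightarrow> tm \<Rightarrow> tm" where "rdist x y = rdist_tm \<cdot> x \<cdot> y"

text \<open>The real \<open>1/k\<close>, for \<open>k \<ge> 1\<close>.\<close>

definition rinv_tm :: tm where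
  "rinv_tm = (let k = (0, Tn); n = (1, Tn) in lam k (lam n (quot one zero (V k))))"
definition rinv :: "tm \<Rightarrow> tm" where "rinv k = rinv_tm \<cdot> k"

text \<open>\<open>\<bar>x - z\<bar> > 1/k\<close>. Since \<open>1/0\<close> is undefined, the inequality is taken to be false for
  \<open>k = 0\<close>. (The convention \<open>1/0 = 0\<close> would make the last principle below fail for the constant
  function \<open>g = 0\<close>.)\<close>

definition apart :: "tm \<Rightarrow> tm \<Rightarrow> tm \<Rightarrow> fm" where
  "apart x z k = (\<not>\<^sub>f (k \<doteq> zero) \<and>\<^sub>f (rinv k <\<^sub>R rdist x z))"

section \<open>The four principles\<close>

definition STP :: fm where
  "STP = (let \<alpha> = (0, T1); \<beta> = (1, T1) in
     all \<alpha> (binary (V \<alpha>) \<longrightarrow>\<^sub>f exst \<beta> (binary (V \<beta>) \<and>\<^sub>f (V \<alpha> \<approx>\<^sub>1 V \<beta>))))"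

definition STP_R :: fm where
  "STP_R = (let x = (0, T1); y = (1, T1) in
     all x (unit_interval (V x) \<longrightarrow>\<^sub>f exst y (unit_interval (V y) \<and>\<^sub>f (V x \<approx>\<^sub>R V y))))"

definition STP_tree :: fm where
  "STP_tree =
    (let g = (0, T2); w = (1, Tseq T1); k = (2, Tn); T = (3, T1); \<alpha> = (4, T1); \<beta> = (5, T1); i = (6, Tn) in
     allst g (exst w (exst k (all T (binary_tree (V T) \<longrightarrow>\<^sub>f
       (all \<alpha> ((V \<alpha> \<in>\<^sub>f V w) \<longrightarrow>\<^sub>f \<not>\<^sub>f (in_tree (seg (V \<alpha>) (V g \<cdot> V \<alpha>)) (V T)))
        \<longrightarrow>\<^sub>f all \<beta> (binary (V \<beta>) \<longrightarrow>\<^sub>f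
              ex i ((V i \<le>\<^sub>0 V k) \<and>\<^sub>f \<not>\<^sub>f (in_tree (seg (V \<beta>) (V i)) (V T))))))))))"

definition STP_cover :: fm where
  "STP_cover =
    (let g = (0, T2); w = (1, Tseq T1); k = (2, Tn); z = (3, T1); y = (4, T1); x = (5, T1) in
     allst g (exst w (exst k (all z (is_real (V z) \<longrightarrow>\<^sub>f
       (all y (((V y \<in>\<^sub>f V w) \<and>\<^sub>f unit_interval (V y)) \<longrightarrow>\<^sub>f apart (V y) (V z) (V g \<cdot> V y))
        \<longrightarrow>\<^sub>f all x (unit_interval (V x) \<longrightarrow>\<^sub>f apart (V x) (V z) (V k))))))))"

end

theory Submission
  imports Defs "HOL-Library.Countable_Set" "HOL-Computational_Algebra.Fraction_Field"
begin

text \<open>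
  P is a classical many-sorted first-order theory, so by completeness (a Henkin term model built from
  the open terms) it suffices to argue in an arbitrary countable model of P. The objects of type 0 of
  such a model form a discretely ordered semiring with induction for internal formulas, which embeds
  into an ordered field; there the codes of rationals become field elements.

  In the model, the tree principle follows from STP by idealisation: if no standard \<open>w\<close>, \<open>k\<close> work for
  \<open>g\<close>, there are a tree \<open>T\<close> avoiding all standard \<open>\<alpha>\<close> at height \<open>g \<alpha>\<close> and a binary \<open>\<beta>\<close> all of whose
  standard initial segments lie in \<open>T\<close>, and the standard part of \<open>\<beta>\<close> is a contradiction. Conversely,
  if the binary \<open>\<alpha>\<close> is not \<open>\<approx>\<^sub>1\<close> to a standard sequence, HAC-int gives a standard \<open>g\<close> such that every
  standard \<open>\<beta>\<close> differs from \<open>\<alpha>\<close> below \<open>g \<beta>\<close>, which refutes the tree principle for the tree of initial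
  segments of \<open>\<alpha>\<close>. The same two arguments relate the covering principle to the standard part
  principle for reals. The latter follows from STP by binary expansion of a rational infinitely close
  to \<open>x\<close>, and implies STP by reading \<open>\<alpha>\<close> as the digits of a real in base 4: the digits 2 and 3 do not
  occur, so that a standard real infinitely close to it determines the standard digits.
\<close>

text \<open>Truth in a model is a predicate of HOL, but induction, choice and idealisation hold
  there only for formulas of P. So each use of them exhibits a formula, and the \<open>sat\<close>
  rules turn it into the intended predicate. Inductive claims are therefore stated without division,
  and only afterwards divided in the field. Idealisation treats one variable at a time, while the
  negated principles have to be idealised in a sequence and a number. One variable of type 1 serves
  as both, the number being its value at 0, and a finite list of such objects is dealt with by the
  sum of these values. HAC-int in turn yields finite lists of candidates instead of a choice
  function; their sums are used, since a larger bound still separates what a smaller one separates.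
  Finally, the field of fractions exists only for a type with class instances, while the numbers of
  a model form a mere set. Passing to countable models and choosing one potential countermodel
  globally overcomes this: its arithmetic is copied to a fixed type.\<close>

section \<open>The ordered field of fractions of a semiring of natural numbers\<close>

text \<open>Cancellation, the absence of zero divisors and an order defined by addition are what the
  passage to differences and then to fractions requires. Induction is not among the axioms: in a
  model it is available for internal formulas only, so a class could not state it for all
  predicates.\<close>

class natlike = comm_semiring_1 + linorder +
  assumes le_iff_ex_add: "a \<le> b \<longleftrightarrow> (\<exists>c. b = a + c)"
    and natlike_cancel: "a + c = b + c \<Longrightarrow> a = b"
    and natlike_no_zero_divisors: "a * b = 0 \<Longrightarrow> a = 0 \<or> b = 0"
begin

lemma natlike_add_le: "a + c \<le> b + c \<longleftrightarrow> a \<le> b"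
proof
  assume "a + c \<le> b + c"
  then obtain d where "b + c = a + c + d" using le_iff_ex_add by blast
  then have "b + c = (a + d) + c" by (simp add: ac_simps)
  then show "a \<le> b" using natlike_cancel le_iff_ex_add by blast
next
  assume "a \<le> b"
  then obtain d where "b = a + d" using le_iff_ex_add by blast
  then have "b + c = a + c + d" by (simp add: ac_simps)
  then show "a + c \<le> b + c" using le_iff_ex_add by blast
qed

end

\<comment> \<open>The Grothendieck ring, with \<open>(a, b)\<close> standing for a - b; cancellation
  makes the relation transitive.\<close>
quotient_type (overloaded) 'n dif = "'n::natlike \<times> 'n" / "\<lambda>(a, b) (c, d). a + d = c + b"
  morphisms rep_dif abs_dif
proof (rule equivpI)
  show "transp (\<lambda>(a, b) (c, d). a + d = c + (b::'n))"
  proof (rule transpI, clarsimp)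
    fix a b c d e f :: 'n
    assume "a + d = c + b" "c + f = e + d"
    then have "a + d + (c + f) = c + b + (e + d)" by simp
    then have "(a + f) + (c + d) = (e + b) + (c + d)" by (simp add: ac_simps)
    then show "a + f = e + b" by (rule natlike_cancel)
  qed
qed (auto intro: reflpI sympI)

instantiation dif :: (natlike) comm_ring_1
begin

lift_definition zero_dif :: "'a dif" is "(0, 0)" .
lift_definition one_dif :: "'a dif" is "(1, 0)" .
lift_definition plus_dif :: "'a dif \<Rightarrow> 'a dif \<Rightarrow> 'a dif" is "\<lambda>(a, b) (c, d). (a + c, b + d)"
  by (clarsimp) (metis add.assoc add.commute)
lift_definition uminus_dif :: "'a dif \<Rightarrow> 'a dif" is "\<lambda>(a, b). (b, a)"
  by (clarsimp simp: ac_simps)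
lift_definition minus_dif :: "'a dif \<Rightarrow> 'a dif \<Rightarrow> 'a dif" is "\<lambda>(a, b) (c, d). (a + d, b + c)"
  by (clarsimp) (metis add.assoc add.commute)
lift_definition times_dif :: "'a dif \<Rightarrow> 'a dif \<Rightarrow> 'a dif"
  is "\<lambda>(a, b) (c, d). (a * c + b * d, a * d + b * c)"
proof (clarsimp)
  fix a b a' b' c d c' d' :: 'a
  assume 1: "a + b' = a' + b" and 2: "c + d' = c' + d"
  have e1: "(a + b') * c = (a' + b) * c" "(a' + b) * d = (a + b') * d" using 1 by simp_all
  have e2: "a' * (c + d') = a' * (c' + d)" "b' * (c' + d) = b' * (c + d')" using 2 by simp_all
  \<comment> \<open>Four mixed products are added to both sides, so that each pair of terms can be
    rewritten by one of the hypotheses; they are cancelled at the end.\<close>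
  have "(a * c + b * d + (a' * d' + b' * c')) + (b' * c + a' * d + a' * c + b' * d)
      = ((a + b') * c) + ((a' + b) * d) + (a' * (c + d')) + (b' * (c' + d))"
    by (simp add: algebra_simps)
  also have "\<dots> = ((a' + b) * c) + ((a + b') * d) + (a' * (c' + d)) + (b' * (c + d'))"
    by (simp only: e1 e2)
  also have "\<dots> = (a' * c' + b' * d' + (a * d + b * c)) + (b' * c + a' * d + a' * c + b' * d)"
    by (simp add: algebra_simps)
  finally show "a * c + b * d + (a' * d' + b' * c') = a' * c' + b' * d' + (a * d + b * c)"
    by (rule natlike_cancel)
qed

instance
    by standard (transfer, force simp: algebra_simps)+

end

instantiation dif :: (natlike) linordered_idom
begin

lift_definition less_eq_dif :: "'a dif \<Rightarrow> 'a dif \<Rightarrow> bool" is "\<lambda>(a, b) (c, d). a + d \<le> c + b"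
proof (clarsimp)
  fix a b a' b' c d c' d' :: 'a
  assume 1: "a + b' = a' + b" and 2: "c + d' = c' + d"
  have "a + d \<le> c + b \<longleftrightarrow> (a + d) + (b' + d') \<le> (c + b) + (b' + d')" by (simp add: natlike_add_le)
  also have "\<dots> \<longleftrightarrow> (a + b') + d + d' \<le> (c + d') + b + b'" by (simp add: ac_simps)
  also have "\<dots> \<longleftrightarrow> (a' + b) + d + d' \<le> (c' + d) + b + b'" by (simp only: 1 2)
  also have "\<dots> \<longleftrightarrow> (a' + d') + (b + d) \<le> (c' + b') + (b + d)" by (simp add: ac_simps)
  also have "\<dots> \<longleftrightarrow> a' + d' \<le> c' + b'" by (simp add: natlike_add_le)
  finally show "a + d \<le> c + b \<longleftrightarrow> a' + d' \<le> c' + b'" .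
qed

definition less_dif :: "'a dif \<Rightarrow> 'a dif \<Rightarrow> bool" where "less_dif a b \<longleftrightarrow> a \<le> b \<and> \<not> b \<le> a"
definition abs_dif_inst: "\<bar>a :: 'a dif\<bar> = (if a < 0 then - a else a)"
definition sgn_dif :: "'a dif \<Rightarrow> 'a dif" where "sgn_dif a = (if a = 0 then 0 else if 0 < a then 1 else - 1)"

text \<open>This reduces the order of products and the absence of zero divisors to the corresponding
  facts about numbers.\<close>

lemma dif_nonneg: "0 \<le> (x :: 'a dif) \<longleftrightarrow> (\<exists>n. x = abs_dif (n, 0))"
proof (transfer, clarsimp)
  show "b \<le> a \<longleftrightarrow> (\<exists>n. a = n + b)" for a b :: 'a
    by (auto simp: le_iff_ex_add add.commute)
qed

lemma dif_nonneg_mult: "0 \<le> x \<Longrightarrow> 0 \<le> y \<Longrightarrow> 0 \<le> (x :: 'a dif) * y"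
  unfolding dif_nonneg by (auto simp: times_dif.abs_eq)

instance
proof
  fix a b c :: "'a dif"
  show antisym: "a \<le> b \<Longrightarrow> b \<le> a \<Longrightarrow> a = b" for a b :: "'a dif" by transfer auto
  show add: "a \<le> b \<Longrightarrow> c + a \<le> c + b" for a b c :: "'a dif"
  proof (transfer, clarsimp)
    show "c + a + (d + b') \<le> c + a' + (d + b)" if "a + b' \<le> a' + b" for a b a' b' c d :: 'a
      using that natlike_add_le[of "a + b'" "c + d" "a' + b"] by (simp add: ac_simps)
  qed
  show tot: "a \<le> b \<or> b \<le> a" for a b :: "'a dif" by transfer auto
  show "a \<le> b \<Longrightarrow> b \<le> c \<Longrightarrow> a \<le> c"
  proof (transfer, clarsimp)
    fix a b c d e f :: 'a
    assume "a + d \<le> c + b" "c + f \<le> e + d"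
    then obtain u v where "c + b = a + d + u" "e + d = c + f + v" unfolding le_iff_ex_add by blast
    then have "c + b + (e + d) = a + d + u + (c + f + v)" by simp
    then have "(e + b) + (c + d) = (a + f + (u + v)) + (c + d)" by (simp add: ac_simps)
    then show "a + f \<le> e + b" using natlike_cancel unfolding le_iff_ex_add by blast
  qed
  \<comment> \<open>After changes of sign both factors are nonnegative, hence images of
    numbers.\<close>
  have nzd: "a = 0 \<or> b = 0" if "a * b = 0" for a b :: "'a dif"
  proof -
    have pos: "x = 0 \<or> y = 0" if "x * y = 0" "0 \<le> x" "0 \<le> y" for x y :: "'a dif"
    proof -
      from that obtain n m where "x = abs_dif (n, 0)" "y = abs_dif (m, 0)" "x * y = 0"
        unfolding dif_nonneg by blast
      then show ?thesis
        using natlike_no_zero_divisors[of n m]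
        by (auto simp: times_dif.abs_eq zero_dif_def dif.abs_eq_iff)
    qed
    have neg: "0 \<le> - x" if "\<not> 0 \<le> x" for x :: "'a dif" using tot[of 0 x] add[of x 0 "- x"] that by simp
    show ?thesis
      using pos[of a b] pos[of "- a" b] pos[of a "- b"] pos[of "- a" "- b"] neg[of a] neg[of b] that
      by fastforce
  qed
  show "a < b \<Longrightarrow> 0 < c \<Longrightarrow> c * a < c * b"
  proof -
    assume "a < b" "0 < c"
    then have l: "a \<le> b" "a \<noteq> b" "0 \<le> c" "c \<noteq> 0" by (auto simp: less_dif_def)
    have "0 \<le> b - a" using add[OF l(1), of "- a"] by (simp add: add.commute)
    then have "0 \<le> c * (b - a)" using l by (intro dif_nonneg_mult)
    then have "c * a \<le> c * b" using add[of 0 "c * (b - a)" "c * a"] by (simp add: algebra_simps)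
    moreover have "c * a \<noteq> c * b"
    proof
      assume "c * a = c * b"
      then have "c * (b - a) = 0" by (simp add: algebra_simps)
      then show False using nzd[of c "b - a"] l by auto
    qed
    ultimately show ?thesis using antisym by (auto simp: less_dif_def)
  qed
qed (auto simp: less_dif_def abs_dif_inst sgn_dif_def, transfer, auto)

end

definition emb :: "'n::natlike \<Rightarrow> 'n dif fract" where "emb n = Fract (abs_dif (n, 0)) 1"

lemma emb_simps:
  "emb 0 = 0" "emb 1 = 1" "emb (a + b) = emb a + emb b" "emb (a * b) = emb a * emb b"
  "emb a = emb b \<longleftrightarrow> a = b" "emb a \<le> emb b \<longleftrightarrow> a \<le> b"
  by (simp_all add: emb_def Zero_fract_def One_fract_def eq_fract zero_dif_def[symmetric] one_dif_def[symmetric]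
      plus_dif.abs_eq times_dif.abs_eq dif.abs_eq_iff less_eq_dif.abs_eq)

section \<open>Well-formed formulas under substitution\<close>

text \<open>\<open>wff\<close> is defined by closing named variables and has no inversion rule for \<open>Forall\<close>; the
  following predicates type the dangling indices of a formula by a context instead.\<close>

fun btyof :: "ty list \<Rightarrow> tm \<Rightarrow> ty" where
  "btyof \<Delta> (V x) = snd x"
| "btyof \<Delta> (Bound i) = (if i < length \<Delta> then \<Delta> ! i else Tn)"
| "btyof \<Delta> (Cn c) = cty c"
| "btyof \<Delta> (s \<cdot> t) = (case btyof \<Delta> s of \<sigma> \<rightarrow> \<tau> \<Rightarrow> \<tau> | _ \<Rightarrow> Tn)"

fun bwt :: "ty list \<Rightarrow> tm \<Rightarrow> bool" where
  "bwt \<Delta> (V x) = True"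
| "bwt \<Delta> (Bound i) = (i < length \<Delta>)"
| "bwt \<Delta> (Cn c) = True"
| "bwt \<Delta> (s \<cdot> t) =
    (bwt \<Delta> s \<and> bwt \<Delta> t \<and> (case btyof \<Delta> s of \<sigma> \<rightarrow> \<tau> \<Rightarrow> btyof \<Delta> t = \<sigma> | _ \<Rightarrow> False))"

primrec bwff :: "ty list \<Rightarrow> fm \<Rightarrow> bool" where
  "bwff \<Delta> Fls = True"
| "bwff \<Delta> (s \<doteq> t) = (bwt \<Delta> s \<and> bwt \<Delta> t \<and> btyof \<Delta> s = btyof \<Delta> t)"
| "bwff \<Delta> (St t) = bwt \<Delta> t"
| "bwff \<Delta> (\<phi> \<longrightarrow>\<^sub>f \<psi>) = (bwff \<Delta> \<phi> \<and> bwff \<Delta> \<psi>)"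
| "bwff \<Delta> (Forall \<sigma> \<phi>) = bwff (\<sigma> # \<Delta>) \<phi>"

fun opent :: "var \<Rightarrow> nat \<Rightarrow> tm \<Rightarrow> tm" where
  "opent x k (V y) = V y"
| "opent x k (Bound i) = (if i = k then V x else Bound i)"
| "opent x k (Cn c) = Cn c"
| "opent x k (s \<cdot> t) = opent x k s \<cdot> opent x k t"

primrec openf :: "var \<Rightarrow> nat \<Rightarrow> fm \<Rightarrow> fm" where
  "openf x k Fls = Fls"
| "openf x k (s \<doteq> t) = (opent x k s \<doteq> opent x k t)"
| "openf x k (St t) = St (opent x k t)"
| "openf x k (\<phi> \<longrightarrow>\<^sub>f \<psi>) = (openf x k \<phi> \<longrightarrow>\<^sub>f openf x k \<psi>)"
| "openf x k (Forall \<sigma> \<phi>) = Forall \<sigma> (openf x (Suc k) \<phi>)"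

lemma btyof_wt: "wt t \<Longrightarrow> btyof \<Delta> t = tyof t"
  by (induction t) (auto split: ty.splits)

lemma bwt_wt: "wt t \<Longrightarrow> bwt \<Delta> t"
  by (induction t) (auto simp: btyof_wt split: ty.splits)

lemma btyof_Nil: "btyof [] t = tyof t"
  by (induction t) auto

lemma bwt_Nil: "bwt [] t = wt t"
  by (induction t) (auto simp: btyof_Nil cong: ty.case_cong split: ty.splits)

text \<open>The index introduced by closing is the outermost one, so its type is appended to the
  context, whereas a quantifier met on the way down puts its type in front.\<close>

lemma closet_typed:
  assumes "bwt \<Delta> t"
  shows "bwt (\<Delta> @ [snd x]) (closet x (length \<Delta>) t)
    \<and> btyof (\<Delta> @ [snd x]) (closet x (length \<Delta>) t) = btyof \<Delta> t"
  using assms by (induction t) (auto simp: nth_append split: ty.splits)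

lemma bwff_close: "bwff \<Delta> \<phi> \<Longrightarrow> bwff (\<Delta> @ [snd x]) (close x (length \<Delta>) \<phi>)"
proof (induction \<phi> arbitrary: \<Delta>)
  case (Forall \<sigma> \<phi>)
  then show ?case using Forall.IH[of "\<sigma> # \<Delta>"] by simp
qed (auto simp: closet_typed)

lemma wff_imp_bwff: "wff \<phi> \<Longrightarrow> bwff [] \<phi>"
proof (induction rule: wff.induct)
  case (wff_all \<phi> x)
  then show ?case using bwff_close[of "[]" \<phi> x] by (simp add: all_def)
qed (auto simp: bwt_wt btyof_wt)

lemma opent_typed:
  assumes "bwt (\<Delta> @ [snd x]) t"
  shows "bwt \<Delta> (opent x (length \<Delta>) t)
    \<and> btyof \<Delta> (opent x (length \<Delta>) t) = btyof (\<Delta> @ [snd x]) t"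
  using assms by (induction t) (auto simp: nth_append less_Suc_eq split: ty.splits)

lemma bwff_openf: "bwff (\<Delta> @ [snd x]) \<phi> \<Longrightarrow> bwff \<Delta> (openf x (length \<Delta>) \<phi>)"
proof (induction \<phi> arbitrary: \<Delta>)
  case (Forall \<sigma> \<phi>)
  then show ?case using Forall.IH[of "\<sigma> # \<Delta>"] by simp
qed (auto simp: opent_typed)

lemma closet_opent: "x \<notin> fvt t \<Longrightarrow> closet x k (opent x k t) = t"
  by (induction t) auto

lemma close_openf: "x \<notin> fv \<phi> \<Longrightarrow> close x k (openf x k \<phi>) = \<phi>"
  by (induction \<phi> arbitrary: k) (auto simp: closet_opent)

primrec fsize :: "fm \<Rightarrow> nat" where
  "fsize Fls = 0"
| "fsize (s \<doteq> t) = 0"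
| "fsize (St t) = 0"
| "fsize (\<phi> \<longrightarrow>\<^sub>f \<psi>) = Suc (fsize \<phi> + fsize \<psi>)"
| "fsize (Forall \<sigma> \<phi>) = Suc (fsize \<phi>)"

lemma fsize_openf [simp]: "fsize (openf x k \<phi>) = fsize \<phi>"
  by (induction \<phi> arbitrary: k) auto

lemma fsize_close [simp]: "fsize (close x k \<phi>) = fsize \<phi>"
  by (induction \<phi> arbitrary: k) auto

lemma fsize_subst [simp]: "fsize (subst x t \<phi>) = fsize \<phi>"
  by (induction \<phi>) auto

lemma finite_fvt [simp]: "finite (fvt t)"
  by (induction t) auto

lemma finite_fv [simp]: "finite (fv \<phi>)"
  by (induction \<phi>) auto

lemma fresh_var: "finite X \<Longrightarrow> \<exists>n. (n, \<sigma>::ty) \<notin> (X :: var set)"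
proof (rule ccontr)
  assume "finite X" "\<nexists>n. (n, \<sigma>) \<notin> X"
  then have "finite (range (\<lambda>n::nat. (n, \<sigma>)))" by (auto intro: finite_subset)
  then have "finite (UNIV :: nat set)" by (rule finite_imageD) (simp add: inj_on_def)
  then show False by simp
qed

text \<open>A formula \<open>Forall\<close> is \<open>all x\<close> applied to its body opened with
  a fresh variable x. The opened body is not a subformula, hence the induction on size.\<close>

lemma bwff_imp_wff: "bwff [] \<phi> \<Longrightarrow> wff \<phi>"
proof (induction "fsize \<phi>" arbitrary: \<phi> rule: less_induct)
  case less
  show ?case
  proof (cases \<phi>)
    case (Forall \<sigma> \<psi>)
    obtain n where n: "(n, \<sigma>) \<notin> fv \<psi>" using fresh_var[of "fv \<psi>"] by auto
    let ?x = "(n, \<sigma>)"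
    have "wff (openf ?x 0 \<psi>)"
      using less bwff_openf[of "[]" ?x \<psi>] Forall by simp
    then have "wff (all ?x (openf ?x 0 \<psi>))" by (rule wff_all)
    then show ?thesis using n Forall by (simp add: all_def close_openf)
  qed (use less in \<open>auto simp: bwt_Nil btyof_Nil intro: wff.intros\<close>)
qed

lemma wff_iff_bwff: "wff \<phi> \<longleftrightarrow> bwff [] \<phi>"
  using bwff_imp_wff wff_imp_bwff by blast

lemma substt_typed:
  assumes "bwt \<Delta> t" "wt u" "tyof u = snd x"
  shows "bwt \<Delta> (substt x u t) \<and> btyof \<Delta> (substt x u t) = btyof \<Delta> t"
  using assms by (induction t) (auto simp: bwt_wt btyof_wt split: ty.splits)

lemma bwff_subst: "bwff \<Delta> \<phi> \<Longrightarrow> wt u \<Longrightarrow> tyof u = snd x \<Longrightarrow> bwff \<Delta> (subst x u \<phi>)"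
  by (induction \<phi> arbitrary: \<Delta>) (auto simp: substt_typed)

lemma wff_subst: "wff \<phi> \<Longrightarrow> wt u \<Longrightarrow> tyof u = snd x \<Longrightarrow> wff (subst x u \<phi>)"
  by (simp add: wff_iff_bwff bwff_subst)

lemma wff_Imp_iff [simp]: "wff (\<phi> \<longrightarrow>\<^sub>f \<psi>) \<longleftrightarrow> wff \<phi> \<and> wff \<psi>"
  and wff_Eq_iff [simp]: "wff (s \<doteq> t) \<longleftrightarrow> wt s \<and> wt t \<and> tyof s = tyof t"
  and wff_St_iff [simp]: "wff (St t) \<longleftrightarrow> wt t"
  and wff_Fls' [simp]: "wff Fls"
  by (auto simp: wff_iff_bwff bwt_Nil btyof_Nil)

lemma wff_Neg [simp]: "wff (\<not>\<^sub>f \<phi>) \<longleftrightarrow> wff \<phi>"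
  by (simp add: Neg_def)

lemma derives_wff: "\<Gamma> \<turnstile>\<^sub>P \<phi> \<Longrightarrow> wff \<phi>"
  by (induction rule: derives.induct) (auto intro: wff_all wff_subst)

lemma substt_self [simp]: "substt x (V x) t = t"
  by (induction t) auto

lemma subst_self [simp]: "subst x (V x) \<phi> = \<phi>"
  by (induction \<phi>) auto

lemma fvt_closet: "fvt (closet x k t) = fvt t - {x}"
  by (induction t) auto

lemma fv_close: "fv (close x k \<phi>) = fv \<phi> - {x}"
  by (induction \<phi> arbitrary: k) (auto simp: fvt_closet)

lemma fv_all [simp]: "fv (all x \<phi>) = fv \<phi> - {x}"
  by (simp add: all_def fv_close)

section \<open>A Hilbert-style calculus\<close>

text \<open>Only derivations without assumptions are used from here on: weakening fails to be immediate
  for \<open>\<turnstile>\<^sub>P\<close> because of the variable condition of \<open>AllI\<close>.\<close>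

inductive hil :: "fm set \<Rightarrow> fm \<Rightarrow> bool" (infix "\<turnstile>\<^sub>H" 45) for S where
  hil_thm: "{} \<turnstile>\<^sub>P \<phi> \<Longrightarrow> S \<turnstile>\<^sub>H \<phi>"
| hil_asm: "\<lbrakk>\<phi> \<in> S; wff \<phi>\<rbrakk> \<Longrightarrow> S \<turnstile>\<^sub>H \<phi>"
| hil_mp: "\<lbrakk>S \<turnstile>\<^sub>H (\<phi> \<longrightarrow>\<^sub>f \<psi>); S \<turnstile>\<^sub>H \<phi>\<rbrakk> \<Longrightarrow> S \<turnstile>\<^sub>H \<psi>"

lemma hil_wff: "S \<turnstile>\<^sub>H \<phi> \<Longrightarrow> wff \<phi>"
  by (induction rule: hil.induct) (auto dest: derives_wff)

lemma hil_mono: "S \<turnstile>\<^sub>H \<phi> \<Longrightarrow> S \<subseteq> S' \<Longrightarrow> S' \<turnstile>\<^sub>H \<phi>"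
  by (induction rule: hil.induct) (auto intro: hil.intros)

lemma hil_finite: "S \<turnstile>\<^sub>H \<phi> \<Longrightarrow> \<exists>S0. finite S0 \<and> S0 \<subseteq> S \<and> S0 \<turnstile>\<^sub>H \<phi>"
proof (induction rule: hil.induct)
  case (hil_thm \<phi>)
  then show ?case by (intro exI[of _ "{}"]) (auto intro: hil.intros)
next
  case (hil_asm \<phi>)
  then show ?case by (intro exI[of _ "{\<phi>}"]) (auto intro: hil.intros)
next
  case (hil_mp \<phi> \<psi>)
  then obtain A B where "finite A" "finite B" "A \<subseteq> S" "B \<subseteq> S" "A \<turnstile>\<^sub>H (\<phi> \<longrightarrow>\<^sub>f \<psi>)" "B \<turnstile>\<^sub>H \<phi>"
    by blast
  moreover from this have "A \<union> B \<turnstile>\<^sub>H \<psi>"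
    using hil_mono[of A _ "A \<union> B"] hil_mono[of B _ "A \<union> B"] by (meson hil.hil_mp sup_ge1 sup_ge2)
  ultimately show ?case by (intro exI[of _ "A \<union> B"]) simp
qed

lemma derives_K: "wff \<phi> \<Longrightarrow> wff \<psi> \<Longrightarrow> {} \<turnstile>\<^sub>P (\<phi> \<longrightarrow>\<^sub>f \<psi> \<longrightarrow>\<^sub>f \<phi>)"
  by (rule ImpI, simp, rule ImpI, simp, rule Assm, auto)

lemma derives_S:
  assumes "wff \<phi>" "wff \<psi>" "wff \<chi>"
  shows "{} \<turnstile>\<^sub>P ((\<phi> \<longrightarrow>\<^sub>f \<psi> \<longrightarrow>\<^sub>f \<chi>) \<longrightarrow>\<^sub>f (\<phi> \<longrightarrow>\<^sub>f \<psi>) \<longrightarrow>\<^sub>f \<phi> \<longrightarrow>\<^sub>f \<chi>)"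
proof -
  let ?G = "{\<phi>, \<phi> \<longrightarrow>\<^sub>f \<psi>, \<phi> \<longrightarrow>\<^sub>f \<psi> \<longrightarrow>\<^sub>f \<chi>}"
  have a: "?G \<turnstile>\<^sub>P \<theta>" if "\<theta> \<in> ?G" for \<theta>
    using that assms by (intro Assm) auto
  have "?G \<turnstile>\<^sub>P \<chi>"
    using a[of \<phi>] a[of "\<phi> \<longrightarrow>\<^sub>f \<psi>"] a[of "\<phi> \<longrightarrow>\<^sub>f \<psi> \<longrightarrow>\<^sub>f \<chi>"]
      ImpE[of ?G \<phi> \<psi>] ImpE[of ?G \<psi> \<chi>] ImpE[of ?G \<phi> "\<psi> \<longrightarrow>\<^sub>f \<chi>"] by simp
  then show ?thesis using assms by (intro ImpI) simp_all
qed

lemma derives_dne: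
  assumes "wff \<phi>"
  shows "{} \<turnstile>\<^sub>P (\<not>\<^sub>f (\<not>\<^sub>f \<phi>) \<longrightarrow>\<^sub>f \<phi>)"
proof -
  let ?G = "{\<not>\<^sub>f \<phi>, \<not>\<^sub>f (\<not>\<^sub>f \<phi>)}"
  have "?G \<turnstile>\<^sub>P (\<not>\<^sub>f \<phi> \<longrightarrow>\<^sub>f Fls)" using assms by (intro Assm) (simp_all add: Neg_def)
  moreover have "?G \<turnstile>\<^sub>P \<not>\<^sub>f \<phi>" using assms by (intro Assm) simp_all
  ultimately have "?G \<turnstile>\<^sub>P Fls" by (rule ImpE)
  then have "{\<not>\<^sub>f (\<not>\<^sub>f \<phi>)} \<turnstile>\<^sub>P \<phi>" by (rule Contr[rotated]) (use assms in simp)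
  then show ?thesis using assms by (intro ImpI) simp_all
qed

lemma derives_efq:
  assumes "wff \<phi>" "wff \<psi>"
  shows "{} \<turnstile>\<^sub>P (\<not>\<^sub>f \<phi> \<longrightarrow>\<^sub>f \<phi> \<longrightarrow>\<^sub>f \<psi>)"
proof -
  let ?G = "{\<not>\<^sub>f \<psi>, \<phi>, \<not>\<^sub>f \<phi>}"
  have "?G \<turnstile>\<^sub>P (\<phi> \<longrightarrow>\<^sub>f Fls)" using assms by (intro Assm) (simp_all add: Neg_def)
  moreover have "?G \<turnstile>\<^sub>P \<phi>" using assms by (intro Assm) simp_all
  ultimately have "?G \<turnstile>\<^sub>P Fls" by (rule ImpE)
  then have "{\<phi>, \<not>\<^sub>f \<phi>} \<turnstile>\<^sub>P \<psi>" by (rule Contr[rotated]) (use assms in simp)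
  then show ?thesis using assms by (intro ImpI) simp_all
qed

lemma derives_all_inst:
  assumes "wff \<phi>" "wt t" "tyof t = snd x"
  shows "{} \<turnstile>\<^sub>P (all x \<phi> \<longrightarrow>\<^sub>f subst x t \<phi>)"
proof (rule ImpI)
  show "{all x \<phi>} \<turnstile>\<^sub>P subst x t \<phi>"
    using assms by (intro AllE Assm) (simp_all add: wff_all)
qed (use assms in \<open>simp add: wff_all\<close>)

lemma derives_all_mp:
  assumes "wff \<phi>" "wff \<psi>"
  shows "{} \<turnstile>\<^sub>P (all x (\<phi> \<longrightarrow>\<^sub>f \<psi>) \<longrightarrow>\<^sub>f all x \<phi> \<longrightarrow>\<^sub>f all x \<psi>)"
proof -
  let ?G = "{all x \<phi>, all x (\<phi> \<longrightarrow>\<^sub>f \<psi>)}"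
  have "?G \<turnstile>\<^sub>P (\<phi> \<longrightarrow>\<^sub>f \<psi>)"
    using AllE[of ?G x "\<phi> \<longrightarrow>\<^sub>f \<psi>" "V x"] assms Assm[of "all x (\<phi> \<longrightarrow>\<^sub>f \<psi>)" ?G] wff_all[of "\<phi> \<longrightarrow>\<^sub>f \<psi>"] by simp
  moreover have "?G \<turnstile>\<^sub>P \<phi>"
    using AllE[of ?G x \<phi> "V x"] assms Assm[of "all x \<phi>" ?G] wff_all[of \<phi>] by simp
  ultimately have "?G \<turnstile>\<^sub>P \<psi>" by (rule ImpE)
  then have "?G \<turnstile>\<^sub>P all x \<psi>" by (rule AllI) auto
  then show ?thesis using assms by (intro ImpI wff_all) auto
qed

lemma derives_all_vacuous:
  assumes "wff \<phi>" "x \<notin> fv \<phi>"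
  shows "{} \<turnstile>\<^sub>P (\<phi> \<longrightarrow>\<^sub>f all x \<phi>)"
proof (rule ImpI)
  show "{\<phi>} \<turnstile>\<^sub>P all x \<phi>" using assms by (intro AllI Assm) simp_all
qed (use assms in simp)

text \<open>Since generalisation is not a rule of this calculus, the deduction theorem comes without
  a condition on variables.\<close>

lemma hil_deduction: "insert \<phi> S \<turnstile>\<^sub>H \<psi> \<Longrightarrow> wff \<phi> \<Longrightarrow> S \<turnstile>\<^sub>H (\<phi> \<longrightarrow>\<^sub>f \<psi>)"
proof (induction rule: hil.induct)
  case (hil_thm \<psi>)
  then show ?case by (meson derives_K derives_wff hil.hil_mp hil.hil_thm)
next
  case (hil_asm \<psi>)
  show ?case
  proof (cases "\<psi> = \<phi>")
    case True
    have "{} \<turnstile>\<^sub>P (\<phi> \<longrightarrow>\<^sub>f \<phi>)" using hil_asm by (intro ImpI Assm) auto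
    then show ?thesis using True by (simp add: hil.hil_thm)
  next
    case False
    then have "S \<turnstile>\<^sub>H \<psi>" using hil_asm by (auto intro: hil.hil_asm)
    then show ?thesis
      using derives_K[of \<psi> \<phi>] hil_asm by (auto intro: hil.hil_mp[of S \<psi>] hil.hil_thm)
  qed
next
  case (hil_mp \<chi> \<psi>)
  then show ?case by (meson derives_S hil.hil_mp hil.hil_thm hil_wff wff_Imp_iff)
qed

lemma hil_contr: "insert (\<not>\<^sub>f \<phi>) S \<turnstile>\<^sub>H Fls \<Longrightarrow> wff \<phi> \<Longrightarrow> S \<turnstile>\<^sub>H \<phi>"
  using hil_deduction[of "\<not>\<^sub>f \<phi>" S Fls] derives_dne[of \<phi>] hil_mp hil_thm
  by (metis Neg_def wff_Neg)

text \<open>Generalisation is admissible: theorems are generalised in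
  \<open>\<turnstile>\<^sub>P\<close>, assumptions by vacuous quantification, and modus ponens by
  distributing the quantifier over the implication.\<close>

lemma hil_gen: "S \<turnstile>\<^sub>H \<phi> \<Longrightarrow> \<forall>\<psi>\<in>S. x \<notin> fv \<psi> \<Longrightarrow> S \<turnstile>\<^sub>H all x \<phi>"
proof (induction rule: hil.induct)
  case (hil_thm \<phi>)
  then show ?case by (auto intro!: hil.hil_thm AllI)
next
  case (hil_asm \<phi>)
  then show ?case using derives_all_vacuous[of \<phi> x]
    by (blast intro: hil.hil_mp[of S \<phi>] hil.hil_asm hil.hil_thm)
next
  case (hil_mp \<phi> \<psi>)
  then show ?case by (meson derives_all_mp hil.hil_mp hil.hil_thm hil_wff wff_Imp_iff)
qed

lemma hil_empty: "{} \<turnstile>\<^sub>H \<phi> \<Longrightarrow> {} \<turnstile>\<^sub>P \<phi>"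
  by (induction rule: hil.induct) (auto intro: ImpE)

section \<open>Structures and models\<close>

locale tstruct =
  fixes D :: "ty \<Rightarrow> 'a set" and ap :: "'a \<Rightarrow> 'a \<Rightarrow> 'a" and ci :: "cnst \<Rightarrow> 'a" and st :: "'a \<Rightarrow> bool"
begin

primrec valb :: "(var \<Rightarrow> 'a) \<Rightarrow> (nat \<Rightarrow> 'a) \<Rightarrow> tm \<Rightarrow> 'a" where
  "valb e b (V x) = e x"
| "valb e b (Bound i) = b i"
| "valb e b (Cn c) = ci c"
| "valb e b (s \<cdot> t) = ap (valb e b s) (valb e b t)"

primrec satb :: "(var \<Rightarrow> 'a) \<Rightarrow> (nat \<Rightarrow> 'a) \<Rightarrow> fm \<Rightarrow> bool" where
  "satb e b Fls = False"
| "satb e b (s \<doteq> t) = (valb e b s = valb e b t)"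
| "satb e b (St t) = st (valb e b t)"
| "satb e b (\<phi> \<longrightarrow>\<^sub>f \<psi>) = (satb e b \<phi> \<longrightarrow> satb e b \<psi>)"
| "satb e b (Forall \<sigma> \<phi>) = (\<forall>d\<in>D \<sigma>. satb e (case_nat d b) \<phi>)"

definition val :: "(var \<Rightarrow> 'a) \<Rightarrow> tm \<Rightarrow> 'a" where "val e t = valb e (\<lambda>_. undefined) t"
definition sat :: "(var \<Rightarrow> 'a) \<Rightarrow> fm \<Rightarrow> bool" where "sat e \<phi> = satb e (\<lambda>_. undefined) \<phi>"
definition good :: "(var \<Rightarrow> 'a) \<Rightarrow> bool" where "good e \<longleftrightarrow> (\<forall>x. e x \<in> D (snd x))"

lemma valb_cong: "bwt \<Delta> t \<Longrightarrow> \<forall>i<length \<Delta>. b i = b' i \<Longrightarrow> valb e b t = valb e b' t"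
  by (induction t) auto

lemma satb_cong: "bwff \<Delta> \<phi> \<Longrightarrow> \<forall>i<length \<Delta>. b i = b' i \<Longrightarrow> satb e b \<phi> = satb e b' \<phi>"
proof (induction \<phi> arbitrary: \<Delta> b b')
  case (Forall \<sigma> \<phi>)
  have "satb e (case_nat d b) \<phi> = satb e (case_nat d b') \<phi>" for d
    using Forall.prems by (intro Forall.IH[of "\<sigma> # \<Delta>"]) (auto split: nat.splits)
  then show ?case by simp
next
  case (Eq s t)
  then show ?case using valb_cong[of \<Delta> s b b'] valb_cong[of \<Delta> t b b'] by simp
next
  case (St t)
  then show ?case using valb_cong[of \<Delta> t b b'] by simp
next
  case (Imp \<phi> \<psi>)
  then show ?case using Imp.IH[of \<Delta> b b'] by simp
qed simp

lemma valb_close: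
  "bwt \<Delta> t \<Longrightarrow> b (length \<Delta>) = d \<Longrightarrow> valb e b (closet x (length \<Delta>) t) = valb (e(x := d)) b t"
  by (induction t) auto

lemma satb_close:
  "bwff \<Delta> \<phi> \<Longrightarrow> b (length \<Delta>) = d \<Longrightarrow> satb e b (close x (length \<Delta>) \<phi>) = satb (e(x := d)) b \<phi>"
proof (induction \<phi> arbitrary: \<Delta> b)
  case (Forall \<sigma> \<phi>)
  have "satb e (case_nat c b) (close x (length (\<sigma> # \<Delta>)) \<phi>) = satb (e(x := d)) (case_nat c b) \<phi>" for c
    using Forall.prems by (intro Forall.IH) auto
  then show ?case by (simp add: fun_upd_def)
qed (auto simp: valb_close)

lemma val_V [simp]: "val e (V x) = e x"
  and val_Cn [simp]: "val e (Cn c) = ci c"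
  and val_App [simp]: "val e (s \<cdot> t) = ap (val e s) (val e t)"
  by (auto simp: val_def)

lemma sat_Fls [simp]: "\<not> sat e Fls"
  and sat_Eq [simp]: "sat e (s \<doteq> t) \<longleftrightarrow> val e s = val e t"
  and sat_St [simp]: "sat e (St t) \<longleftrightarrow> st (val e t)"
  and sat_Imp [simp]: "sat e (\<phi> \<longrightarrow>\<^sub>f \<psi>) \<longleftrightarrow> (sat e \<phi> \<longrightarrow> sat e \<psi>)"
  by (auto simp: sat_def val_def)

lemma sat_all [simp]:
  assumes "wff \<phi>"
  shows "sat e (all x \<phi>) \<longleftrightarrow> (\<forall>d\<in>D (snd x). sat (e(x := d)) \<phi>)"
proof -
  have b: "bwff [] \<phi>" using assms by (simp add: wff_iff_bwff)
  have "satb e (case_nat d b) (close x 0 \<phi>) = satb (e(x := d)) b \<phi>" for d b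
  proof -
    have "satb e (case_nat d b) (close x 0 \<phi>) = satb (e(x := d)) (case_nat d b) \<phi>"
      using satb_close[OF b, of "case_nat d b" d e x] by simp
    also have "\<dots> = satb (e(x := d)) b \<phi>" by (rule satb_cong[OF b]) simp
    finally show ?thesis .
  qed
  then show ?thesis by (simp add: sat_def all_def)
qed

lemma sat_Neg [simp]: "sat e (\<not>\<^sub>f \<phi>) \<longleftrightarrow> \<not> sat e \<phi>"
  by (simp add: Neg_def)

lemma val_cong: "\<forall>x\<in>fvt t. e x = e' x \<Longrightarrow> val e t = val e' t"
  unfolding val_def by (induction t) auto

lemma valb_cong_env: "\<forall>x\<in>fvt t. e x = e' x \<Longrightarrow> valb e b t = valb e' b t"
  by (induction t) auto

lemma sat_cong: "\<forall>x\<in>fv \<phi>. e x = e' x \<Longrightarrow> sat e \<phi> = sat e' \<phi>"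
proof -
  have "\<forall>x\<in>fv \<phi>. e x = e' x \<Longrightarrow> satb e b \<phi> = satb e' b \<phi>" for b
  proof (induction \<phi> arbitrary: b)
    case (Eq s t)
    then show ?case using valb_cong_env[of s e e' b] valb_cong_env[of t e e' b] by simp
  next
    case (St t)
    then show ?case using valb_cong_env[of t e e' b] by simp
  qed simp_all
  then show "\<forall>x\<in>fv \<phi>. e x = e' x \<Longrightarrow> sat e \<phi> = sat e' \<phi>" by (simp add: sat_def)
qed

lemma valb_subst: "wt u \<Longrightarrow> valb e b (substt x u t) = valb (e(x := val e u)) b t"
  using valb_cong[of "[]" u b "\<lambda>_. undefined" e] by (induction t) (simp_all add: val_def bwt_Nil)

lemma sat_subst: "wt u \<Longrightarrow> sat e (subst x u \<phi>) = sat (e(x := val e u)) \<phi>"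
proof -
  assume "wt u"
  then have "satb e b (subst x u \<phi>) = satb (e(x := val e u)) b \<phi>" for b
    by (induction \<phi> arbitrary: b) (simp_all add: valb_subst)
  then show ?thesis by (simp add: sat_def)
qed

end

locale P_model = tstruct +
  assumes ci_D [simp]: "ci c \<in> D (cty c)"
    and ap_D: "\<lbrakk>f \<in> D (\<sigma> \<rightarrow> \<tau>); a \<in> D \<sigma>\<rbrakk> \<Longrightarrow> ap f a \<in> D \<tau>"
    and sat_ax: "\<lbrakk>\<phi> \<in> P_axioms; wff \<phi>; good e\<rbrakk> \<Longrightarrow> sat e \<phi>"

section \<open>Completeness\<close>

instance ty :: countable by countable_datatype
instance cnst :: countable by countable_datatype
instance tm :: countable by countable_datatype
instance fm :: countable by countable_datatype

definition con :: "fm set \<Rightarrow> bool" where "con S \<longleftrightarrow> \<not> S \<turnstile>\<^sub>H Fls"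

text \<open>One stage of the Henkin construction. The sets remain finite, so some variable of the
  required type is free in none of their formulas and can act as the witness; the language needs no
  new constants.\<close>

lemma con_step:
  assumes "finite S" "con S"
  shows "\<exists>S'. finite S' \<and> con S' \<and> S \<subseteq> S' \<and> (wff \<psi> \<and> con (insert \<psi> S) \<longrightarrow> \<psi> \<in> S')
    \<and> (\<forall>\<sigma> \<chi>. \<psi> = \<not>\<^sub>f (Forall \<sigma> \<chi>) \<and> wff \<psi> \<and> con (insert \<psi> S) \<longrightarrow>
        (\<exists>y \<chi>'. snd y = \<sigma> \<and> close y 0 \<chi>' = \<chi> \<and> wff \<chi>' \<and> \<not>\<^sub>f \<chi>' \<in> S'))"
proof (cases "wff \<psi> \<and> con (insert \<psi> S)")
  case True
  show ?thesis
  proof (cases "\<exists>\<sigma> \<chi>. \<psi> = \<not>\<^sub>f (Forall \<sigma> \<chi>)")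
    case t: True
    then obtain \<sigma> \<chi> where \<psi>: "\<psi> = \<not>\<^sub>f (Forall \<sigma> \<chi>)" by blast
    obtain n where n: "(n, \<sigma>) \<notin> (\<Union>(fv ` insert \<psi> S))"
      using fresh_var[of "\<Union>(fv ` insert \<psi> S)"] assms by auto
    let ?y = "(n, \<sigma>)" and ?c = "openf (n, \<sigma>) 0 \<chi>"
    have c: "close ?y 0 ?c = \<chi>" using n \<psi> by (intro close_openf) (auto simp: Neg_def)
    have w: "wff ?c" using True \<psi> bwff_openf[of "[]" ?y \<chi>] by (simp add: wff_iff_bwff Neg_def)
    \<comment> \<open>Otherwise the opened body would be derivable, and generalising over the fresh
      variable would contradict \<psi>.\<close>
    have "con (insert (\<not>\<^sub>f ?c) (insert \<psi> S))"
    proof (rule ccontr)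
      assume "\<not> ?thesis"
      then have "insert \<psi> S \<turnstile>\<^sub>H ?c" using w by (auto simp: con_def intro: hil_contr)
      then have "insert \<psi> S \<turnstile>\<^sub>H all ?y ?c" using n by (auto intro: hil_gen)
      moreover have "insert \<psi> S \<turnstile>\<^sub>H (all ?y ?c \<longrightarrow>\<^sub>f Fls)"
        using \<psi> True c by (auto simp: all_def Neg_def intro!: hil_asm)
      ultimately show False using True hil_mp con_def by blast
    qed
    then show ?thesis using \<psi> c w assms True
      by (intro exI[of _ "insert (\<not>\<^sub>f ?c) (insert \<psi> S)"]) (auto simp: Neg_def intro!: exI[of _ n] exI[of _ ?c])
  next
    case False
    then show ?thesis using True assms by (intro exI[of _ "insert \<psi> S"]) auto
  qed
next
  case False
  then show ?thesis using assms by (intro exI[of _ S]) auto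
qed

lemma henkin_extension:
  assumes "wff \<phi>0" "con {\<phi>0}"
  obtains T where "\<phi>0 \<in> T" "\<And>\<phi>. wff \<phi> \<Longrightarrow> T \<turnstile>\<^sub>H \<phi> \<longleftrightarrow> \<phi> \<in> T" "con T"
    "\<And>\<phi>. wff \<phi> \<Longrightarrow> \<not>\<^sub>f \<phi> \<in> T \<longleftrightarrow> \<phi> \<notin> T"
    "\<And>\<sigma> \<chi>. \<lbrakk>wff (Forall \<sigma> \<chi>); Forall \<sigma> \<chi> \<notin> T\<rbrakk> \<Longrightarrow>
      \<exists>y \<chi>'. snd y = \<sigma> \<and> close y 0 \<chi>' = \<chi> \<and> wff \<chi>' \<and> \<chi>' \<notin> T"
proof -
  \<comment> \<open>The enumeration \<open>from_nat\<close> reaches every formula; \<psi> is treated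
    at stage \<open>to_nat \<psi>\<close>, together with its witness if it is a negated universal
    formula.\<close>
  define R where "R n S S' \<longleftrightarrow> S \<subseteq> S' \<and> (wff (from_nat n) \<and> con (insert (from_nat n) S) \<longrightarrow> from_nat n \<in> S')
    \<and> (\<forall>\<sigma> \<chi>. from_nat n = \<not>\<^sub>f (Forall \<sigma> \<chi>) \<and> wff (from_nat n) \<and> con (insert (from_nat n) S) \<longrightarrow>
        (\<exists>y \<chi>'. snd y = \<sigma> \<and> close y 0 \<chi>' = \<chi> \<and> wff \<chi>' \<and> \<not>\<^sub>f \<chi>' \<in> S'))" for n and S S' :: "fm set"
  obtain F where F: "\<And>n. finite (F n) \<and> con (F n) \<and> \<phi>0 \<in> F n" "\<And>n. R n (F n) (F (Suc n))"
  proof -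
    have "\<exists>F. \<forall>n. (finite (F n) \<and> con (F n) \<and> \<phi>0 \<in> F n) \<and> R n (F n) (F (Suc n))"
    proof (rule dependent_nat_choice)
      show "\<exists>S. finite S \<and> con S \<and> \<phi>0 \<in> S" using assms by blast
      fix S n assume "finite S \<and> con S \<and> \<phi>0 \<in> S"
      then show "\<exists>S'. (finite S' \<and> con S' \<and> \<phi>0 \<in> S') \<and> R n S S'"
        using con_step[of S "from_nat n"] unfolding R_def by blast
    qed
    then show ?thesis using that by blast
  qed
  define T where "T = (\<Union>n. F n)"
  have F1: "F n \<subseteq> F (Suc n)" for n
    by (rule F(2)[of n, unfolded R_def, THEN conjunct1])
  have F2: "\<psi> \<in> F (Suc (to_nat \<psi>))" if "wff \<psi>" "con (insert \<psi> (F (to_nat \<psi>)))" for \<psi>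
    using F(2)[of "to_nat \<psi>", unfolded R_def from_nat_to_nat, THEN conjunct2, THEN conjunct1] that by blast
  have F3: "\<exists>y \<chi>'. snd y = \<sigma> \<and> close y 0 \<chi>' = \<chi> \<and> wff \<chi>' \<and> \<not>\<^sub>f \<chi>' \<in> F (Suc (to_nat \<psi>))"
    if "wff \<psi>" "con (insert \<psi> (F (to_nat \<psi>)))" "\<psi> = \<not>\<^sub>f (Forall \<sigma> \<chi>)" for \<psi> \<sigma> \<chi>
    using F(2)[of "to_nat \<psi>", unfolded R_def from_nat_to_nat, THEN conjunct2, THEN conjunct2] that by blast
  have mono: "F m \<subseteq> F n" if "m \<le> n" for m n
    by (rule lift_Suc_mono_le[of F, OF F1 that])
  have conT: "con T"
  proof (rule ccontr)
    assume "\<not> con T"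
    then obtain S0 where S0: "finite S0" "S0 \<subseteq> T" "S0 \<turnstile>\<^sub>H Fls"
      using hil_finite[of T Fls] unfolding con_def by blast
    have "\<exists>n. S0 \<subseteq> F n" using S0(1,2)
    proof (induction S0)
      case (insert x S)
      then obtain n m where "S \<subseteq> F n" "x \<in> F m" unfolding T_def by blast
      then show ?case using mono[of n "max n m"] mono[of m "max n m"] by (intro exI[of _ "max n m"]) auto
    qed simp
    then show False using S0(3) hil_mono F(1) con_def by blast
  qed
  have in_step: "\<psi> \<in> F (Suc (to_nat \<psi>))" if "wff \<psi>" "con (insert \<psi> T)" for \<psi>
  proof -
    have "con (insert \<psi> (F (to_nat \<psi>)))"
      using that hil_mono[of "insert \<psi> (F (to_nat \<psi>))" Fls "insert \<psi> T"] unfolding con_def T_def by blast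
    then show ?thesis using F2 that(1) by simp
  qed
  have neg: "T \<turnstile>\<^sub>H \<not>\<^sub>f \<psi>" if "wff \<psi>" "\<psi> \<notin> T" for \<psi>
    using in_step[of \<psi>] that hil_deduction[of \<psi> T Fls] unfolding con_def T_def Neg_def by blast
  have closed: "T \<turnstile>\<^sub>H \<psi> \<longleftrightarrow> \<psi> \<in> T" if "wff \<psi>" for \<psi>
    using neg[OF that] that hil_asm[of \<psi> T] hil_mp[of T \<psi> Fls] conT unfolding Neg_def con_def by blast
  have dec: "\<not>\<^sub>f \<psi> \<in> T \<longleftrightarrow> \<psi> \<notin> T" if "wff \<psi>" for \<psi>
    using neg[OF that] closed[of \<psi>] closed[of "\<not>\<^sub>f \<psi>"] that hil_mp[of T \<psi> Fls] conT
    unfolding con_def by (simp add: Neg_def) blast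
  have wit: "\<exists>y \<chi>'. snd y = \<sigma> \<and> close y 0 \<chi>' = \<chi> \<and> wff \<chi>' \<and> \<chi>' \<notin> T"
    if "wff (Forall \<sigma> \<chi>)" "Forall \<sigma> \<chi> \<notin> T" for \<sigma> \<chi>
  proof -
    let ?p = "\<not>\<^sub>f (Forall \<sigma> \<chi>)"
    have "?p \<in> T" using dec that by simp
    then have "insert ?p (F (to_nat ?p)) \<subseteq> T" unfolding T_def by blast
    then have "con (insert ?p (F (to_nat ?p)))"
      using conT hil_mono[of "insert ?p (F (to_nat ?p))" Fls T] unfolding con_def by blast
    moreover have "wff ?p" using that(1) by simp
    ultimately obtain y \<chi>' where y: "snd y = \<sigma>" "close y 0 \<chi>' = \<chi>" "wff \<chi>'"
        "\<not>\<^sub>f \<chi>' \<in> F (Suc (to_nat ?p))"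
      using F3[of ?p, OF _ _ refl] by metis
    then have "\<not>\<^sub>f \<chi>' \<in> T" unfolding T_def by blast
    then show ?thesis using dec[OF y(3)] y by blast
  qed
  have "\<phi>0 \<in> T" using F(1)[of 0] unfolding T_def by blast
  then show ?thesis by (rule that[OF _ closed conT dec wit])
qed

text \<open>The models have the fixed carrier type \<open>tm set\<close> and countably many numbers,
  as the term model does. The countability will later allow the numbers to be renamed to elements of
  \<open>nat\<close>.\<close>

theorem completeness:
  assumes "wff \<phi>"
    and valid: "\<And>(D :: ty \<Rightarrow> tm set set) ap ci st e.
      \<lbrakk>P_model D ap ci st; countable (D Tn); tstruct.good D e\<rbrakk> \<Longrightarrow> tstruct.sat D ap ci st e \<phi>"
  shows "{} \<turnstile>\<^sub>P \<phi>"
proof (rule ccontr)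
  assume nd: "\<not> ({} \<turnstile>\<^sub>P \<phi>)"
  have "con {\<not>\<^sub>f \<phi>}" using nd hil_contr[of \<phi> "{}"] hil_empty assms(1) unfolding con_def by blast
  then obtain T where T: "\<not>\<^sub>f \<phi> \<in> T" "\<And>\<phi>. wff \<phi> \<Longrightarrow> T \<turnstile>\<^sub>H \<phi> \<longleftrightarrow> \<phi> \<in> T" "con T"
    "\<And>\<phi>. wff \<phi> \<Longrightarrow> \<not>\<^sub>f \<phi> \<in> T \<longleftrightarrow> \<phi> \<notin> T"
    "\<And>\<sigma> \<chi>. \<lbrakk>wff (Forall \<sigma> \<chi>); Forall \<sigma> \<chi> \<notin> T\<rbrakk> \<Longrightarrow>
      \<exists>y \<chi>'. snd y = \<sigma> \<and> close y 0 \<chi>' = \<chi> \<and> wff \<chi>' \<and> \<chi>' \<notin> T"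
    using henkin_extension[of "\<not>\<^sub>f \<phi>"] assms(1) by (metis wff_Neg)
  have thmT: "\<psi> \<in> T" if "{} \<turnstile>\<^sub>P \<psi>" for \<psi>
    using T(2)[of \<psi>] that derives_wff hil_thm by blast
  have ax: "\<psi> \<in> T" if "\<psi> \<in> P_axioms" "wff \<psi>" for \<psi>
    using thmT that by (blast intro: Ax)
  have imp: "(\<chi> \<longrightarrow>\<^sub>f \<psi>) \<in> T \<longleftrightarrow> (\<chi> \<in> T \<longrightarrow> \<psi> \<in> T)" if "wff \<chi>" "wff \<psi>" for \<chi> \<psi>
  proof -
    have "{} \<turnstile>\<^sub>P (\<psi> \<longrightarrow>\<^sub>f \<chi> \<longrightarrow>\<^sub>f \<psi>)" using that by (rule derives_K[rotated])
    moreover have "{} \<turnstile>\<^sub>P (\<not>\<^sub>f \<chi> \<longrightarrow>\<^sub>f \<chi> \<longrightarrow>\<^sub>f \<psi>)"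
      using that by (rule derives_efq)
    ultimately show ?thesis using T(2,4) that hil_mp hil_thm by (metis wff_Imp_iff wff_Neg)
  qed
  have imp2: "\<psi> \<in> T" if "(\<chi> \<longrightarrow>\<^sub>f \<psi>) \<in> T" "wff \<chi>" "wff \<psi>" "\<chi> \<in> T" for \<chi> \<psi>
    using imp that by blast
  have conj: "(\<chi> \<and>\<^sub>f \<psi>) \<in> T \<longleftrightarrow> \<chi> \<in> T \<and> \<psi> \<in> T" if "wff \<chi>" "wff \<psi>" for \<chi> \<psi>
    using that T(4) by (simp add: Conj_def imp)
  define eq where "eq s t \<longleftrightarrow> wt s \<and> wt t \<and> tyof s = tyof t \<and> (s \<doteq> t) \<in> T" for s t
  have eq_refl: "eq t t" if "wt t" for t using that ax[OF ax_refl] by (simp add: eq_def)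
  have eq_sym: "eq t s" if "eq s t" for s t
    using that ax[OF ax_sym[of s t]] imp2[of "s \<doteq> t" "t \<doteq> s"] unfolding eq_def by simp
  have eq_trans: "eq s u" if "eq s t" "eq t u" for s t u
    using that ax[OF ax_trans[of s t u]] imp2[of "s \<doteq> t" "(t \<doteq> u) \<longrightarrow>\<^sub>f (s \<doteq> u)"]
      imp2[of "t \<doteq> u" "s \<doteq> u"] unfolding eq_def by simp
  have eq_app: "eq (f \<cdot> s) (g \<cdot> t)" if "eq f g" "eq s t" "wt (f \<cdot> s)" for f g s t
  proof -
    have w: "wt (g \<cdot> t)" "tyof (f \<cdot> s) = tyof (g \<cdot> t)"
      using that by (auto simp: eq_def split: ty.splits)
    then show ?thesis
      using that ax[OF ax_cong[of f g s t]] imp2[of "f \<doteq> g" "(s \<doteq> t) \<longrightarrow>\<^sub>f (f \<cdot> s \<doteq> g \<cdot> t)"]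
        imp2[of "s \<doteq> t" "f \<cdot> s \<doteq> g \<cdot> t"]
      unfolding eq_def by simp
  qed
  define cls where "cls t = {s. eq t s}" for t
  have cls_eq: "cls s = cls t \<longleftrightarrow> eq s t" if "wt s" "wt t" for s t
    using that eq_refl eq_sym eq_trans unfolding cls_def by blast
  define rep where "rep a = (SOME t. t \<in> a)" for a :: "tm set"
  have rep: "eq t (rep (cls t))" if "wt t" for t
    unfolding rep_def using someI[of "\<lambda>s. s \<in> cls t" t] eq_refl[OF that] by (simp add: cls_def)
  define D where "D \<sigma> = {cls t | t. wt t \<and> tyof t = \<sigma>}" for \<sigma>
  define ap where "ap a b = cls (rep a \<cdot> rep b)" for a b
  define ci where "ci c = cls (Cn c)" for c
  define st where "st a \<longleftrightarrow> St (rep a) \<in> T" for a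
  define e0 where "e0 x = cls (V x)" for x
  interpret tstruct D ap ci st .
  have ap_cls: "ap (cls s) (cls t) = cls (s \<cdot> t)" if "wt (s \<cdot> t)" for s t
  proof -
    have "eq (s \<cdot> t) (rep (cls s) \<cdot> rep (cls t))" using that by (intro eq_app rep) auto
    then show ?thesis unfolding ap_def using cls_eq eq_def by metis
  qed
  have st_cls: "st (cls t) \<longleftrightarrow> St t \<in> T" if "wt t" for t
  proof -
    have *: "St u \<in> T" if "eq s u" "St s \<in> T" for s u
      using that ax[OF ax_st_eq[of s u]] imp2[of "St s \<and>\<^sub>f (s \<doteq> u)" "St u"]
      by (simp add: eq_def conj Conj_def[symmetric]) (simp add: Conj_def)
    show ?thesis using *[OF rep[OF that]] *[OF eq_sym[OF rep[OF that]]] by (auto simp: st_def)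
  qed
  have val0: "wt t \<Longrightarrow> val e0 t = cls t" for t
    by (induction t) (auto simp: e0_def ci_def ap_cls)
  \<comment> \<open>The induction is on size, because the quantifier case uses substitution
    instances in one direction and a renamed body, supplied by the Henkin witness, in the
    other.\<close>
  have truth: "wff \<psi> \<Longrightarrow> sat e0 \<psi> \<longleftrightarrow> \<psi> \<in> T" for \<psi>
  proof (induction "fsize \<psi>" arbitrary: \<psi> rule: less_induct)
    case less
    from less.prems show ?case
    proof (cases rule: wff.cases)
      case wff_Fls
      then show ?thesis using T(2)[of Fls] T(3) by (simp add: con_def)
    next
      case (wff_Eq s t)
      then show ?thesis by (simp add: val0 cls_eq eq_def)
    next
      case (wff_St t)
      then show ?thesis by (simp add: val0 st_cls)
    next
      case (wff_Imp \<chi> \<xi>)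
      then show ?thesis using less.hyps[of \<chi>] less.hyps[of \<xi>] by (simp add: imp)
    next
      case (wff_all \<chi> x)
      show ?thesis
      proof
        assume *: "\<psi> \<in> T"
        have "sat (e0(x := d)) \<chi>" if "d \<in> D (snd x)" for d
        proof -
          from that obtain t where t: "d = cls t" "wt t" "tyof t = snd x" by (auto simp: D_def)
          have "subst x t \<chi> \<in> T"
            using imp2[OF thmT[OF derives_all_inst[of \<chi> t x]]] t wff_all * less.prems wff_subst by auto
          then have "sat e0 (subst x t \<chi>)"
            using less.hyps[of "subst x t \<chi>"] wff_all t wff_subst by (simp add: all_def)
          then show ?thesis using t by (simp add: sat_subst val0)
        qed
        then show "sat e0 \<psi>" using wff_all by simp
      next
        assume *: "sat e0 \<psi>"
        show "\<psi> \<in> T"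
        proof (rule ccontr)
          assume "\<psi> \<notin> T"
          then obtain y \<chi>' where y: "snd y = snd x" "close y 0 \<chi>' = close x 0 \<chi>" "wff \<chi>'" "\<chi>' \<notin> T"
            using T(5)[of "snd x" "close x 0 \<chi>"] less.prems wff_all by (auto simp: all_def)
          have "fsize \<chi>' = fsize \<chi>" using y(2) by (metis fsize_close)
          then have n: "\<not> sat e0 \<chi>'" using less.hyps[of \<chi>'] wff_all y by (simp add: all_def)
          have "\<psi> = all y \<chi>'" using wff_all y by (simp add: all_def)
          moreover have "cls (V y) \<in> D (snd y)" unfolding D_def by force
          ultimately have "sat (e0(y := e0 y)) \<chi>'" using * y unfolding e0_def by simp
          then show False using n by simp
        qed
      qed
    qed
  qed
  \<comment> \<open>The truth lemma concerns the assignment \<open>e0\<close> only. Any other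
    assignment is reached on the finitely many free variables one at a time, each change passing
    through a generalisation of the theorem.\<close>
  have sat_thm: "sat e \<psi>" if "{} \<turnstile>\<^sub>P \<psi>" "good e" for \<psi> e
  proof -
    have "sat (\<lambda>x. if x \<in> X then e x else e0 x) \<psi>" if "{} \<turnstile>\<^sub>P \<psi>" "finite X" for X \<psi>
      using that(2,1)
    proof (induction X arbitrary: \<psi>)
      case empty
      then show ?case using truth[of \<psi>] thmT derives_wff by auto
    next
      case (insert x X)
      have "sat (\<lambda>x. if x \<in> X then e x else e0 x) (all x \<psi>)"
        using insert.IH[of "all x \<psi>"] insert.prems AllI[of "{}" \<psi> x] by simp
      then have "sat ((\<lambda>x. if x \<in> X then e x else e0 x)(x := e x)) \<psi>"
        using sat_all[OF derives_wff[OF insert.prems]] \<open>good e\<close> unfolding good_def by blast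
      moreover have "(\<lambda>x. if x \<in> X then e x else e0 x)(x := e x) = (\<lambda>y. if y \<in> insert x X then e y else e0 y)"
        by (rule ext) simp
      ultimately show ?case by simp
    qed
    from this[OF that(1), of "fv \<psi>"] show ?thesis
      using sat_cong[of \<psi> "\<lambda>x. if x \<in> fv \<psi> then e x else e0 x" e] by simp
  qed
  have "P_model D ap ci st"
  proof
    show "ci c \<in> D (cty c)" for c by (force simp: ci_def D_def)
    show "ap f a \<in> D \<tau>" if "f \<in> D (\<sigma> \<rightarrow> \<tau>)" "a \<in> D \<sigma>" for f a \<sigma> \<tau>
    proof -
      from that obtain s t where st: "f = cls s" "wt s" "tyof s = \<sigma> \<rightarrow> \<tau>" "a = cls t" "wt t" "tyof t = \<sigma>"
        by (auto simp: D_def)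
      then have "ap f a = cls (s \<cdot> t)" by (simp add: ap_cls)
      then show ?thesis using st by (auto simp: D_def intro!: exI[of _ "s \<cdot> t"])
    qed
    show "sat e \<psi>" if "\<psi> \<in> P_axioms" "wff \<psi>" "good e" for \<psi> e
      using that sat_thm Ax by blast
  qed
  moreover have "countable (D Tn)"
  proof -
    have "D Tn = cls ` {t. wt t \<and> tyof t = Tn}" by (auto simp: D_def)
    then show ?thesis by (simp add: countable_image)
  qed
  moreover have "good e0" by (force simp: good_def e0_def D_def)
  ultimately have "sat e0 \<phi>" by (rule valid)
  then show False using truth[OF assms(1)] T(1,4) assms(1) by blast
qed

section \<open>Typing and evaluation of defined terms\<close>

declare lam.simps [simp del]

lemma tyof_lam [simp]: "wt t \<Longrightarrow> tyof (lam x t) = snd x \<rightarrow> tyof t"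
  by (cases t) (auto simp: lam.simps)

lemma wt_lam [simp]: "wt t \<Longrightarrow> wt (lam x t)"
proof (induction t)
  case (App s t)
  then show ?case by (cases "tyof s") (simp_all add: lam.simps)
qed (simp_all add: lam.simps)

lemma fvt_lam [simp]: "fvt (lam x t) = fvt t - {x}"
  by (induction t) (auto simp: lam.simps)

lemma wff_all' [simp]: "wff \<phi> \<Longrightarrow> wff (all x \<phi>)" by (rule wff_all)

lemma wff_Conj [simp]: "wff (\<phi> \<and>\<^sub>f \<psi>) \<longleftrightarrow> wff \<phi> \<and> wff \<psi>"
  and wff_Disj [simp]: "wff (\<phi> \<or>\<^sub>f \<psi>) \<longleftrightarrow> wff \<phi> \<and> wff \<psi>"
  and wff_Iff [simp]: "wff (\<phi> \<longleftrightarrow>\<^sub>f \<psi>) \<longleftrightarrow> wff \<phi> \<and> wff \<psi>"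
  by (auto simp: Conj_def Disj_def Iff_def)

lemma wff_ex [simp]: "wff \<phi> \<Longrightarrow> wff (ex x \<phi>)"
  and wff_allst [simp]: "wff \<phi> \<Longrightarrow> wff (allst x \<phi>)"
  and wff_exst [simp]: "wff \<phi> \<Longrightarrow> wff (exst x \<phi>)"
  by (simp_all add: ex_def allst_def exst_def)

lemma internal_close [simp]: "internal (close x k \<phi>) = internal \<phi>"
  by (induction \<phi> arbitrary: k) auto

lemma internal_simps [simp]:
  "internal (\<not>\<^sub>f \<phi>) = internal \<phi>" "internal (\<phi> \<and>\<^sub>f \<psi>) = (internal \<phi> \<and> internal \<psi>)"
  "internal (\<phi> \<or>\<^sub>f \<psi>) = (internal \<phi> \<and> internal \<psi>)"
  "internal (\<phi> \<longleftrightarrow>\<^sub>f \<psi>) = (internal \<phi> \<and> internal \<psi>)"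
  "internal (all x \<phi>) = internal \<phi>" "internal (ex x \<phi>) = internal \<phi>"
  by (auto simp: Neg_def Conj_def Disj_def Iff_def ex_def all_def)

lemma fv_simps [simp]:
  "fv (\<not>\<^sub>f \<phi>) = fv \<phi>" "fv (\<phi> \<and>\<^sub>f \<psi>) = fv \<phi> \<union> fv \<psi>" "fv (ex x \<phi>) = fv \<phi> - {x}"
  by (auto simp: Neg_def Conj_def ex_def)

lemma above_fvt: "x \<in> fvt t \<Longrightarrow> fst x < above t"
  by (induction t) auto

lemma fresh_le_notin: "t \<in> set ts \<Longrightarrow> fresh ts \<le> n \<Longrightarrow> (n, \<sigma>) \<notin> fvt t"
proof -
  assume t: "t \<in> set ts" and n: "fresh ts \<le> n"
  have "t \<in> set ts \<Longrightarrow> above t \<le> fresh ts"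
    unfolding fresh_def by (induction ts) auto
  then show ?thesis using above_fvt[of "(n, \<sigma>)" t] t n by auto
qed


lemma fresh_notin [simp]: "t \<in> set ts \<Longrightarrow> (fresh ts, \<sigma>) \<notin> fvt t"
  "t \<in> set ts \<Longrightarrow> (Suc (fresh ts), \<sigma>) \<notin> fvt t"
  using fresh_le_notin[of t ts "fresh ts"] fresh_le_notin[of t ts "Suc (fresh ts)"] by auto

lemma zero_typed [simp]: "wt zero" "tyof zero = Tn" "fvt zero = {}" "substt x u zero = zero"
  by (simp_all add: zero_def)
lemma suc_typed [simp]: "wt (suc t) \<longleftrightarrow> wt t \<and> tyof t = Tn" "tyof (suc t) = Tn" "fvt (suc t) = fvt t"
  "substt x u (suc t) = suc (substt x u t)"
  by (auto simp: suc_def)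
lemma one_typed [simp]: "wt one" "tyof one = Tn" "fvt one = {}" by (simp_all add: one_def)
lemma two_typed [simp]: "wt two" "tyof two = Tn" "fvt two = {}" by (simp_all add: two_def)
lemma nil_typed [simp]: "wt (nil \<sigma>)" "tyof (nil \<sigma>) = Tseq \<sigma>" "fvt (nil \<sigma>) = {}"
  by (simp_all add: nil_def)
lemma cons_typed [simp]: "wt (cons a w) \<longleftrightarrow> wt a \<and> wt w \<and> tyof w = Tseq (tyof a)"
  "tyof (cons a w) = Tseq (tyof a)" "fvt (cons a w) = fvt a \<union> fvt w"
  by (auto simp: cons_def)
lemma elty_simp [simp]: "tyof w = Tseq \<sigma> \<Longrightarrow> elty w = \<sigma>" by (simp add: elty_def)

lemma nrec_typed [simp]:
  "wt (nrec n y z) \<longleftrightarrow> wt n \<and> wt y \<and> wt z \<and> tyof n = Tn \<and> tyof z = tyof y \<rightarrow> Tn \<rightarrow> tyof y"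
  "tyof (nrec n y z) = tyof y" "fvt (nrec n y z) = fvt n \<union> fvt y \<union> fvt z"
  by (auto simp: nrec_def)

lemma plus_tm_typed [simp]: "wt plus_tm" "tyof plus_tm = Tn \<rightarrow> Tn \<rightarrow> Tn" "fvt plus_tm = {}"
  by (auto simp: plus_tm_def Let_def)
lemma plus_typed [simp]: "wt (plus s t) \<longleftrightarrow> wt s \<and> wt t \<and> tyof s = Tn \<and> tyof t = Tn"
  "tyof (plus s t) = Tn" "fvt (plus s t) = fvt s \<union> fvt t"
  by (auto simp: plus_def)
lemma pred_tm_typed [simp]: "wt pred_tm" "tyof pred_tm = Tn \<rightarrow> Tn" "fvt pred_tm = {}"
  by (auto simp: pred_tm_def Let_def)
lemma pred_typed [simp]: "wt (pred t) \<longleftrightarrow> wt t \<and> tyof t = Tn" "tyof (pred t) = Tn" "fvt (pred t) = fvt t"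
  by (auto simp: pred_def)
lemma monus_tm_typed [simp]: "wt monus_tm" "tyof monus_tm = Tn \<rightarrow> Tn \<rightarrow> Tn" "fvt monus_tm = {}"
  by (auto simp: monus_tm_def Let_def)
lemma monus_typed [simp]: "wt (monus s t) \<longleftrightarrow> wt s \<and> wt t \<and> tyof s = Tn \<and> tyof t = Tn"
  "tyof (monus s t) = Tn" "fvt (monus s t) = fvt s \<union> fvt t"
  by (auto simp: monus_def)
lemma times_tm_typed [simp]: "wt times_tm" "tyof times_tm = Tn \<rightarrow> Tn \<rightarrow> Tn" "fvt times_tm = {}"
  by (auto simp: times_tm_def Let_def)
lemma times_typed [simp]: "wt (times s t) \<longleftrightarrow> wt s \<and> wt t \<and> tyof s = Tn \<and> tyof t = Tn"
  "tyof (times s t) = Tn" "fvt (times s t) = fvt s \<union> fvt t"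
  by (auto simp: times_def)
lemma leq_typed [simp]: "wff (s \<le>\<^sub>0 t) \<longleftrightarrow> wt s \<and> wt t \<and> tyof s = Tn \<and> tyof t = Tn"
  "internal (s \<le>\<^sub>0 t)" "fv (s \<le>\<^sub>0 t) = fvt s \<union> fvt t"
  by (auto simp: leq_def)
lemma less_typed [simp]: "wff (s <\<^sub>0 t) \<longleftrightarrow> wt s \<and> wt t \<and> tyof s = Tn \<and> tyof t = Tn"
  "internal (s <\<^sub>0 t)" "fv (s <\<^sub>0 t) = fvt s \<union> fvt t"
  by (auto simp: less_def)

section \<open>Combinators, induction and recursion on numbers in a model\<close>

context P_model
begin

abbreviation N :: "'a set" where "N \<equiv> D Tn"

primrec dflt :: "ty \<Rightarrow> 'a" where
  "dflt Tn = ci Zero"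
| "dflt (\<sigma> \<rightarrow> \<tau>) = ap (ci (Kc \<tau> \<sigma>)) (dflt \<tau>)"
| "dflt (Tseq \<sigma>) = ci (Nilc \<sigma>)"

lemma ci_D': "cty c = \<tau> \<Longrightarrow> ci c \<in> D \<tau>" using ci_D[of c] by simp

lemma dflt_D [simp]: "dflt \<sigma> \<in> D \<sigma>"
  by (induction \<sigma>) (auto intro!: ci_D' ap_D)

text \<open>A base assignment; the parameters of a formula are put in by updating it.\<close>

definition eb :: "var \<Rightarrow> 'a" where "eb x = dflt (snd x)"

lemma good_eb [simp]: "good eb" by (simp add: good_def eb_def)

lemma good_upd [simp]: "good e \<Longrightarrow> d \<in> D (snd x) \<Longrightarrow> good (e(x := d))"
  unfolding good_def by (metis fun_upd_apply)

lemma goodD [simp]: "good e \<Longrightarrow> e x \<in> D (snd x)" unfolding good_def by blast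

lemma val_D: "wt t \<Longrightarrow> good e \<Longrightarrow> val e t \<in> D (tyof t)"
  by (induction t) (auto intro: ap_D split: ty.splits)

lemma val_D' [simp]: "wt t \<Longrightarrow> good e \<Longrightarrow> tyof t = \<sigma> \<Longrightarrow> val e t \<in> D \<sigma>"
  using val_D by blast

definition cv :: "tm \<Rightarrow> 'a" where "cv t = val eb t"

lemma val_closed: "fvt t = {} \<Longrightarrow> val e t = cv t"
  unfolding cv_def by (rule val_cong) simp

lemma val_upd [simp]: "x \<notin> fvt t \<Longrightarrow> val (e(x := d)) t = val e t"
  by (rule val_cong) auto

lemma sat_simps [simp]:
  "sat e (\<phi> \<and>\<^sub>f \<psi>) \<longleftrightarrow> sat e \<phi> \<and> sat e \<psi>" "sat e (\<phi> \<or>\<^sub>f \<psi>) \<longleftrightarrow> sat e \<phi> \<or> sat e \<psi>"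
  "sat e (\<phi> \<longleftrightarrow>\<^sub>f \<psi>) \<longleftrightarrow> (sat e \<phi> \<longleftrightarrow> sat e \<psi>)"
  by (auto simp: Conj_def Disj_def Iff_def)

lemma sat_ex [simp]: "wff \<phi> \<Longrightarrow> sat e (ex x \<phi>) \<longleftrightarrow> (\<exists>d\<in>D (snd x). sat (e(x := d)) \<phi>)"
  by (simp add: ex_def)
lemma sat_allst [simp]: "wff \<phi> \<Longrightarrow> sat e (allst x \<phi>) \<longleftrightarrow> (\<forall>d\<in>D (snd x). st d \<longrightarrow> sat (e(x := d)) \<phi>)"
  by (simp add: allst_def)
lemma sat_exst [simp]: "wff \<phi> \<Longrightarrow> sat e (exst x \<phi>) \<longleftrightarrow> (\<exists>d\<in>D (snd x). st d \<and> sat (e(x := d)) \<phi>)"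
  by (simp add: exst_def)

lemma K_eq: "a \<in> D \<sigma> \<Longrightarrow> b \<in> D \<tau> \<Longrightarrow> ap (ap (ci (Kc \<sigma> \<tau>)) a) b = a"
  using sat_ax[OF ax_K[of \<sigma> \<tau> "V (0, \<sigma>)" "V (1, \<tau>)"], of "eb((0, \<sigma>) := a, (1, \<tau>) := b)"] by simp

lemma S_eq: "a \<in> D (\<rho> \<rightarrow> \<sigma> \<rightarrow> \<tau>) \<Longrightarrow> b \<in> D (\<rho> \<rightarrow> \<sigma>) \<Longrightarrow> c \<in> D \<rho> \<Longrightarrow>
    ap (ap (ap (ci (Sc \<rho> \<sigma> \<tau>)) a) b) c = ap (ap a c) (ap b c)"
  using sat_ax[OF ax_S[of \<rho> \<sigma> \<tau> "V (0, \<rho> \<rightarrow> \<sigma> \<rightarrow> \<tau>)" "V (1, \<rho> \<rightarrow> \<sigma>)" "V (2, \<rho>)"],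
      of "eb((0, \<rho> \<rightarrow> \<sigma> \<rightarrow> \<tau>) := a, (1, \<rho> \<rightarrow> \<sigma>) := b, (2, \<rho>) := c)"] by simp

text \<open>Beta conversion. As a rewrite rule it yields the recursion equations of all defined
  terms, without exposing their combinators.\<close>

lemma ap_lam [simp]:
  assumes "wt t" "good e" "d \<in> D (snd x)"
  shows "ap (val e (lam x t)) d = val (e(x := d)) t"
  using assms
proof (induction t)
  case (V y)
  have "ci (Kc (snd x) (snd x)) \<in> D (snd x \<rightarrow> snd x \<rightarrow> snd x)"
    "ci (Kc (snd x) (snd x \<rightarrow> snd x)) \<in> D (snd x \<rightarrow> (snd x \<rightarrow> snd x) \<rightarrow> snd x)"
    by (simp_all add: ci_D')
  then show ?case using V ap_D[of "ci (Kc (snd x) (snd x))"]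
    by (auto simp: lam.simps K_eq S_eq)
next
  case (App s t)
  obtain \<sigma> \<tau> where ty: "tyof s = \<sigma> \<rightarrow> \<tau>" "tyof t = \<sigma>" using App.prems by (auto split: ty.splits)
  show ?case
  proof (cases "x \<in> fvt s \<union> fvt t")
    case True
    then show ?thesis using App ty
      by (simp add: lam.simps) (subst S_eq, auto intro!: val_D')
  next
    case False
    have "ap (val e s) (val e t) \<in> D \<tau>"
      using App.prems ty by (intro ap_D[of _ \<sigma>]) auto
    then show ?thesis using False App.prems ty by (simp add: lam.simps K_eq flip: fun_upd_def)
  qed
qed (simp_all add: lam.simps K_eq)

text \<open>Beta steps under nested abstractions leave updates at variables that no longer occur.
  Such updates may lie beneath later ones, where \<open>val_upd\<close> does not reach them.\<close>

lemma val_upd_lam2 [simp]: "x \<notin> fvt (lam y t) \<Longrightarrow>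
    val (e(x := d, x1 := d1)) (lam y t) = val (e(x1 := d1)) (lam y t)"
  and val_upd_lam3 [simp]: "x \<notin> fvt (lam y t) \<Longrightarrow>
    val (e(x := d, x1 := d1, x2 := d2)) (lam y t) = val (e(x1 := d1, x2 := d2)) (lam y t)"
  by (rule val_cong; auto)+

definition Sc' :: "'a \<Rightarrow> 'a" where "Sc' a = ap (ci Succ) a"
abbreviation Z0 :: 'a where "Z0 \<equiv> ci Zero"

lemma Z0_N [simp]: "Z0 \<in> N" by (simp add: ci_D')
lemma Sc'_N [simp]: "a \<in> N \<Longrightarrow> Sc' a \<in> N" unfolding Sc'_def by (rule ap_D[of _ Tn]) (simp_all add: ci_D')
lemma val_zero [simp]: "val e zero = Z0" by (simp add: zero_def)
lemma val_suc [simp]: "val e (suc t) = Sc' (val e t)" by (simp add: suc_def Sc'_def)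
lemma val_one [simp]: "val e one = Sc' Z0" by (simp add: one_def)
lemma val_two [simp]: "val e two = Sc' (Sc' Z0)" by (simp add: two_def)

lemma Sc'_neq: "a \<in> N \<Longrightarrow> Sc' a \<noteq> Z0"
  using sat_ax[OF ax_suc_neq[of "V (0, Tn)"], of "eb((0, Tn) := a)"] by simp
lemma Sc'_inj: "a \<in> N \<Longrightarrow> b \<in> N \<Longrightarrow> Sc' a = Sc' b \<longleftrightarrow> a = b"
  using sat_ax[OF ax_suc_inj[of "V (0, Tn)" "V (1, Tn)"], of "eb((0, Tn) := a, (1, Tn) := b)"] by auto

lemma ind:
  assumes "internal \<phi>" "wff \<phi>" "snd n = Tn" "good e" "sat (e(n := Z0)) \<phi>"
    and "\<forall>d\<in>N. sat (e(n := d)) \<phi> \<longrightarrow> sat (e(n := Sc' d)) \<phi>" and "d \<in> N"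
  shows "sat (e(n := d)) \<phi>"
proof -
  let ?\<psi> = "(subst n zero \<phi> \<and>\<^sub>f all n (\<phi> \<longrightarrow>\<^sub>f subst n (suc (V n)) \<phi>)) \<longrightarrow>\<^sub>f all n \<phi>"
  have w: "wff (subst n zero \<phi>)" "wff (subst n (suc (V n)) \<phi>)" using assms by (auto intro!: wff_subst)
  then have "sat e ?\<psi>" using assms by (intro sat_ax ax_ind) auto
  then show ?thesis using assms w by (simp add: sat_subst)
qed

lemma ext_ind:
  assumes "wff \<phi>" "snd n = Tn" "good e" "sat (e(n := Z0)) \<phi>"
    and "\<forall>d\<in>N. st d \<longrightarrow> sat (e(n := d)) \<phi> \<longrightarrow> sat (e(n := Sc' d)) \<phi>" and "d \<in> N" "st d"
  shows "sat (e(n := d)) \<phi>"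
proof -
  let ?\<psi> = "(subst n zero \<phi> \<and>\<^sub>f allst n (\<phi> \<longrightarrow>\<^sub>f subst n (suc (V n)) \<phi>)) \<longrightarrow>\<^sub>f allst n \<phi>"
  have w: "wff (subst n zero \<phi>)" "wff (subst n (suc (V n)) \<phi>)" using assms by (auto intro!: wff_subst)
  then have "sat e ?\<psi>" using assms by (intro sat_ax ax_ext_ind) auto
  then show ?thesis using assms w by (simp add: sat_subst)
qed

lemma indP:
  assumes "internal \<phi>" "wff \<phi>" "good e" and ex: "\<And>d. d \<in> N \<Longrightarrow> sat (e((k, Tn) := d)) \<phi> \<longleftrightarrow> P d"
    and "P Z0" "\<And>d. d \<in> N \<Longrightarrow> P d \<Longrightarrow> P (Sc' d)" "n \<in> N"
  shows "P n"
proof -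
  have "sat (e((k, Tn) := n)) \<phi>" by (rule ind) (use assms in simp_all)
  then show ?thesis using ex assms(7) by blast
qed

lemma ext_indP:
  assumes "wff \<phi>" "good e" and ex: "\<And>d. d \<in> N \<Longrightarrow> sat (e((k, Tn) := d)) \<phi> \<longleftrightarrow> P d"
    and "P Z0" "\<And>d. d \<in> N \<Longrightarrow> st d \<Longrightarrow> P d \<Longrightarrow> P (Sc' d)" "n \<in> N" "st n"
  shows "P n"
proof -
  have "sat (e((k, Tn) := n)) \<phi>" by (rule ext_ind) (use assms in simp_all)
  then show ?thesis using ex assms(6) by blast
qed

definition rec' :: "ty \<Rightarrow> 'a \<Rightarrow> 'a \<Rightarrow> 'a \<Rightarrow> 'a" where
  "rec' \<rho> n y z = ap (ap (ap (ci (Rc \<rho>)) n) y) z"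

lemma rec'_D [simp]: "n \<in> N \<Longrightarrow> y \<in> D \<rho> \<Longrightarrow> z \<in> D (\<rho> \<rightarrow> Tn \<rightarrow> \<rho>) \<Longrightarrow> rec' \<rho> n y z \<in> D \<rho>"
  unfolding rec'_def by (rule ap_D ci_D' | simp)+

lemma rec'_zero [simp]: "y \<in> D \<rho> \<Longrightarrow> z \<in> D (\<rho> \<rightarrow> Tn \<rightarrow> \<rho>) \<Longrightarrow> rec' \<rho> Z0 y z = y"
  using sat_ax[OF ax_R_zero[of \<rho> "V (0, \<rho>)" "V (1, \<rho> \<rightarrow> Tn \<rightarrow> \<rho>)"],
      of "eb((0, \<rho>) := y, (1, \<rho> \<rightarrow> Tn \<rightarrow> \<rho>) := z)"] by (simp add: rec'_def)

lemma rec'_suc [simp]: "n \<in> N \<Longrightarrow> y \<in> D \<rho> \<Longrightarrow> z \<in> D (\<rho> \<rightarrow> Tn \<rightarrow> \<rho>) \<Longrightarrow>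
    rec' \<rho> (Sc' n) y z = ap (ap z (rec' \<rho> n y z)) n"
  using sat_ax[OF ax_R_suc[of \<rho> "V (2, Tn)" "V (0, \<rho>)" "V (1, \<rho> \<rightarrow> Tn \<rightarrow> \<rho>)"],
      of "eb((0, \<rho>) := y, (1, \<rho> \<rightarrow> Tn \<rightarrow> \<rho>) := z, (2, Tn) := n)"] by (simp add: rec'_def)

lemma val_nrec [simp]: "val e (nrec n y z) = rec' (tyof y) (val e n) (val e y) (val e z)"
  by (simp add: nrec_def rec'_def)

definition pl :: "'a \<Rightarrow> 'a \<Rightarrow> 'a" where "pl a b = ap (ap (cv plus_tm) a) b"
definition pr :: "'a \<Rightarrow> 'a" where "pr a = ap (cv pred_tm) a"
definition mo :: "'a \<Rightarrow> 'a \<Rightarrow> 'a" where "mo a b = ap (ap (cv monus_tm) a) b"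
definition ti :: "'a \<Rightarrow> 'a \<Rightarrow> 'a" where "ti a b = ap (ap (cv times_tm) a) b"

lemma val_plus [simp]: "val e (plus s t) = pl (val e s) (val e t)"
  by (simp add: plus_def pl_def val_closed)
lemma val_pred [simp]: "val e (pred s) = pr (val e s)"
  by (simp add: pred_def pr_def val_closed)
lemma val_monus [simp]: "val e (monus s t) = mo (val e s) (val e t)"
  by (simp add: monus_def mo_def val_closed)
lemma val_times [simp]: "val e (times s t) = ti (val e s) (val e t)"
  by (simp add: times_def ti_def val_closed)

lemma cv_D: "wt t \<Longrightarrow> tyof t = \<sigma> \<Longrightarrow> cv t \<in> D \<sigma>" by (simp add: cv_def)

lemma pl_N [simp]: "a \<in> N \<Longrightarrow> b \<in> N \<Longrightarrow> pl a b \<in> N"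
  and pr_N [simp]: "a \<in> N \<Longrightarrow> pr a \<in> N"
  and mo_N [simp]: "a \<in> N \<Longrightarrow> b \<in> N \<Longrightarrow> mo a b \<in> N"
  and ti_N [simp]: "a \<in> N \<Longrightarrow> b \<in> N \<Longrightarrow> ti a b \<in> N"
  unfolding pl_def pr_def mo_def ti_def by (rule ap_D cv_D | simp)+

lemma pl_rec: "a \<in> N \<Longrightarrow> pl a Z0 = a" "a \<in> N \<Longrightarrow> b \<in> N \<Longrightarrow> pl a (Sc' b) = Sc' (pl a b)"
  by (simp_all add: pl_def plus_tm_def cv_def Let_def)
lemma pr_rec: "pr Z0 = Z0" "a \<in> N \<Longrightarrow> pr (Sc' a) = a"
  by (simp_all add: pr_def pred_tm_def cv_def Let_def)
lemma mo_rec: "a \<in> N \<Longrightarrow> mo a Z0 = a" "a \<in> N \<Longrightarrow> b \<in> N \<Longrightarrow> mo a (Sc' b) = pr (mo a b)"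
  by (simp_all add: mo_def monus_tm_def cv_def Let_def)
lemma ti_rec: "a \<in> N \<Longrightarrow> ti a Z0 = Z0" "a \<in> N \<Longrightarrow> b \<in> N \<Longrightarrow> ti a (Sc' b) = pl (ti a b) a"
  by (simp_all add: ti_def times_tm_def cv_def Let_def)

end

section \<open>The semiring of the numbers of a model\<close>

context P_model
begin

abbreviation "v0 \<equiv> V (0, Tn)" abbreviation "v1 \<equiv> V (1, Tn)" abbreviation "v2 \<equiv> V (2, Tn)"

lemma N_cases:
  assumes "a \<in> N" obtains "a = Z0" | b where "b \<in> N" "a = Sc' b"
  using ind[of "(v0 \<doteq> zero) \<or>\<^sub>f ex (1, Tn) (v0 \<doteq> suc v1)" "(0, Tn)" eb a] assms by auto

lemma pl_Z0_left: "a \<in> N \<Longrightarrow> pl Z0 a = a"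
  using ind[of "plus zero v0 \<doteq> v0" "(0, Tn)" eb a] by (simp add: pl_rec)

lemma pl_Sc_left: "a \<in> N \<Longrightarrow> b \<in> N \<Longrightarrow> pl (Sc' a) b = Sc' (pl a b)"
  using ind[of "plus (suc v1) v0 \<doteq> suc (plus v1 v0)" "(0, Tn)" "eb((1, Tn) := a)" b] by (simp add: pl_rec)

lemma pl_commute: "a \<in> N \<Longrightarrow> b \<in> N \<Longrightarrow> pl a b = pl b a"
  using ind[of "plus v1 v0 \<doteq> plus v0 v1" "(0, Tn)" "eb((1, Tn) := a)" b]
  by (simp add: pl_rec pl_Z0_left pl_Sc_left)

lemma pl_assoc: "a \<in> N \<Longrightarrow> b \<in> N \<Longrightarrow> c \<in> N \<Longrightarrow> pl (pl a b) c = pl a (pl b c)"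
  using ind[of "plus (plus v1 v2) v0 \<doteq> plus v1 (plus v2 v0)" "(0, Tn)" "eb((1, Tn) := a, (2, Tn) := b)" c]
  by (simp add: pl_rec)

lemma pl_left_commute: "a \<in> N \<Longrightarrow> b \<in> N \<Longrightarrow> c \<in> N \<Longrightarrow> pl b (pl a c) = pl a (pl b c)"
  by (metis pl_assoc pl_commute)

lemmas pl_ac = pl_assoc pl_commute pl_left_commute

lemma pl_cancel: "a \<in> N \<Longrightarrow> b \<in> N \<Longrightarrow> c \<in> N \<Longrightarrow> pl a c = pl b c \<Longrightarrow> a = b"
  using ind[of "(plus v1 v0 \<doteq> plus v2 v0) \<longrightarrow>\<^sub>f (v1 \<doteq> v2)" "(0, Tn)" "eb((1, Tn) := a, (2, Tn) := b)" c]
  by (simp add: pl_rec Sc'_inj)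

lemma pl_eq_Z0: "a \<in> N \<Longrightarrow> b \<in> N \<Longrightarrow> pl a b = Z0 \<Longrightarrow> b = Z0"
  by (erule N_cases[of b]) (auto simp: pl_rec Sc'_neq)

lemma ti_Z0_left: "a \<in> N \<Longrightarrow> ti Z0 a = Z0"
  using ind[of "times zero v0 \<doteq> zero" "(0, Tn)" eb a] by (simp add: pl_rec ti_rec)

lemma ti_Sc_left: "a \<in> N \<Longrightarrow> b \<in> N \<Longrightarrow> ti (Sc' a) b = pl (ti a b) b"
  using ind[of "times (suc v1) v0 \<doteq> plus (times v1 v0) v0" "(0, Tn)" "eb((1, Tn) := a)" b]
  by (simp add: pl_rec pl_Sc_left ti_rec pl_ac)

lemma ti_commute: "a \<in> N \<Longrightarrow> b \<in> N \<Longrightarrow> ti a b = ti b a"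
  using ind[of "times v1 v0 \<doteq> times v0 v1" "(0, Tn)" "eb((1, Tn) := a)" b]
  by (simp add: ti_rec ti_Z0_left ti_Sc_left)

lemma ti_distrib: "a \<in> N \<Longrightarrow> b \<in> N \<Longrightarrow> c \<in> N \<Longrightarrow> ti (pl a b) c = pl (ti a c) (ti b c)"
  using ind[of "times (plus v1 v2) v0 \<doteq> plus (times v1 v0) (times v2 v0)" "(0, Tn)"
      "eb((1, Tn) := a, (2, Tn) := b)" c]
  by (simp add: ti_rec pl_rec pl_ac)

lemma ti_assoc: "a \<in> N \<Longrightarrow> b \<in> N \<Longrightarrow> c \<in> N \<Longrightarrow> ti (ti a b) c = ti a (ti b c)"
  using ind[of "times (times v1 v2) v0 \<doteq> times v1 (times v2 v0)" "(0, Tn)"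
      "eb((1, Tn) := a, (2, Tn) := b)" c]
  by (simp add: ti_rec ti_distrib ti_commute[of a])

lemma ti_one: "a \<in> N \<Longrightarrow> ti (Sc' Z0) a = a"
  by (simp add: ti_Sc_left ti_Z0_left pl_Z0_left)

lemma ti_eq_Z0: "a \<in> N \<Longrightarrow> b \<in> N \<Longrightarrow> ti a b = Z0 \<Longrightarrow> a = Z0 \<or> b = Z0"
  by (erule N_cases[of a]; erule N_cases[of b]) (auto simp: ti_rec pl_rec Sc'_neq)

lemma pl_total: "a \<in> N \<Longrightarrow> b \<in> N \<Longrightarrow> \<exists>c\<in>N. pl a c = b \<or> pl b c = a"
proof -
  assume a: "a \<in> N" and b: "b \<in> N"
  have "\<exists>e\<in>N. pl a e = Sc' d \<or> pl (Sc' d) e = a" if "d \<in> N" "c \<in> N" "pl a c = d \<or> pl d c = a" for c d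
  proof (cases "pl a c = d")
    case True
    then show ?thesis using that a by (intro bexI[of _ "Sc' c"]) (auto simp: pl_rec)
  next
    case False
    then have "pl d c = a" using that by simp
    moreover have "c \<noteq> Z0" using False calculation that by (auto simp: pl_rec)
    ultimately obtain e where "e \<in> N" "c = Sc' e" using \<open>c \<in> N\<close> N_cases[of c] by blast
    then show ?thesis using \<open>pl d c = a\<close> that by (intro bexI[of _ e]) (auto simp: pl_rec pl_Sc_left)
  qed
  then show ?thesis
    using ind[of "ex (1, Tn) ((plus v2 v1 \<doteq> v0) \<or>\<^sub>f (plus v0 v1 \<doteq> v2))" "(0, Tn)" "eb((2, Tn) := a)" b] a b
    by (fastforce simp: pl_Z0_left)
qed

text \<open>The order is expressed by addition here, since in P it is itself defined by truncated
  subtraction: the result is either a true difference, or 0 with a below b.\<close>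

lemma mo_char:
  assumes a: "a \<in> N" and b: "b \<in> N"
  shows "pl (mo a b) b = a \<or> mo a b = Z0 \<and> (\<exists>c\<in>N. pl a c = b)"
proof -
  have "pl (mo a (Sc' d)) (Sc' d) = a \<or> mo a (Sc' d) = Z0 \<and> (\<exists>c\<in>N. pl a c = Sc' d)"
    if d: "d \<in> N" and "pl (mo a d) d = a \<or> mo a d = Z0 \<and> (\<exists>c\<in>N. pl a c = d)" for d
    using that(2)
  proof
    assume *: "pl (mo a d) d = a"
    have "mo a d \<in> N" using a d by simp
    then show ?thesis
    proof (cases rule: N_cases)
      case 1
      then show ?thesis using * a d
        by (intro disjI2) (auto simp: mo_rec pr_rec pl_Z0_left pl_rec intro!: bexI[of _ "Sc' Z0"])
    next
      case (2 m)
      then show ?thesis using * a d by (intro disjI1) (simp add: mo_rec pr_rec pl_rec pl_Sc_left)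
    qed
  next
    assume "mo a d = Z0 \<and> (\<exists>c\<in>N. pl a c = d)"
    then obtain c where "mo a d = Z0" "c \<in> N" "pl a c = d" by blast
    then show ?thesis using a d by (intro disjI2) (auto simp: mo_rec pr_rec pl_rec intro!: bexI[of _ "Sc' c"])
  qed
  then show ?thesis
    using ind[of "(plus (monus v1 v0) v0 \<doteq> v1) \<or>\<^sub>f ((monus v1 v0 \<doteq> zero) \<and>\<^sub>f ex (2, Tn) (plus v1 v2 \<doteq> v0))"
        "(0, Tn)" "eb((1, Tn) := a)" b] a b
    by (auto simp: mo_rec pl_rec)
qed

text \<open>With countability this provides a bijection between the type \<open>nat\<close> and the
  numbers of the model.\<close>

lemma N_infinite: "infinite N"
proof
  assume "finite N"
  moreover have "inj_on Sc' N" "Sc' ` N \<subseteq> N" by (auto simp: inj_on_def Sc'_inj)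
  ultimately have "Sc' ` N = N" by (simp add: endo_inj_surj)
  then show False using Sc'_neq Z0_N by (metis imageE)
qed

end

lemma lrec_typed [simp]:
  assumes "tyof w = Tseq \<sigma>"
  shows "wt (lrec w y z) \<longleftrightarrow> wt w \<and> wt y \<and> wt z \<and> tyof z = tyof y \<rightarrow> \<sigma> \<rightarrow> tyof y"
    and "tyof (lrec w y z) = tyof y"
  using assms by (auto simp: lrec_def)
lemma fvt_lrec [simp]: "fvt (lrec w y z) = fvt w \<union> fvt y \<union> fvt z" by (auto simp: lrec_def)

lemma default_typed [simp]: "wt (default \<sigma>)" "tyof (default \<sigma>) = \<sigma>" "fvt (default \<sigma>) = {}"
proof -
  have "wt (default \<sigma>) \<and> tyof (default \<sigma>) = \<sigma> \<and> fvt (default \<sigma>) = {}" by (induction \<sigma>) auto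
  then show "wt (default \<sigma>)" "tyof (default \<sigma>) = \<sigma>" "fvt (default \<sigma>) = {}" by auto
qed

lemma append_tm_typed [simp]: "wt (append_tm \<sigma>)" "tyof (append_tm \<sigma>) = Tseq \<sigma> \<rightarrow> Tseq \<sigma> \<rightarrow> Tseq \<sigma>"
  "fvt (append_tm \<sigma>) = {}"
  by (auto simp: append_tm_def Let_def)
lemma append_typed [simp]:
  assumes "tyof v = Tseq \<sigma>"
  shows "wt (append v w) \<longleftrightarrow> wt v \<and> wt w \<and> tyof w = Tseq \<sigma>" "tyof (append v w) = Tseq \<sigma>"
  using assms by (auto simp: append_def)
lemma fvt_append [simp]: "fvt (append v w) = fvt v \<union> fvt w" by (auto simp: append_def)
lemma len_tm_typed [simp]: "wt (len_tm \<sigma>)" "tyof (len_tm \<sigma>) = Tseq \<sigma> \<rightarrow> Tn" "fvt (len_tm \<sigma>) = {}"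
  by (auto simp: len_tm_def Let_def)
lemma len_typed [simp]: "tyof w = Tseq \<sigma> \<Longrightarrow> wt (len w) \<longleftrightarrow> wt w" "tyof (len w) = Tn" "fvt (len w) = fvt w"
  by (auto simp: len_def)
lemma nth_tm_typed [simp]: "wt (nth_tm \<sigma>)" "tyof (nth_tm \<sigma>) = Tseq \<sigma> \<rightarrow> Tn \<rightarrow> \<sigma>" "fvt (nth_tm \<sigma>) = {}"
  by (auto simp: nth_tm_def Let_def)
lemma nth_typed [simp]:
  assumes "tyof w = Tseq \<sigma>"
  shows "wt (nth w i) \<longleftrightarrow> wt w \<and> wt i \<and> tyof i = Tn" "tyof (nth w i) = \<sigma>"
  using assms by (auto simp: nth_def)
lemma fvt_nth [simp]: "fvt (nth w i) = fvt w \<union> fvt i" by (auto simp: nth_def)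
lemma pow2_tm_typed [simp]: "wt pow2_tm" "tyof pow2_tm = Tn \<rightarrow> Tn" "fvt pow2_tm = {}"
  by (auto simp: pow2_tm_def Let_def)
lemma pow2_typed [simp]: "wt (pow2 t) \<longleftrightarrow> wt t \<and> tyof t = Tn" "tyof (pow2 t) = Tn" "fvt (pow2 t) = fvt t"
  by (auto simp: pow2_def)
lemma seg_tm_typed [simp]: "wt seg_tm" "tyof seg_tm = T1 \<rightarrow> Tn \<rightarrow> Tseq Tn" "fvt seg_tm = {}"
  by (auto simp: seg_tm_def Let_def)
lemma seg_typed [simp]: "wt (seg a n) \<longleftrightarrow> wt a \<and> wt n \<and> tyof a = T1 \<and> tyof n = Tn"
  "tyof (seg a n) = Tseq Tn" "fvt (seg a n) = fvt a \<union> fvt n"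
  by (auto simp: seg_def)
lemma code_tm_typed [simp]: "wt code_tm" "tyof code_tm = Tseq Tn \<rightarrow> Tn" "fvt code_tm = {}"
  by (auto simp: code_tm_def Let_def)
lemma code_typed [simp]: "wt (code t) \<longleftrightarrow> wt t \<and> tyof t = Tseq Tn" "tyof (code t) = Tn" "fvt (code t) = fvt t"
  by (auto simp: code_def)
lemma mem_typed [simp]:
  assumes "tyof w = Tseq \<sigma>" "wt s" "wt w" "tyof s = \<sigma>"
  shows "wff (s \<in>\<^sub>f w)"
  using assms by (simp add: mem_def Let_def)
lemma internal_mem [simp]: "internal (s \<in>\<^sub>f w)" by (simp add: mem_def Let_def)

text \<open>Arithmetic is henceforth done in a linearly ordered field, through the embedding
  \<kappa>. The embedding is a parameter, because a field for a given model is constructed only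
  after all arguments inside the model.\<close>

locale P_num = P_model D ap ci st for D :: "ty \<Rightarrow> 'a set" and ap ci st +
  fixes \<kappa> :: "'a \<Rightarrow> 'k::linordered_field"
  assumes \<kappa>_Z0 [simp]: "\<kappa> Z0 = 0"
    and \<kappa>_Sc [simp]: "a \<in> N \<Longrightarrow> \<kappa> (Sc' a) = \<kappa> a + 1"
    and \<kappa>_pl [simp]: "a \<in> N \<Longrightarrow> b \<in> N \<Longrightarrow> \<kappa> (pl a b) = \<kappa> a + \<kappa> b"
    and \<kappa>_ti [simp]: "a \<in> N \<Longrightarrow> b \<in> N \<Longrightarrow> \<kappa> (ti a b) = \<kappa> a * \<kappa> b"
    and \<kappa>_inj: "a \<in> N \<Longrightarrow> b \<in> N \<Longrightarrow> \<kappa> a = \<kappa> b \<Longrightarrow> a = b"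
    and \<kappa>_nonneg [simp]: "a \<in> N \<Longrightarrow> 0 \<le> \<kappa> a"
begin

lemma apN [simp]: "f \<in> D (Tn \<rightarrow> \<sigma>) \<Longrightarrow> i \<in> N \<Longrightarrow> ap f i \<in> D \<sigma>" by (rule ap_D)
lemma ap2 [simp]: "f \<in> D T2 \<Longrightarrow> i \<in> D T1 \<Longrightarrow> ap f i \<in> N" by (rule ap_D)

lemma \<kappa>_eq: "a \<in> N \<Longrightarrow> b \<in> N \<Longrightarrow> a = b \<longleftrightarrow> \<kappa> a = \<kappa> b" using \<kappa>_inj by blast

lemma \<kappa>_not_neg [simp]: "a \<in> N \<Longrightarrow> \<not> \<kappa> a < 0" by (simp add: not_less)
lemma \<kappa>_Sc_pos [simp]: "a \<in> N \<Longrightarrow> 0 < \<kappa> a + 1" by (simp add: add_nonneg_pos)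
lemma \<kappa>_odd_pos [simp]: "a \<in> N \<Longrightarrow> 0 < 2 * \<kappa> a + 1" by (simp add: add_nonneg_pos)
lemma \<kappa>_eq_0 [simp]: "a \<in> N \<Longrightarrow> \<kappa> a = 0 \<longleftrightarrow> a = Z0" using \<kappa>_eq[of a Z0] by simp
lemma \<kappa>_le_0 [simp]: "a \<in> N \<Longrightarrow> \<kappa> a \<le> 0 \<longleftrightarrow> a = Z0" by (metis \<kappa>_eq_0 \<kappa>_nonneg antisym order_refl)

lemma \<kappa>_diff:
  assumes "a \<in> N" "b \<in> N" "\<kappa> a \<le> \<kappa> b" obtains c where "c \<in> N" "\<kappa> b = \<kappa> a + \<kappa> c"
proof -
  obtain c where "c \<in> N" "pl a c = b \<or> pl b c = a" using pl_total assms by blast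
  then have "c \<in> N" "\<kappa> b = \<kappa> a + \<kappa> c" if "pl a c = b" using that assms by auto
  moreover have "\<kappa> b = \<kappa> a + \<kappa> Z0" if "pl b c = a"
  proof -
    have "\<kappa> a = \<kappa> b + \<kappa> c" "0 \<le> \<kappa> c" using that assms \<open>c \<in> N\<close> by auto
    then show ?thesis using assms(3) by simp
  qed
  ultimately show ?thesis using that \<open>pl a c = b \<or> pl b c = a\<close> Z0_N by blast
qed

text \<open>The order is discrete, because a nonzero difference is a successor.\<close>

lemma \<kappa>_less: "a \<in> N \<Longrightarrow> b \<in> N \<Longrightarrow> \<kappa> a < \<kappa> b \<longleftrightarrow> \<kappa> a + 1 \<le> \<kappa> b"
proof
  assume a: "a \<in> N" "b \<in> N" "\<kappa> a < \<kappa> b"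
  then obtain c where c: "c \<in> N" "\<kappa> b = \<kappa> a + \<kappa> c" using \<kappa>_diff[of a b] by auto
  moreover have "c \<noteq> Z0" using a c by auto
  ultimately obtain d where "d \<in> N" "c = Sc' d" using N_cases by metis
  then show "\<kappa> a + 1 \<le> \<kappa> b" using c \<kappa>_nonneg[of d] by simp
qed simp

lemma \<kappa>_less_Sc [simp]: "a \<in> N \<Longrightarrow> b \<in> N \<Longrightarrow> \<kappa> a < \<kappa> b + 1 \<longleftrightarrow> \<kappa> a \<le> \<kappa> b"
  using \<kappa>_less[of b a] by (auto simp: not_le[symmetric])

lemma \<kappa>_mo [simp]: "a \<in> N \<Longrightarrow> b \<in> N \<Longrightarrow> \<kappa> (mo a b) = max 0 (\<kappa> a - \<kappa> b)"
proof -
  assume a: "a \<in> N" and b: "b \<in> N"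
  from mo_char[OF a b] show ?thesis
  proof
    assume "pl (mo a b) b = a"
    then have "\<kappa> (mo a b) + \<kappa> b = \<kappa> a" using \<kappa>_pl[of "mo a b" b] a b by simp
    moreover have "0 \<le> \<kappa> (mo a b)" using a b by (intro \<kappa>_nonneg) simp
    ultimately show ?thesis by linarith
  next
    assume "mo a b = Z0 \<and> (\<exists>c\<in>N. pl a c = b)"
    then obtain c where "mo a b = Z0" "c \<in> N" "pl a c = b" by blast
    then show ?thesis using \<kappa>_nonneg[of c] a by auto
  qed
qed

lemma \<kappa>_pr: "a \<in> N \<Longrightarrow> 1 \<le> \<kappa> a \<Longrightarrow> \<kappa> (pr a) = \<kappa> a - 1"
  by (erule N_cases[of a]) (auto simp: pr_rec)

lemma sat_leq [simp]: "wt s \<Longrightarrow> wt t \<Longrightarrow> tyof s = Tn \<Longrightarrow> tyof t = Tn \<Longrightarrow> good e \<Longrightarrow>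
    sat e (s \<le>\<^sub>0 t) \<longleftrightarrow> \<kappa> (val e s) \<le> \<kappa> (val e t)"
  by (simp add: leq_def \<kappa>_eq max_def)

lemma sat_less [simp]: "wt s \<Longrightarrow> wt t \<Longrightarrow> tyof s = Tn \<Longrightarrow> tyof t = Tn \<Longrightarrow> good e \<Longrightarrow>
    sat e (s <\<^sub>0 t) \<longleftrightarrow> \<kappa> (val e s) < \<kappa> (val e t)"
  by (simp add: less_def \<kappa>_less)

definition pw :: "'a \<Rightarrow> 'a" where "pw a = ap (cv pow2_tm) a"
lemma val_pow2 [simp]: "val e (pow2 t) = pw (val e t)" by (simp add: pow2_def pw_def val_closed)
lemma pw_N [simp]: "a \<in> N \<Longrightarrow> pw a \<in> N" unfolding pw_def by (rule ap_D cv_D | simp)+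
lemma pw_rec [simp]: "pw Z0 = Sc' Z0" "a \<in> N \<Longrightarrow> \<kappa> (pw (Sc' a)) = 2 * \<kappa> (pw a)"
  by (simp_all add: pw_def pow2_tm_def cv_def Let_def)

lemma pw_pl [simp]: "a \<in> N \<Longrightarrow> b \<in> N \<Longrightarrow> \<kappa> (pw (pl a b)) = \<kappa> (pw a) * \<kappa> (pw b)"
  using ind[of "pow2 (plus v1 v0) \<doteq> times (pow2 v1) (pow2 v0)" "(0, Tn)" "eb((1, Tn) := a)" b]
  by (simp add: \<kappa>_eq pl_rec)

lemma pw_ge: "a \<in> N \<Longrightarrow> \<kappa> a + 1 \<le> \<kappa> (pw a)"
proof -
  assume a: "a \<in> N"
  have "2 + \<kappa> d \<le> 2 * \<kappa> (pw d)" if "d \<in> N" "\<kappa> d + 1 \<le> \<kappa> (pw d)" for d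
    using that(2) \<kappa>_nonneg[OF that(1)] by linarith
  then have "\<forall>d\<in>N. \<kappa> d + 1 \<le> \<kappa> (pw d) \<longrightarrow> 2 + \<kappa> d \<le> 2 * \<kappa> (pw d)" by blast
  then show ?thesis
    using ind[of "suc v0 \<le>\<^sub>0 pow2 v0" "(0, Tn)" eb a] a by simp
qed

lemma pw_pos [simp]: "a \<in> N \<Longrightarrow> 0 < \<kappa> (pw a)" and pw_ge1: "a \<in> N \<Longrightarrow> 1 \<le> \<kappa> (pw a)"
  using pw_ge[of a] \<kappa>_nonneg[of a] by linarith+

lemma pw_nz [simp]: "a \<in> N \<Longrightarrow> \<kappa> (pw a) \<noteq> 0" by (metis less_irrefl pw_pos)

lemma pw_mono: "a \<in> N \<Longrightarrow> b \<in> N \<Longrightarrow> \<kappa> a \<le> \<kappa> b \<Longrightarrow> \<kappa> (pw a) \<le> \<kappa> (pw b)"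
proof -
  assume a: "a \<in> N" "b \<in> N" "\<kappa> a \<le> \<kappa> b"
  then obtain c where c: "c \<in> N" "\<kappa> b = \<kappa> a + \<kappa> c" by (rule \<kappa>_diff)
  then have "b = pl a c" using a by (simp add: \<kappa>_eq)
  then show ?thesis using a c pw_ge1[of c] pw_pos[of a] by simp
qed

section \<open>Finite sequences\<close>

definition cns :: "ty \<Rightarrow> 'a \<Rightarrow> 'a \<Rightarrow> 'a" where "cns \<sigma> a w = ap (ap (ci (Consc \<sigma>)) a) w"
abbreviation nl :: "ty \<Rightarrow> 'a" where "nl \<sigma> \<equiv> ci (Nilc \<sigma>)"
definition lr :: "ty \<Rightarrow> ty \<Rightarrow> 'a \<Rightarrow> 'a \<Rightarrow> 'a \<Rightarrow> 'a" where
  "lr \<sigma> \<rho> w y z = ap (ap (ap (ci (Lc \<sigma> \<rho>)) w) y) z"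

lemma nl_D [simp]: "nl \<sigma> \<in> D (Tseq \<sigma>)" by (simp add: ci_D')
lemma cns_D [simp]: "a \<in> D \<sigma> \<Longrightarrow> w \<in> D (Tseq \<sigma>) \<Longrightarrow> cns \<sigma> a w \<in> D (Tseq \<sigma>)"
  unfolding cns_def by (rule ap_D ci_D' | simp)+
lemma lr_D [simp]: "w \<in> D (Tseq \<sigma>) \<Longrightarrow> y \<in> D \<rho> \<Longrightarrow> z \<in> D (\<rho> \<rightarrow> \<sigma> \<rightarrow> \<rho>) \<Longrightarrow> lr \<sigma> \<rho> w y z \<in> D \<rho>"
  unfolding lr_def by (rule ap_D ci_D' | simp)+
lemma val_nil [simp]: "val e (nil \<sigma>) = nl \<sigma>" by (simp add: nil_def)
lemma val_cons [simp]: "val e (cons a w) = cns (tyof a) (val e a) (val e w)" by (simp add: cons_def cns_def)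
lemma val_lrec [simp]: "tyof w = Tseq \<sigma> \<Longrightarrow> val e (lrec w y z) = lr \<sigma> (tyof y) (val e w) (val e y) (val e z)"
  by (simp add: lrec_def lr_def)

lemma lr_nl [simp]: "y \<in> D \<rho> \<Longrightarrow> z \<in> D (\<rho> \<rightarrow> \<sigma> \<rightarrow> \<rho>) \<Longrightarrow> lr \<sigma> \<rho> (nl \<sigma>) y z = y"
  using sat_ax[OF ax_L_nil[of \<sigma> \<rho> "V (0, \<rho>)" "V (1, \<rho> \<rightarrow> \<sigma> \<rightarrow> \<rho>)"],
      of "eb((0, \<rho>) := y, (1, \<rho> \<rightarrow> \<sigma> \<rightarrow> \<rho>) := z)"] by (simp add: lr_def)

lemma lr_cns [simp]: "a \<in> D \<sigma> \<Longrightarrow> w \<in> D (Tseq \<sigma>) \<Longrightarrow> y \<in> D \<rho> \<Longrightarrow> z \<in> D (\<rho> \<rightarrow> \<sigma> \<rightarrow> \<rho>) \<Longrightarrow>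
    lr \<sigma> \<rho> (cns \<sigma> a w) y z = ap (ap z (lr \<sigma> \<rho> w y z)) a"
  using sat_ax[OF ax_L_cons[of \<sigma> \<rho> "V (2, \<sigma>)" "V (3, Tseq \<sigma>)" "V (0, \<rho>)" "V (1, \<rho> \<rightarrow> \<sigma> \<rightarrow> \<rho>)"],
      of "eb((0, \<rho>) := y, (1, \<rho> \<rightarrow> \<sigma> \<rightarrow> \<rho>) := z, (2, \<sigma>) := a, (3, Tseq \<sigma>) := w)"]
  by (simp add: lr_def cns_def)

lemma seq_cases:
  assumes "w \<in> D (Tseq \<sigma>)"
  obtains "w = nl \<sigma>" | a v where "a \<in> D \<sigma>" "v \<in> D (Tseq \<sigma>)" "w = cns \<sigma> a v"
  using sat_ax[OF ax_seq[of "(0, Tseq \<sigma>)" \<sigma> "(1, \<sigma>)" "(2, Tseq \<sigma>)"], of "eb((0, Tseq \<sigma>) := w)"] assms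
  by auto

definition ln :: "ty \<Rightarrow> 'a \<Rightarrow> 'a" where "ln \<sigma> w = ap (cv (len_tm \<sigma>)) w"
definition nt :: "ty \<Rightarrow> 'a \<Rightarrow> 'a \<Rightarrow> 'a" where "nt \<sigma> w i = ap (ap (cv (nth_tm \<sigma>)) w) i"
definition app :: "ty \<Rightarrow> 'a \<Rightarrow> 'a \<Rightarrow> 'a" where "app \<sigma> v w = ap (ap (cv (append_tm \<sigma>)) v) w"

lemma val_len [simp]: "tyof w = Tseq \<sigma> \<Longrightarrow> val e (len w) = ln \<sigma> (val e w)"
  by (simp add: len_def ln_def val_closed)
lemma val_nth [simp]: "tyof w = Tseq \<sigma> \<Longrightarrow> val e (nth w i) = nt \<sigma> (val e w) (val e i)"
  by (simp add: nth_def nt_def val_closed)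
lemma val_append [simp]: "tyof v = Tseq \<sigma> \<Longrightarrow> val e (append v w) = app \<sigma> (val e v) (val e w)"
  by (simp add: append_def app_def val_closed)
lemma ln_N [simp]: "w \<in> D (Tseq \<sigma>) \<Longrightarrow> ln \<sigma> w \<in> N"
  and nt_D [simp]: "w \<in> D (Tseq \<sigma>) \<Longrightarrow> i \<in> N \<Longrightarrow> nt \<sigma> w i \<in> D \<sigma>"
  and app_D [simp]: "v \<in> D (Tseq \<sigma>) \<Longrightarrow> w \<in> D (Tseq \<sigma>) \<Longrightarrow> app \<sigma> v w \<in> D (Tseq \<sigma>)"
  unfolding ln_def nt_def app_def by (rule ap_D cv_D | simp)+

lemma ln_rec [simp]: "ln \<sigma> (nl \<sigma>) = Z0"
  "a \<in> D \<sigma> \<Longrightarrow> w \<in> D (Tseq \<sigma>) \<Longrightarrow> ln \<sigma> (cns \<sigma> a w) = Sc' (ln \<sigma> w)"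
  by (simp_all add: ln_def len_tm_def cv_def Let_def)
lemma nt_rec [simp]: "a \<in> D \<sigma> \<Longrightarrow> w \<in> D (Tseq \<sigma>) \<Longrightarrow> nt \<sigma> (cns \<sigma> a w) Z0 = a"
  "a \<in> D \<sigma> \<Longrightarrow> w \<in> D (Tseq \<sigma>) \<Longrightarrow> i \<in> N \<Longrightarrow> nt \<sigma> (cns \<sigma> a w) (Sc' i) = nt \<sigma> w i"
  by (simp_all add: nt_def nth_tm_def cv_def Let_def)
lemma app_rec [simp]: "w \<in> D (Tseq \<sigma>) \<Longrightarrow> app \<sigma> (nl \<sigma>) w = w"
  "a \<in> D \<sigma> \<Longrightarrow> v \<in> D (Tseq \<sigma>) \<Longrightarrow> w \<in> D (Tseq \<sigma>) \<Longrightarrow> app \<sigma> (cns \<sigma> a v) w = cns \<sigma> a (app \<sigma> v w)"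
  by (simp_all add: app_def append_tm_def cv_def Let_def)

text \<open>The axioms of P offer only a case distinction for sequences. Induction over them is
  obtained by induction on k, for the statement that \<phi> holds of all sequences of length
  k.\<close>

lemma seq_ind:
  assumes "internal \<phi>" "wff \<phi>" "snd w = Tseq \<sigma>" "good e" "sat (e(w := nl \<sigma>)) \<phi>"
    and step: "\<forall>a\<in>D \<sigma>. \<forall>v\<in>D (Tseq \<sigma>). sat (e(w := v)) \<phi> \<longrightarrow> sat (e(w := cns \<sigma> a v)) \<phi>"
    and v: "v \<in> D (Tseq \<sigma>)"
  shows "sat (e(w := v)) \<phi>"
proof -
  obtain k where k: "(k, Tn) \<notin> fv \<phi>" using fresh_var[of "fv \<phi>" Tn] by auto
  let ?n = "(k, Tn)"
  let ?\<psi> = "all w ((len (V w) \<doteq> V ?n) \<longrightarrow>\<^sub>f \<phi>)"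
  have w: "w \<noteq> ?n" using assms(3) by auto
  have drop: "sat (e(?n := d, w := u)) \<phi> = sat (e(w := u)) \<phi>" for d u
    using w k by (intro sat_cong) auto
  have ex: "sat (e(?n := d)) ?\<psi> \<longleftrightarrow> (\<forall>u\<in>D (Tseq \<sigma>). ln \<sigma> u = d \<longrightarrow> sat (e(w := u)) \<phi>)" for d
    using assms w by (simp add: drop)
  have "sat (e(?n := ln \<sigma> v)) ?\<psi>"
  proof (rule ind)
    show "sat (e(?n := Z0)) ?\<psi>" unfolding ex
    proof (intro ballI impI)
      fix u assume "u \<in> D (Tseq \<sigma>)" "ln \<sigma> u = Z0"
      then show "sat (e(w := u)) \<phi>"
        by (cases rule: seq_cases) (use assms Sc'_neq in auto)
    qed
    show "\<forall>d\<in>N. sat (e(?n := d)) ?\<psi> \<longrightarrow> sat (e(?n := Sc' d)) ?\<psi>" unfolding ex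
    proof (intro ballI impI)
      fix d u assume d: "d \<in> N" "\<forall>u\<in>D (Tseq \<sigma>). ln \<sigma> u = d \<longrightarrow> sat (e(w := u)) \<phi>"
        and u: "u \<in> D (Tseq \<sigma>)" "ln \<sigma> u = Sc' d"
      from u(1) show "sat (e(w := u)) \<phi>"
      proof (cases rule: seq_cases)
        case 1
        then show ?thesis using u Sc'_neq[of d] d by simp
      next
        case (2 a v)
        then show ?thesis using u d step Sc'_inj[of "ln \<sigma> v" d] by auto
      qed
    qed
  qed (use assms in auto)
  then show ?thesis using v unfolding ex by auto
qed

lemma seq_indP:
  assumes "internal \<phi>" "wff \<phi>" "good e"
    and ex: "\<And>d. d \<in> D (Tseq \<sigma>) \<Longrightarrow> sat (e((k, Tseq \<sigma>) := d)) \<phi> \<longleftrightarrow> P d"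
    and "P (nl \<sigma>)" "\<And>a d. a \<in> D \<sigma> \<Longrightarrow> d \<in> D (Tseq \<sigma>) \<Longrightarrow> P d \<Longrightarrow> P (cns \<sigma> a d)" "n \<in> D (Tseq \<sigma>)"
  shows "P n"
proof -
  have "sat (e((k, Tseq \<sigma>) := n)) \<phi>" by (rule seq_ind) (use assms in simp_all)
  then show ?thesis using ex assms(7) by blast
qed

text \<open>Equality of sequences is primitive in P, so extensionality is a consequence of sequence
  induction: equal entries at position 0 identify the heads, and a shift of positions passes to the
  tails.\<close>

lemma seq_ext:
  assumes v: "v \<in> D (Tseq \<sigma>)" and w: "w \<in> D (Tseq \<sigma>)" and "ln \<sigma> v = ln \<sigma> w"
    and "\<And>i. i \<in> N \<Longrightarrow> \<kappa> i < \<kappa> (ln \<sigma> v) \<Longrightarrow> nt \<sigma> v i = nt \<sigma> w i"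
  shows "v = w"
proof -
  let ?v = "(0, Tseq \<sigma>)" and ?w = "(1, Tseq \<sigma>)"
  let ?\<phi> = "all ?w ((len (V ?v) \<doteq> len (V ?w)) \<longrightarrow>\<^sub>f all (2, Tn) ((v2 <\<^sub>0 len (V ?v)) \<longrightarrow>\<^sub>f
      (nth (V ?v) v2 \<doteq> nth (V ?w) v2)) \<longrightarrow>\<^sub>f (V ?v \<doteq> V ?w))"
  have ex: "sat (eb(?v := u)) ?\<phi> \<longleftrightarrow> (\<forall>x\<in>D (Tseq \<sigma>). ln \<sigma> u = ln \<sigma> x \<longrightarrow>
      (\<forall>i\<in>N. \<kappa> i < \<kappa> (ln \<sigma> u) \<longrightarrow> nt \<sigma> u i = nt \<sigma> x i) \<longrightarrow> u = x)" if "u \<in> D (Tseq \<sigma>)" for u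
    using that by simp
  have "sat (eb(?v := v)) ?\<phi>"
  proof (rule seq_ind)
    show "sat (eb(?v := nl \<sigma>)) ?\<phi>"
    proof (subst ex, simp, intro ballI impI)
      fix x assume "x \<in> D (Tseq \<sigma>)" "ln \<sigma> (nl \<sigma>) = ln \<sigma> x"
      then show "nl \<sigma> = x" by (cases rule: seq_cases) (use Sc'_neq in \<open>auto dest: sym\<close>)
    qed
    show "\<forall>a\<in>D \<sigma>. \<forall>u\<in>D (Tseq \<sigma>). sat (eb(?v := u)) ?\<phi> \<longrightarrow> sat (eb(?v := cns \<sigma> a u)) ?\<phi>"
    proof (intro ballI impI)
      fix a u assume a: "a \<in> D \<sigma>" "u \<in> D (Tseq \<sigma>)" "sat (eb(?v := u)) ?\<phi>"
      show "sat (eb(?v := cns \<sigma> a u)) ?\<phi>"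
      proof (subst ex, simp add: a, intro ballI impI)
        fix x assume x: "x \<in> D (Tseq \<sigma>)" "ln \<sigma> (cns \<sigma> a u) = ln \<sigma> x"
          and n: "\<forall>i\<in>N. \<kappa> i < \<kappa> (ln \<sigma> (cns \<sigma> a u)) \<longrightarrow> nt \<sigma> (cns \<sigma> a u) i = nt \<sigma> x i"
        from x(1) show "cns \<sigma> a u = x"
        proof (cases rule: seq_cases)
          case 1
          then show ?thesis using x a Sc'_neq[of "ln \<sigma> u"] by simp
        next
          case (2 b y)
          have "a = b" using n[rule_format, of Z0] a 2 \<kappa>_nonneg[of "ln \<sigma> u"] by simp
          moreover have "nt \<sigma> u i = nt \<sigma> y i" if "i \<in> N" "\<kappa> i < \<kappa> (ln \<sigma> u)" for i
            using n[rule_format, of "Sc' i"] a 2 that by simp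
          then have "u = y" using a(3) 2 x Sc'_inj[of "ln \<sigma> u" "ln \<sigma> y"] a(1,2) unfolding ex[OF a(2)] by simp
          ultimately show ?thesis using 2 by simp
        qed
      qed
    qed
  qed (use v in auto)
  then show ?thesis using assms unfolding ex[OF v] by simp
qed

lemma ln_app [simp]: "v \<in> D (Tseq \<sigma>) \<Longrightarrow> w \<in> D (Tseq \<sigma>) \<Longrightarrow> \<kappa> (ln \<sigma> (app \<sigma> v w)) = \<kappa> (ln \<sigma> v) + \<kappa> (ln \<sigma> w)"
  using seq_ind[of "len (append (V (0, Tseq \<sigma>)) (V (1, Tseq \<sigma>))) \<doteq> plus (len (V (0, Tseq \<sigma>))) (len (V (1, Tseq \<sigma>)))"
      "(0, Tseq \<sigma>)" \<sigma> "eb((1, Tseq \<sigma>) := w)" v]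
  by (simp add: \<kappa>_eq)

lemma nt_app_left: "v \<in> D (Tseq \<sigma>) \<Longrightarrow> w \<in> D (Tseq \<sigma>) \<Longrightarrow> i \<in> N \<Longrightarrow> \<kappa> i < \<kappa> (ln \<sigma> v) \<Longrightarrow>
    nt \<sigma> (app \<sigma> v w) i = nt \<sigma> v i"
proof -
  assume v: "v \<in> D (Tseq \<sigma>)" and w: "w \<in> D (Tseq \<sigma>)" and i: "i \<in> N" "\<kappa> i < \<kappa> (ln \<sigma> v)"
  let ?v = "(0, Tseq \<sigma>)" and ?w = "(1, Tseq \<sigma>)"
  let ?\<phi> = "all (2, Tn) ((v2 <\<^sub>0 len (V ?v)) \<longrightarrow>\<^sub>f (nth (append (V ?v) (V ?w)) v2 \<doteq> nth (V ?v) v2))"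
  have st: "nt \<sigma> (cns \<sigma> a (app \<sigma> u w)) i = nt \<sigma> (cns \<sigma> a u) i"
    if "a \<in> D \<sigma>" "u \<in> D (Tseq \<sigma>)" "\<forall>i\<in>N. \<kappa> i < \<kappa> (ln \<sigma> u) \<longrightarrow> nt \<sigma> (app \<sigma> u w) i = nt \<sigma> u i"
      "i \<in> N" "\<kappa> i < \<kappa> (ln \<sigma> u) + 1" for a u i
    using that(4) by (cases rule: N_cases) (use that w in auto)
  have "sat ((eb(?w := w))(?v := v)) ?\<phi>"
    by (rule seq_ind[where \<sigma> = \<sigma>]) (use v w in \<open>simp_all add: st\<close>)
  then show ?thesis using v w i by simp
qed

lemma nt_app_right: "v \<in> D (Tseq \<sigma>) \<Longrightarrow> w \<in> D (Tseq \<sigma>) \<Longrightarrow> i \<in> N \<Longrightarrow>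
    nt \<sigma> (app \<sigma> v w) (pl (ln \<sigma> v) i) = nt \<sigma> w i"
  using seq_ind[of "nth (append (V (0, Tseq \<sigma>)) (V (1, Tseq \<sigma>))) (plus (len (V (0, Tseq \<sigma>))) v2) \<doteq> nth (V (1, Tseq \<sigma>)) v2"
      "(0, Tseq \<sigma>)" \<sigma> "eb((1, Tseq \<sigma>) := w, (2, Tn) := i)" v]
  by (simp add: pl_Z0_left pl_Sc_left)

definition me :: "ty \<Rightarrow> 'a \<Rightarrow> 'a \<Rightarrow> bool" where
  "me \<sigma> a w \<longleftrightarrow> (\<exists>i\<in>N. \<kappa> i < \<kappa> (ln \<sigma> w) \<and> a = nt \<sigma> w i)"

lemma sat_mem [simp]:
  assumes "tyof w = Tseq \<sigma>" "wt s" "wt w" "tyof s = \<sigma>" "good e"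
  shows "sat e (s \<in>\<^sub>f w) \<longleftrightarrow> me \<sigma> (val e s) (val e w)"
  using assms by (simp add: mem_def Let_def me_def)

lemma me_nl [simp]: "\<not> me \<sigma> a (nl \<sigma>)"
  by (auto simp: me_def)

lemma me_cns [simp]: "b \<in> D \<sigma> \<Longrightarrow> w \<in> D (Tseq \<sigma>) \<Longrightarrow> me \<sigma> a (cns \<sigma> b w) \<longleftrightarrow> a = b \<or> me \<sigma> a w"
proof
  assume d: "b \<in> D \<sigma>" "w \<in> D (Tseq \<sigma>)"
  { assume "me \<sigma> a (cns \<sigma> b w)"
    then obtain i where i: "i \<in> N" "\<kappa> i < \<kappa> (ln \<sigma> w) + 1" "a = nt \<sigma> (cns \<sigma> b w) i"
      using d by (auto simp: me_def)
    from i(1) show "a = b \<or> me \<sigma> a w" by (cases rule: N_cases) (use i d in \<open>auto simp: me_def\<close>) }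
  { assume "a = b \<or> me \<sigma> a w"
    then show "me \<sigma> a (cns \<sigma> b w)"
    proof
      assume "a = b"
      then show ?thesis using d \<kappa>_nonneg[of "ln \<sigma> w"] unfolding me_def by (intro bexI[of _ Z0]) auto
    next
      assume "me \<sigma> a w"
      then obtain i where "i \<in> N" "\<kappa> i < \<kappa> (ln \<sigma> w)" "a = nt \<sigma> w i" by (auto simp: me_def)
      then show ?thesis using d unfolding me_def by (intro bexI[of _ "Sc' i"]) auto
    qed }
qed

lemma me_D: "me \<sigma> a w \<Longrightarrow> w \<in> D (Tseq \<sigma>) \<Longrightarrow> a \<in> D \<sigma>" by (auto simp: me_def)

section \<open>Initial segments and codes\<close>

definition sg :: "'a \<Rightarrow> 'a \<Rightarrow> 'a" where "sg a n = ap (ap (cv seg_tm) a) n"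
definition cd :: "'a \<Rightarrow> 'a" where "cd w = ap (cv code_tm) w"
lemma val_seg [simp]: "val e (seg a n) = sg (val e a) (val e n)" by (simp add: seg_def sg_def val_closed)
lemma val_code [simp]: "val e (code w) = cd (val e w)" by (simp add: code_def cd_def val_closed)
lemma sg_D [simp]: "a \<in> D T1 \<Longrightarrow> n \<in> N \<Longrightarrow> sg a n \<in> D (Tseq Tn)"
  and cd_N [simp]: "w \<in> D (Tseq Tn) \<Longrightarrow> cd w \<in> N"
  unfolding sg_def cd_def by (rule ap_D cv_D | simp)+
lemma sg_rec [simp]: "a \<in> D T1 \<Longrightarrow> sg a Z0 = cns Tn (ap a Z0) (nl Tn)"
  "a \<in> D T1 \<Longrightarrow> n \<in> N \<Longrightarrow> sg a (Sc' n) = app Tn (sg a n) (cns Tn (ap a (Sc' n)) (nl Tn))"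
  by (simp_all add: sg_def seg_tm_def cv_def Let_def)
lemma cd_rec [simp]: "cd (nl Tn) = Z0"
  "a \<in> N \<Longrightarrow> w \<in> D (Tseq Tn) \<Longrightarrow> \<kappa> (cd (cns Tn a w)) = \<kappa> (pw a) * (2 * \<kappa> (cd w) + 1)"
  by (simp_all add: cd_def code_tm_def cv_def Let_def)

lemma ln_sg [simp]: "a \<in> D T1 \<Longrightarrow> n \<in> N \<Longrightarrow> ln Tn (sg a n) = Sc' n"
  using ind[of "len (seg (V (1, T1)) v0) \<doteq> suc v0" "(0, Tn)" "eb((1, T1) := a)" n] by (simp add: \<kappa>_eq)

lemma nt_sg: "a \<in> D T1 \<Longrightarrow> n \<in> N \<Longrightarrow> i \<in> N \<Longrightarrow> \<kappa> i \<le> \<kappa> n \<Longrightarrow> nt Tn (sg a n) i = ap a i"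
proof -
  assume a: "a \<in> D T1" and n: "n \<in> N" and i: "i \<in> N" "\<kappa> i \<le> \<kappa> n"
  let ?\<phi> = "all (2, Tn) ((v2 \<le>\<^sub>0 v0) \<longrightarrow>\<^sub>f (nth (seg (V (1, T1)) v0) v2 \<doteq> V (1, T1) \<cdot> v2))"
  have z: "nt Tn (cns Tn (ap a Z0) (nl Tn)) i = ap a i" if "i \<in> N" "\<kappa> i \<le> 0" for i
    using that a by auto
  have s: "nt Tn (app Tn (sg a n) (cns Tn (ap a (Sc' n)) (nl Tn))) i = ap a i"
    if "n \<in> N" "\<forall>i\<in>N. \<kappa> i \<le> \<kappa> n \<longrightarrow> nt Tn (sg a n) i = ap a i" "i \<in> N" "\<kappa> i \<le> \<kappa> n + 1" for n i
  proof (cases "\<kappa> i \<le> \<kappa> n")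
    case True
    then show ?thesis using that a by (simp add: nt_app_left)
  next
    case False
    then have "\<kappa> i = \<kappa> n + 1" using \<kappa>_less[of n i] that by simp
    then have "i = pl (ln Tn (sg a n)) Z0" using that a by (simp add: \<kappa>_eq)
    then show ?thesis using that a nt_app_right[of "sg a n" Tn "cns Tn (ap a (Sc' n)) (nl Tn)" Z0]
      by (simp add: pl_rec)
  qed
  have "sat ((eb((1, T1) := a))((0, Tn) := n)) ?\<phi>"
    by (rule ind) (use a n in \<open>simp_all add: z s\<close>)
  then show ?thesis using a n i by simp
qed

lemma sg_eq: "a \<in> D T1 \<Longrightarrow> b \<in> D T1 \<Longrightarrow> n \<in> N \<Longrightarrow> m \<in> N \<Longrightarrow>
    sg a n = sg b m \<longleftrightarrow> n = m \<and> (\<forall>i\<in>N. \<kappa> i \<le> \<kappa> n \<longrightarrow> ap a i = ap b i)"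
proof
  assume d: "a \<in> D T1" "b \<in> D T1" "n \<in> N" "m \<in> N"
  { assume e: "sg a n = sg b m"
    have "Sc' n = Sc' m" using ln_sg[OF d(1,3)] ln_sg[OF d(2,4)] e by simp
    then have nm: "n = m" using d Sc'_inj by simp
    moreover have "ap a i = ap b i" if "i \<in> N" "\<kappa> i \<le> \<kappa> n" for i
      using nt_sg[of a n i] nt_sg[of b m i] that e d nm by simp
    ultimately show "n = m \<and> (\<forall>i\<in>N. \<kappa> i \<le> \<kappa> n \<longrightarrow> ap a i = ap b i)" by blast }
  { assume "n = m \<and> (\<forall>i\<in>N. \<kappa> i \<le> \<kappa> n \<longrightarrow> ap a i = ap b i)"
    then have nm: "n = m" "\<And>i. i \<in> N \<Longrightarrow> \<kappa> i \<le> \<kappa> n \<Longrightarrow> ap a i = ap b i" by auto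
    show "sg a n = sg b m"
      by (rule seq_ext[of _ Tn]) (use d nm in \<open>simp_all add: nt_sg\<close>) }
qed

text \<open>If a were less than b, cancelling the common power of 2 would equate an odd number with
  an even one.\<close>

lemma pw_odd_inj:
  assumes "a \<in> N" "b \<in> N" "x \<in> N" "y \<in> N" "\<kappa> (pw a) * (2 * \<kappa> x + 1) = \<kappa> (pw b) * (2 * \<kappa> y + 1)"
  shows "a = b \<and> x = y"
proof -
  have key: "a = b" if "a \<in> N" "b \<in> N" "x \<in> N" "y \<in> N" "\<kappa> a \<le> \<kappa> b"
    "\<kappa> (pw a) * (2 * \<kappa> x + 1) = \<kappa> (pw b) * (2 * \<kappa> y + 1)" for a b x y
  proof (rule ccontr)
    assume "a \<noteq> b"
    from that(1,2,5) obtain c where c: "c \<in> N" "\<kappa> b = \<kappa> a + \<kappa> c" by (rule \<kappa>_diff)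
    then have b: "b = pl a c" using that by (simp add: \<kappa>_eq)
    have "c \<noteq> Z0" using b \<open>a \<noteq> b\<close> that by (auto simp: pl_rec)
    then obtain d where d: "d \<in> N" "c = Sc' d" using c N_cases by metis
    \<comment> \<open>Half of 2^(b - a) * (2 * y + 1), which exists because b - a = d + 1.\<close>
    define z where "z = ti (pw d) (Sc' (ti (Sc' (Sc' Z0)) y))"
    have z: "z \<in> N" "\<kappa> z = \<kappa> (pw d) * (2 * \<kappa> y + 1)" using d that by (simp_all add: z_def)
    have "\<kappa> (pw a) * (2 * \<kappa> x + 1) = \<kappa> (pw a) * (2 * \<kappa> z)" using that b c d z by simp
    then have "2 * \<kappa> x + 1 = 2 * \<kappa> z" using that by (simp add: pw_pos less_imp_neq[symmetric])
    moreover have "\<kappa> x < \<kappa> z \<Longrightarrow> \<kappa> x + 1 \<le> \<kappa> z" using \<kappa>_less that z by blast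
    ultimately show False by linarith
  qed
  have ab: "a = b" using key[of a b x y] key[of b a y x] assms by (metis linear)
  then have "2 * \<kappa> x + 1 = 2 * \<kappa> y + 1" using assms by (simp add: less_imp_neq[symmetric])
  then show ?thesis using ab assms by (simp add: \<kappa>_eq)
qed

text \<open>A nonempty sequence has a positive code, whose exponent of 2 gives the head and whose
  odd factor gives the code of the tail.\<close>

lemma cd_inj: "v \<in> D (Tseq Tn) \<Longrightarrow> w \<in> D (Tseq Tn) \<Longrightarrow> cd v = cd w \<Longrightarrow> v = w"
proof -
  assume v: "v \<in> D (Tseq Tn)" and w: "w \<in> D (Tseq Tn)" and e: "cd v = cd w"
  let ?v = "(0, Tseq Tn)" and ?w = "(1, Tseq Tn)"
  let ?\<phi> = "all ?w ((code (V ?v) \<doteq> code (V ?w)) \<longrightarrow>\<^sub>f (V ?v \<doteq> V ?w))"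
  have pos: "0 < \<kappa> (cd (cns Tn a u))" if "a \<in> N" "u \<in> D (Tseq Tn)" for a u
    using that by simp
  have z: "nl Tn = x" if "x \<in> D (Tseq Tn)" "Z0 = cd x" for x
    using that(1)
  proof (cases rule: seq_cases)
    case (2 a u)
    then have "0 < \<kappa> (cd x)" using pos by blast
    moreover have "\<kappa> (cd x) = 0" using that(2) \<kappa>_Z0 by metis
    ultimately show ?thesis by simp
  qed simp
  have s: "cns Tn a u = x" if "a \<in> N" "u \<in> D (Tseq Tn)" "\<forall>x\<in>D (Tseq Tn). cd u = cd x \<longrightarrow> u = x"
    "x \<in> D (Tseq Tn)" "cd (cns Tn a u) = cd x" for a u x
    using that(4)
  proof (cases rule: seq_cases)
    case 1
    then have "\<kappa> (cd (cns Tn a u)) = 0" using that(5) by simp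
    then show ?thesis using pos[OF that(1,2)] by linarith
  next
    case (2 b y)
    have "\<kappa> (pw a) * (2 * \<kappa> (cd u) + 1) = \<kappa> (pw b) * (2 * \<kappa> (cd y) + 1)"
      using cd_rec(2)[OF that(1,2)] cd_rec(2)[OF 2(1,2)] that(5) 2(3) by metis
    then have "a = b \<and> cd u = cd y" using that(1,2) 2(1,2) by (intro pw_odd_inj cd_N)
    moreover from this have "u = y" using that(3) 2(2) by blast
    ultimately show ?thesis using 2(3) by simp
  qed
  have ex: "sat (eb(?v := u)) ?\<phi> \<longleftrightarrow> (\<forall>x\<in>D (Tseq Tn). cd u = cd x \<longrightarrow> u = x)" if "u \<in> D (Tseq Tn)" for u
    using that by simp
  have "sat (eb(?v := v)) ?\<phi>"
  proof (rule seq_ind)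
    show "sat (eb(?v := nl Tn)) ?\<phi>" unfolding ex[OF nl_D] using z by simp
    show "\<forall>a\<in>N. \<forall>u\<in>D (Tseq Tn). sat (eb(?v := u)) ?\<phi> \<longrightarrow> sat (eb(?v := cns Tn a u)) ?\<phi>"
    proof (intro ballI impI)
      fix a u assume a: "a \<in> N" "u \<in> D (Tseq Tn)" "sat (eb(?v := u)) ?\<phi>"
      then show "sat (eb(?v := cns Tn a u)) ?\<phi>" unfolding ex[OF a(2)] ex[OF cns_D[OF a(1,2)]]
        using s by blast
    qed
  qed (use v in auto)
  then show ?thesis using w e unfolding ex[OF v] by blast
qed

end

text \<open>The sum bounds all entries of a finite sequence. Being given by a closed term, it is
  standard for a standard sequence.\<close>

definition sum_tm :: tm where
  "sum_tm = (let w = (0, Tseq Tn); r = (1, Tn); a = (2, Tn) in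
     lam w (lrec (V w) zero (lam r (lam a (plus (V r) (V a))))))"
text \<open>This serves the idealisations in which an object of type 1 carries a number as its value
  at 0.\<close>

definition sum1_tm :: tm where
  "sum1_tm = (let w = (0, Tseq T1); r = (1, Tn); a = (2, T1) in
     lam w (lrec (V w) zero (lam r (lam a (plus (V r) (V a \<cdot> zero))))))"
lemma sum_tm_typed [simp]: "wt sum_tm" "tyof sum_tm = Tseq Tn \<rightarrow> Tn" "fvt sum_tm = {}"
  by (auto simp: sum_tm_def Let_def)
lemma sum1_tm_typed [simp]: "wt sum1_tm" "tyof sum1_tm = Tseq T1 \<rightarrow> Tn" "fvt sum1_tm = {}"
  by (auto simp: sum1_tm_def Let_def)

lemma tri_tm_typed [simp]: "wt tri_tm" "tyof tri_tm = Tn \<rightarrow> Tn" "fvt tri_tm = {}"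
  by (auto simp: tri_tm_def Let_def)
lemma pair_tm_typed [simp]: "wt pair_tm" "tyof pair_tm = Tn \<rightarrow> Tn \<rightarrow> Tn" "fvt pair_tm = {}"
  by (auto simp: pair_tm_def Let_def)
lemma pair_typed [simp]: "wt (pair s t) \<longleftrightarrow> wt s \<and> wt t \<and> tyof s = Tn \<and> tyof t = Tn"
  "tyof (pair s t) = Tn" "fvt (pair s t) = fvt s \<union> fvt t"
  by (auto simp: pair_def)
lemma ifz_tm_typed [simp]: "wt (ifz_tm \<sigma>)" "tyof (ifz_tm \<sigma>) = Tn \<rightarrow> \<sigma> \<rightarrow> \<sigma> \<rightarrow> \<sigma>" "fvt (ifz_tm \<sigma>) = {}"
  by (auto simp: ifz_tm_def Let_def)
lemma ifz_typed [simp]: "wt (ifz s t u) \<longleftrightarrow> wt s \<and> wt t \<and> wt u \<and> tyof s = Tn \<and> tyof u = tyof t"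
  "tyof (ifz s t u) = tyof t" "fvt (ifz s t u) = fvt s \<union> fvt t \<union> fvt u"
  by (auto simp: ifz_def)
lemma list2_typed [simp]: "wt (list2 s t) \<longleftrightarrow> wt s \<and> wt t \<and> tyof s = Tn \<and> tyof t = Tn"
  "tyof (list2 s t) = Tseq (tyof s)" "fvt (list2 s t) = fvt s \<union> fvt t"
  by (auto simp: list2_def)
lemma unpair_tm_typed [simp]: "wt unpair_tm" "tyof unpair_tm = Tn \<rightarrow> Tseq Tn" "fvt unpair_tm = {}"
  by (auto simp: unpair_tm_def Let_def)
lemma pfst_typed [simp]: "wt (pfst t) \<longleftrightarrow> wt t \<and> tyof t = Tn" "tyof (pfst t) = Tn" "fvt (pfst t) = fvt t"
  by (auto simp: pfst_def)
lemma psnd_typed [simp]: "wt (psnd t) \<longleftrightarrow> wt t \<and> tyof t = Tn" "tyof (psnd t) = Tn" "fvt (psnd t) = fvt t"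
  by (auto simp: psnd_def)
lemma q_typed [simp]:
  "wt (qpos t) \<longleftrightarrow> wt t \<and> tyof t = Tn" "tyof (qpos t) = Tn" "fvt (qpos t) = fvt t"
  "wt (qneg t) \<longleftrightarrow> wt t \<and> tyof t = Tn" "tyof (qneg t) = Tn" "fvt (qneg t) = fvt t"
  "wt (qden t) \<longleftrightarrow> wt t \<and> tyof t = Tn" "tyof (qden t) = Tn" "fvt (qden t) = fvt t"
  by (auto simp: qpos_def qneg_def qden_def)
lemma quot_typed [simp]:
  "wt (quot p q d) \<longleftrightarrow> wt p \<and> wt q \<and> wt d \<and> tyof p = Tn \<and> tyof q = Tn \<and> tyof d = Tn"
  "tyof (quot p q d) = Tn" "fvt (quot p q d) = fvt p \<union> fvt q \<union> fvt d"
  by (auto simp: quot_def)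
lemma qrel_typed [simp]:
  "wff (s <\<^sub>Q t) \<longleftrightarrow> wt s \<and> wt t \<and> tyof s = Tn \<and> tyof t = Tn"
  "wff (s \<le>\<^sub>Q t) \<longleftrightarrow> wt s \<and> wt t \<and> tyof s = Tn \<and> tyof t = Tn"
  "internal (s <\<^sub>Q t)" "internal (s \<le>\<^sub>Q t)"
  by (auto simp: qless_def qleq_def)
lemma qplus_tm_typed [simp]: "wt qplus_tm" "tyof qplus_tm = Tn \<rightarrow> Tn \<rightarrow> Tn" "fvt qplus_tm = {}"
  by (auto simp: qplus_tm_def Let_def)
lemma qplus_typed [simp]: "wt (qplus s t) \<longleftrightarrow> wt s \<and> wt t \<and> tyof s = Tn \<and> tyof t = Tn"
  "tyof (qplus s t) = Tn" "fvt (qplus s t) = fvt s \<union> fvt t"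
  by (auto simp: qplus_def)
lemma qdist_tm_typed [simp]: "wt qdist_tm" "tyof qdist_tm = Tn \<rightarrow> Tn \<rightarrow> Tn" "fvt qdist_tm = {}"
  by (auto simp: qdist_tm_def Let_def)
lemma qdist_typed [simp]: "wt (qdist s t) \<longleftrightarrow> wt s \<and> wt t \<and> tyof s = Tn \<and> tyof t = Tn"
  "tyof (qdist s t) = Tn" "fvt (qdist s t) = fvt s \<union> fvt t"
  by (auto simp: qdist_def)
lemma inv_typed [simp]:
  "wt (inv_pow2 t) \<longleftrightarrow> wt t \<and> tyof t = Tn" "tyof (inv_pow2 t) = Tn" "fvt (inv_pow2 t) = fvt t"
  "wt (two_inv_pow2 t) \<longleftrightarrow> wt t \<and> tyof t = Tn" "tyof (two_inv_pow2 t) = Tn" "fvt (two_inv_pow2 t) = fvt t"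
  by (auto simp: inv_pow2_def two_inv_pow2_def)
lemma rzero_typed [simp]: "wt rzero" "tyof rzero = T1" "fvt rzero = {}" "wt rone" "tyof rone = T1" "fvt rone = {}"
  by (auto simp: rzero_def rone_def)
lemma rdist_tm_typed [simp]: "wt rdist_tm" "tyof rdist_tm = T1 \<rightarrow> T1 \<rightarrow> T1" "fvt rdist_tm = {}"
  by (auto simp: rdist_tm_def Let_def)
lemma rdist_typed [simp]: "wt (rdist s t) \<longleftrightarrow> wt s \<and> wt t \<and> tyof s = T1 \<and> tyof t = T1"
  "tyof (rdist s t) = T1" "fvt (rdist s t) = fvt s \<union> fvt t"
  by (auto simp: rdist_def)
lemma rinv_tm_typed [simp]: "wt rinv_tm" "tyof rinv_tm = Tn \<rightarrow> T1" "fvt rinv_tm = {}"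
  by (auto simp: rinv_tm_def Let_def)
lemma rinv_typed [simp]: "wt (rinv s) \<longleftrightarrow> wt s \<and> tyof s = Tn" "tyof (rinv s) = T1" "fvt (rinv s) = fvt s"
  by (auto simp: rinv_def)

lemma wff_T1 [simp]:
  assumes "wt s" "tyof s = T1"
  shows "wff (binary s)" "wff (is_real s)" "wff (unit_interval s)" "wff (binary_tree s)"
    "\<And>t. wt t \<Longrightarrow> tyof t = T1 \<Longrightarrow> wff (s <\<^sub>R t) \<and> wff (s \<le>\<^sub>R t) \<and> wff (s \<approx>\<^sub>R t) \<and> wff (s \<approx>\<^sub>1 t)"
    "\<And>t k. wt t \<Longrightarrow> tyof t = T1 \<Longrightarrow> wt k \<Longrightarrow> tyof k = Tn \<Longrightarrow> wff (apart s t k)"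
    "\<And>t. wt t \<Longrightarrow> tyof t = Tseq Tn \<Longrightarrow> wff (in_tree t s)"
  using assms by (auto simp: binary_def is_real_def unit_interval_def binary_tree_def rless_def rleq_def
      approxR_def approx1_def apart_def Let_def in_tree_def)

lemma internal_T1 [simp]: "internal (binary s)" "internal (is_real s)" "internal (unit_interval s)"
    "internal (binary_tree s)" "internal (apart s t k)" "internal (in_tree t s)"
  by (auto simp: binary_def is_real_def unit_interval_def binary_tree_def rless_def rleq_def
      apart_def Let_def in_tree_def)

context P_num
begin

section \<open>Standard objects\<close>

lemma st_cv: "wt t \<Longrightarrow> fvt t = {} \<Longrightarrow> st (cv t)"
  using sat_ax[OF ax_st_closed[of t], of eb] by (simp add: cv_def)

lemma st_ap: "f \<in> D (\<sigma> \<rightarrow> \<tau>) \<Longrightarrow> a \<in> D \<sigma> \<Longrightarrow> st f \<Longrightarrow> st a \<Longrightarrow> st (ap f a)"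
  using sat_ax[OF ax_st_app[of "V (0, \<sigma> \<rightarrow> \<tau>)" "V (1, \<sigma>)"], of "eb((0, \<sigma> \<rightarrow> \<tau>) := f, (1, \<sigma>) := a)"]
  by simp

lemma st_val: "wt t \<Longrightarrow> good e \<Longrightarrow> \<forall>x\<in>fvt t. st (e x) \<Longrightarrow> st (val e t)"
proof (induction t)
  case (Cn c)
  then show ?case using st_cv[of "Cn c"] by (simp add: cv_def)
next
  case (App s t)
  then obtain \<sigma> \<tau> where "tyof s = \<sigma> \<rightarrow> \<tau>" "tyof t = \<sigma>" by (auto split: ty.splits)
  then show ?case using App st_ap[of "val e s" \<sigma> \<tau> "val e t"] by simp
qed auto

lemma st_Z0 [simp]: "st Z0" using st_cv[of zero] by (simp add: cv_def)
lemma st_Sc [simp]: "a \<in> N \<Longrightarrow> st a \<Longrightarrow> st (Sc' a)"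
  using st_val[of "suc v0" "eb((0, Tn) := a)"] by simp
lemma st_pl [simp]: "a \<in> N \<Longrightarrow> b \<in> N \<Longrightarrow> st a \<Longrightarrow> st b \<Longrightarrow> st (pl a b)"
  using st_val[of "plus v0 v1" "eb((0, Tn) := a, (1, Tn) := b)"] by simp
lemma st_pw [simp]: "a \<in> N \<Longrightarrow> st a \<Longrightarrow> st (pw a)"
  using st_val[of "pow2 v0" "eb((0, Tn) := a)"] by simp
lemma st_ap2 [simp]: "a \<in> D T2 \<Longrightarrow> b \<in> D T1 \<Longrightarrow> st a \<Longrightarrow> st b \<Longrightarrow> st (ap a b)"
  by (rule st_ap)

text \<open>By external induction on n: a number that is at most d + 1 is at most d or equal to d +
  1.\<close>

lemma st_below:
  assumes "n \<in> N" "st n" "m \<in> N" "\<kappa> m \<le> \<kappa> n" shows "st m"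
proof -
  have step: "st m" if "d \<in> N" "st d" "\<forall>m\<in>N. \<kappa> m \<le> \<kappa> d \<longrightarrow> st m" "m \<in> N" "\<kappa> m \<le> \<kappa> (Sc' d)" for d m
  proof (cases "\<kappa> m \<le> \<kappa> d")
    case False
    then have "\<kappa> m = \<kappa> d + 1" using \<kappa>_less[of d m] that by simp
    then have "m = Sc' d" using that by (simp add: \<kappa>_eq)
    then show ?thesis using that by simp
  qed (use that in blast)
  have "\<forall>m\<in>N. \<kappa> m \<le> \<kappa> n \<longrightarrow> st m"
  proof (rule ext_indP[of "all (1, Tn) ((v1 \<le>\<^sub>0 v0) \<longrightarrow>\<^sub>f St v1)" eb 0 "\<lambda>n. \<forall>m\<in>N. \<kappa> m \<le> \<kappa> n \<longrightarrow> st m"])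
    show "\<forall>m\<in>N. \<kappa> m \<le> \<kappa> (Sc' d) \<longrightarrow> st m" if "d \<in> N" "st d" "\<forall>m\<in>N. \<kappa> m \<le> \<kappa> d \<longrightarrow> st m" for d
      using step[OF that] by blast
  qed (use assms in simp_all)
  then show ?thesis using assms by blast
qed

text \<open>The length of a standard sequence is standard, hence so is every position, by
  \<open>st_below\<close>. Thus facts about standard objects apply to the entries of the lists w in
  the principles.\<close>

lemma st_me: "me \<sigma> a w \<Longrightarrow> w \<in> D (Tseq \<sigma>) \<Longrightarrow> st w \<Longrightarrow> st a"
proof -
  assume "me \<sigma> a w" and w: "w \<in> D (Tseq \<sigma>)" "st w"
  then obtain i where i: "i \<in> N" "\<kappa> i < \<kappa> (ln \<sigma> w)" "a = nt \<sigma> w i" by (auto simp: me_def)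
  have "st (ln \<sigma> w)" using st_val[of "len (V (0, Tseq \<sigma>))" "eb((0, Tseq \<sigma>) := w)"] w by simp
  then have "st i" using st_below[of "ln \<sigma> w" i] i w by simp
  then show ?thesis
    using st_val[of "nth (V (0, Tseq \<sigma>)) v1" "eb((0, Tseq \<sigma>) := w, (1, Tn) := i)"] w i by simp
qed

lemma hac:
  assumes "internal \<phi>" "wff \<phi>" "x \<noteq> y" "good e"
    and "\<And>a. a \<in> D (snd x) \<Longrightarrow> st a \<Longrightarrow> \<exists>b\<in>D (snd y). st b \<and> sat (e(x := a, y := b)) \<phi>"
  obtains F where "F \<in> D (snd x \<rightarrow> Tseq (snd y))" "st F"
    "\<And>a. a \<in> D (snd x) \<Longrightarrow> st a \<Longrightarrow> \<exists>b\<in>D (snd y). me (snd y) b (ap F a) \<and> sat (e(x := a, y := b)) \<phi>"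
proof -
  obtain k where k: "(k, snd x \<rightarrow> Tseq (snd y)) \<notin> fv \<phi> \<union> {x, y}"
    using fresh_var[of "fv \<phi> \<union> {x, y}"] by auto
  let ?F = "(k, snd x \<rightarrow> Tseq (snd y))"
  have drop: "sat (e(?F := f, x := a, y := b)) \<phi> = sat (e(x := a, y := b)) \<phi>" for f a b
    using k by (intro sat_cong) auto
  have w: "wff (V y \<in>\<^sub>f V ?F \<cdot> V x)" by (rule mem_typed[of _ "snd y"]) auto
  have mm: "sat (e(?F := f, x := a, y := b)) (V y \<in>\<^sub>f V ?F \<cdot> V x) \<longleftrightarrow> me (snd y) b (ap f a)"
    if "f \<in> D (snd x \<rightarrow> Tseq (snd y))" "a \<in> D (snd x)" "b \<in> D (snd y)" for f a b
    using that k assms(3,4) by (subst sat_mem[of _ "snd y"]) auto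
  have "sat e (allst x (exst y \<phi>) \<longrightarrow>\<^sub>f exst ?F (allst x (ex y ((V y \<in>\<^sub>f V ?F \<cdot> V x) \<and>\<^sub>f \<phi>))))"
    using assms k w by (intro sat_ax ax_HAC) auto
  then obtain f where "f \<in> D (snd x \<rightarrow> Tseq (snd y))" "st f"
    "\<And>a. a \<in> D (snd x) \<Longrightarrow> st a \<Longrightarrow> \<exists>b\<in>D (snd y).
      sat (e(?F := f, x := a, y := b)) (V y \<in>\<^sub>f V ?F \<cdot> V x) \<and> sat (e(?F := f, x := a, y := b)) \<phi>"
    using assms(2,5) w by auto
  then show ?thesis using that[of f] mm drop by metis
qed

lemma ideal:
  assumes "internal \<phi>" "wff \<phi>" "x \<noteq> y" "good e"
    and "\<And>w. w \<in> D (Tseq (snd x)) \<Longrightarrow> st w \<Longrightarrow>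
      \<exists>b\<in>D (snd y). \<forall>a\<in>D (snd x). me (snd x) a w \<longrightarrow> sat (e(y := b, x := a)) \<phi>"
  obtains b where "b \<in> D (snd y)" "\<And>a. a \<in> D (snd x) \<Longrightarrow> st a \<Longrightarrow> sat (e(y := b, x := a)) \<phi>"
proof -
  obtain k where k: "(k, Tseq (snd x)) \<notin> fv \<phi> \<union> {x, y}"
    using fresh_var[of "fv \<phi> \<union> {x, y}"] by auto
  let ?w = "(k, Tseq (snd x))"
  have drop: "sat (e(?w := f, y := b, x := a)) \<phi> = sat (e(y := b, x := a)) \<phi>" for f a b
    using k by (intro sat_cong) auto
  have w: "wff (V x \<in>\<^sub>f V ?w)" by (rule mem_typed[of _ "snd x"]) auto
  have mm: "sat (e(?w := f, y := b, x := a)) (V x \<in>\<^sub>f V ?w) \<longleftrightarrow> me (snd x) a f"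
    if "f \<in> D (Tseq (snd x))" "a \<in> D (snd x)" "b \<in> D (snd y)" for f a b
    using that k assms(3,4) by (subst sat_mem[of _ "snd x"]) auto
  have "sat e (allst ?w (ex y (all x ((V x \<in>\<^sub>f V ?w) \<longrightarrow>\<^sub>f \<phi>))) \<longrightarrow>\<^sub>f ex y (allst x \<phi>))"
    using assms k w by (intro sat_ax ax_I) auto
  moreover have "sat e (allst ?w (ex y (all x ((V x \<in>\<^sub>f V ?w) \<longrightarrow>\<^sub>f \<phi>))))"
  proof -
    have "\<exists>b\<in>D (snd y). \<forall>a\<in>D (snd x). sat (e(?w := f, y := b, x := a)) (V x \<in>\<^sub>f V ?w) \<longrightarrow>
        sat (e(?w := f, y := b, x := a)) \<phi>" if "f \<in> D (Tseq (snd x))" "st f" for f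
      using assms(5)[OF that] mm[OF that(1)] drop by metis
    then show ?thesis using w assms(2) by simp
  qed
  ultimately obtain b where "b \<in> D (snd y)" "\<forall>a\<in>D (snd x). st a \<longrightarrow> sat (e(y := b, x := a)) \<phi>"
    using assms(2) by auto
  then show ?thesis using that by blast
qed

abbreviation "sm w \<equiv> ap (cv sum_tm) w"
abbreviation "sm1 w \<equiv> ap (cv sum1_tm) w"

lemma val_sum_tm [simp]: "val e sum_tm = cv sum_tm" "val e sum1_tm = cv sum1_tm" by (simp_all add: val_closed)

lemma sm_N [simp]: "w \<in> D (Tseq Tn) \<Longrightarrow> sm w \<in> N" "w \<in> D (Tseq T1) \<Longrightarrow> sm1 w \<in> N"
  by (rule ap_D cv_D | simp)+
lemma sm_st [simp]: "w \<in> D (Tseq Tn) \<Longrightarrow> st w \<Longrightarrow> st (sm w)" "w \<in> D (Tseq T1) \<Longrightarrow> st w \<Longrightarrow> st (sm1 w)"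
  using st_val[of "sum_tm \<cdot> V (0, Tseq Tn)" "eb((0, Tseq Tn) := w)"]
    st_val[of "sum1_tm \<cdot> V (0, Tseq T1)" "eb((0, Tseq T1) := w)"] by simp_all
lemma sm_rec [simp]: "sm (nl Tn) = Z0" "a \<in> N \<Longrightarrow> w \<in> D (Tseq Tn) \<Longrightarrow> sm (cns Tn a w) = pl (sm w) a"
  "sm1 (nl T1) = Z0" "f \<in> D T1 \<Longrightarrow> v \<in> D (Tseq T1) \<Longrightarrow> sm1 (cns T1 f v) = pl (sm1 v) (ap f Z0)"
  by (simp_all add: sum_tm_def sum1_tm_def cv_def Let_def)

lemma sm_bound:
  assumes "me Tn a w" "w \<in> D (Tseq Tn)" shows "\<kappa> a \<le> \<kappa> (sm w)"
proof -
  have "\<forall>a\<in>N. me Tn a w \<longrightarrow> \<kappa> a \<le> \<kappa> (sm w)"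
  proof (rule seq_indP[of "all (1, Tn) ((v1 \<in>\<^sub>f V (0, Tseq Tn)) \<longrightarrow>\<^sub>f (v1 \<le>\<^sub>0 sum_tm \<cdot> V (0, Tseq Tn)))" eb Tn 0
      "\<lambda>w. \<forall>a\<in>N. me Tn a w \<longrightarrow> \<kappa> a \<le> \<kappa> (sm w)"])
    show "\<forall>a\<in>N. me Tn a (cns Tn b u) \<longrightarrow> \<kappa> a \<le> \<kappa> (sm (cns Tn b u))"
      if b: "b \<in> N" "u \<in> D (Tseq Tn)" and s: "\<forall>a\<in>N. me Tn a u \<longrightarrow> \<kappa> a \<le> \<kappa> (sm u)" for b u
    proof (intro ballI impI)
      fix c assume "c \<in> N" "me Tn c (cns Tn b u)"
      then have "c = b \<or> \<kappa> c \<le> \<kappa> (sm u)" using s b by auto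
      then show "\<kappa> c \<le> \<kappa> (sm (cns Tn b u))"
        using b by (elim disjE) (simp_all add: add_increasing2)
    qed
  qed (use assms in simp_all)
  then show ?thesis using assms me_D by blast
qed

lemma sm1_bound:
  assumes "me T1 a w" "w \<in> D (Tseq T1)" shows "\<kappa> (ap a Z0) \<le> \<kappa> (sm1 w)"
proof -
  have "\<forall>a\<in>D T1. me T1 a w \<longrightarrow> \<kappa> (ap a Z0) \<le> \<kappa> (sm1 w)"
  proof (rule seq_indP[of "all (1, T1) ((V (1, T1) \<in>\<^sub>f V (0, Tseq T1)) \<longrightarrow>\<^sub>f
      (V (1, T1) \<cdot> zero \<le>\<^sub>0 sum1_tm \<cdot> V (0, Tseq T1)))" eb T1 0
      "\<lambda>w. \<forall>a\<in>D T1. me T1 a w \<longrightarrow> \<kappa> (ap a Z0) \<le> \<kappa> (sm1 w)"])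
    show "\<forall>a\<in>D T1. me T1 a (cns T1 b u) \<longrightarrow> \<kappa> (ap a Z0) \<le> \<kappa> (sm1 (cns T1 b u))"
      if b: "b \<in> D T1" "u \<in> D (Tseq T1)" and s: "\<forall>a\<in>D T1. me T1 a u \<longrightarrow> \<kappa> (ap a Z0) \<le> \<kappa> (sm1 u)" for b u
    proof (intro ballI impI)
      fix c assume "c \<in> D T1" "me T1 c (cns T1 b u)"
      then have "c = b \<or> \<kappa> (ap c Z0) \<le> \<kappa> (sm1 u)" using s b by auto
      then show "\<kappa> (ap c Z0) \<le> \<kappa> (sm1 (cns T1 b u))"
        using b by (elim disjE) (simp_all add: add_increasing2)
    qed
  qed (use assms in simp_all)
  then show ?thesis using assms me_D by blast
qed

text \<open>Idealisation of n \<le> M, where the sum of a finite list bounds its entries.\<close>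

lemma infinite_number: obtains M where "M \<in> N" "\<And>n. n \<in> N \<Longrightarrow> st n \<Longrightarrow> \<kappa> n \<le> \<kappa> M"
proof -
  obtain b where "b \<in> D (snd (1 :: nat, Tn))"
    "\<And>a. a \<in> D (snd (0 :: nat, Tn)) \<Longrightarrow> st a \<Longrightarrow> sat (eb((1, Tn) := b, (0, Tn) := a)) (v0 \<le>\<^sub>0 v1)"
  proof (rule ideal)
    fix w assume "w \<in> D (Tseq (snd (0 :: nat, Tn)))" "st w"
    then show "\<exists>b\<in>D (snd (1 :: nat, Tn)). \<forall>a\<in>D (snd (0 :: nat, Tn)). me (snd (0 :: nat, Tn)) a w \<longrightarrow>
        sat (eb((1, Tn) := b, (0, Tn) := a)) (v0 \<le>\<^sub>0 v1)"
      using sm_bound[of _ w] by (intro bexI[of _ "sm w"]) auto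
  qed auto
  then show ?thesis by (intro that[of b]) auto
qed

section \<open>Rational numbers\<close>

abbreviation "tr a \<equiv> ap (cv tri_tm) a"
lemma val_tri_tm [simp]: "val e tri_tm = cv tri_tm" by (simp add: val_closed)
lemma tr_N [simp]: "a \<in> N \<Longrightarrow> tr a \<in> N" by (rule ap_D cv_D | simp)+
lemma tr_rec: "tr Z0 = Z0" "a \<in> N \<Longrightarrow> tr (Sc' a) = pl (tr a) (Sc' a)"
  by (simp_all add: tri_tm_def cv_def Let_def)

lemma \<kappa>_tr: "a \<in> N \<Longrightarrow> \<kappa> (tr a) = \<kappa> a * (\<kappa> a + 1) / 2"
proof -
  assume a: "a \<in> N"
  have "2 * \<kappa> (tr a) = \<kappa> a * (\<kappa> a + 1)"
  proof (rule indP[of "times two (tri_tm \<cdot> v0) \<doteq> times v0 (suc v0)" eb 0 "\<lambda>a. 2 * \<kappa> (tr a) = \<kappa> a * (\<kappa> a + 1)"])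
    show "2 * \<kappa> (tr (Sc' d)) = \<kappa> (Sc' d) * (\<kappa> (Sc' d) + 1)"
      if "d \<in> N" "2 * \<kappa> (tr d) = \<kappa> d * (\<kappa> d + 1)" for d
      using that by (simp add: tr_rec algebra_simps)
  qed (use a in \<open>simp_all add: tr_rec \<kappa>_eq\<close>)
  then show ?thesis by simp
qed

definition pa :: "'a \<Rightarrow> 'a \<Rightarrow> 'a" where "pa a b = ap (ap (cv pair_tm) a) b"
lemma val_pair [simp]: "val e (pair s t) = pa (val e s) (val e t)" by (simp add: pair_def pa_def val_closed)
lemma pa_N [simp]: "a \<in> N \<Longrightarrow> b \<in> N \<Longrightarrow> pa a b \<in> N" unfolding pa_def by (rule ap_D cv_D | simp)+
lemma \<kappa>_pa: "a \<in> N \<Longrightarrow> b \<in> N \<Longrightarrow> \<kappa> (pa a b) = (\<kappa> a + \<kappa> b) * (\<kappa> a + \<kappa> b + 1) / 2 + \<kappa> b"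
  by (simp add: pa_def pair_tm_def cv_def[of "lam _ _"] Let_def \<kappa>_tr)

text \<open>A pair on a later diagonal has a larger code. So the code determines the diagonal, and
  then the position on it.\<close>

lemma pa_inj:
  assumes "a \<in> N" "b \<in> N" "c \<in> N" "d \<in> N" "pa a b = pa c d" shows "a = c \<and> b = d"
proof -
  have key: False if "a \<in> N" "b \<in> N" "c \<in> N" "d \<in> N" "\<kappa> (pa a b) = \<kappa> (pa c d)"
    "\<kappa> a + \<kappa> b < \<kappa> c + \<kappa> d" for a b c d
  proof -
    have "\<kappa> a + \<kappa> b + 1 \<le> \<kappa> c + \<kappa> d" using \<kappa>_less[of "pl a b" "pl c d"] that by simp
    moreover have n: "0 \<le> \<kappa> a" "0 \<le> \<kappa> b" "0 \<le> \<kappa> d" using that by simp_all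
    ultimately have "(\<kappa> a + \<kappa> b + 1) * (\<kappa> a + \<kappa> b + 2) \<le> (\<kappa> c + \<kappa> d) * (\<kappa> c + \<kappa> d + 1)"
      by (intro mult_mono) auto
    then have "(\<kappa> a + \<kappa> b) * (\<kappa> a + \<kappa> b + 1) / 2 + (\<kappa> a + \<kappa> b + 1) \<le> (\<kappa> c + \<kappa> d) * (\<kappa> c + \<kappa> d + 1) / 2"
      by (simp add: field_simps)
    then show False using that n by (simp add: \<kappa>_pa)
  qed
  have "\<kappa> a + \<kappa> b = \<kappa> c + \<kappa> d" using key[of a b c d] key[of c d a b] assms by (metis linorder_neqE)
  moreover from this have "\<kappa> b = \<kappa> d" using arg_cong[OF assms(5), of \<kappa>] assms(1-4) by (simp add: \<kappa>_pa)
  ultimately show ?thesis using assms by (simp add: \<kappa>_eq)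
qed

definition iz :: "ty \<Rightarrow> 'a \<Rightarrow> 'a \<Rightarrow> 'a \<Rightarrow> 'a" where "iz \<sigma> a b c = ap (ap (ap (cv (ifz_tm \<sigma>)) a) b) c"
lemma val_ifz [simp]: "val e (ifz s t u) = iz (tyof t) (val e s) (val e t) (val e u)"
  by (simp add: ifz_def iz_def val_closed)
lemma iz_rec: "b \<in> D \<sigma> \<Longrightarrow> c \<in> D \<sigma> \<Longrightarrow> iz \<sigma> Z0 b c = b"
  "a \<in> N \<Longrightarrow> b \<in> D \<sigma> \<Longrightarrow> c \<in> D \<sigma> \<Longrightarrow> iz \<sigma> (Sc' a) b c = c"
  by (simp_all add: iz_def ifz_tm_def cv_def Let_def)
lemma iz_if: "a \<in> N \<Longrightarrow> b \<in> D \<sigma> \<Longrightarrow> c \<in> D \<sigma> \<Longrightarrow> iz \<sigma> a b c = (if a = Z0 then b else c)"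
  by (erule N_cases[of a]) (auto simp: iz_rec Sc'_neq)

abbreviation "l2 a b \<equiv> cns Tn a (cns Tn b (nl Tn))"
lemma val_list2 [simp]: "tyof s = Tn \<Longrightarrow> tyof t = Tn \<Longrightarrow> val e (list2 s t) = l2 (val e s) (val e t)"
  by (simp add: list2_def)

abbreviation "up a \<equiv> ap (cv unpair_tm) a"
lemma val_unpair_tm [simp]: "val e unpair_tm = cv unpair_tm" by (simp add: val_closed)
lemma up_D [simp]: "a \<in> N \<Longrightarrow> up a \<in> D (Tseq Tn)" by (rule ap_D cv_D | simp)+
definition pf :: "'a \<Rightarrow> 'a" where "pf a = nt Tn (up a) Z0"
definition ps :: "'a \<Rightarrow> 'a" where "ps a = nt Tn (up a) (Sc' Z0)"
lemma val_pfst [simp]: "val e (pfst t) = pf (val e t)" and val_psnd [simp]: "val e (psnd t) = ps (val e t)"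
  by (simp_all add: pfst_def psnd_def pf_def ps_def)
lemma pf_N [simp]: "a \<in> N \<Longrightarrow> pf a \<in> N" and ps_N [simp]: "a \<in> N \<Longrightarrow> ps a \<in> N"
  by (simp_all add: pf_def ps_def)
lemma up_rec: "up Z0 = l2 Z0 Z0"
  "a \<in> N \<Longrightarrow> up (Sc' a) = (if pf a = Z0 then l2 (Sc' (ps a)) Z0 else l2 (pr (pf a)) (Sc' (ps a)))"
  by (simp_all add: unpair_tm_def cv_def Let_def pf_def ps_def iz_if)
lemma pf_ps_rec: "pf Z0 = Z0" "ps Z0 = Z0"
  "a \<in> N \<Longrightarrow> pf (Sc' a) = (if pf a = Z0 then Sc' (ps a) else pr (pf a))"
  "a \<in> N \<Longrightarrow> ps (Sc' a) = (if pf a = Z0 then Z0 else Sc' (ps a))"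
  by (simp_all add: pf_def[of "Sc' _"] ps_def[of "Sc' _"] pf_def[of Z0] ps_def[of Z0] up_rec)

text \<open>The walk of \<open>unpair_tm\<close> increases the code of the current pair by exactly 1
  at each step, both along a diagonal and at the passage to the next one.\<close>

lemma pa_pf_ps: "a \<in> N \<Longrightarrow> pa (pf a) (ps a) = a"
proof -
  assume a: "a \<in> N"
  have "pa (pf (Sc' d)) (ps (Sc' d)) = Sc' d" if d: "d \<in> N" "pa (pf d) (ps d) = d" for d
    using pf_N[OF d(1)]
  proof (cases rule: N_cases)
    case 1
    have e: "\<kappa> d = \<kappa> (ps d) * (\<kappa> (ps d) + 1) / 2 + \<kappa> (ps d)"
      using arg_cong[OF d(2), of \<kappa>] 1 d(1) by (simp add: \<kappa>_pa)
    have "pa (Sc' (ps d)) Z0 = Sc' d"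
      by (rule \<kappa>_inj) (use d(1) in \<open>simp_all add: \<kappa>_pa e field_simps\<close>)
    then show ?thesis using d(1) 1 by (simp add: pf_ps_rec)
  next
    case (2 b)
    have e: "\<kappa> d = (\<kappa> b + 1 + \<kappa> (ps d)) * (\<kappa> b + 1 + \<kappa> (ps d) + 1) / 2 + \<kappa> (ps d)"
      using arg_cong[OF d(2), of \<kappa>] 2 d(1) by (simp add: \<kappa>_pa)
    have "pa b (Sc' (ps d)) = Sc' d"
      by (rule \<kappa>_inj) (use d(1) 2(1) in \<open>simp_all add: \<kappa>_pa e field_simps\<close>)
    then show ?thesis using d(1) 2 by (simp add: pf_ps_rec pr_rec Sc'_neq)
  qed
  note s = this
  have z: "pa Z0 Z0 = Z0" by (rule \<kappa>_inj) (simp_all add: \<kappa>_pa)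
  show ?thesis
  proof (rule indP[of "pair (pfst v0) (psnd v0) \<doteq> v0" eb 0 "\<lambda>d. pa (pf d) (ps d) = d"])
    show "pa (pf (Sc' d)) (ps (Sc' d)) = Sc' d" if "d \<in> N" "pa (pf d) (ps d) = d" for d
      using that by (rule s)
  qed (use a in \<open>simp_all add: pf_ps_rec(1,2) z\<close>)
qed

lemma pf_pa [simp]: "a \<in> N \<Longrightarrow> b \<in> N \<Longrightarrow> pf (pa a b) = a" "a \<in> N \<Longrightarrow> b \<in> N \<Longrightarrow> ps (pa a b) = b"
  using pa_inj[of "pf (pa a b)" "ps (pa a b)" a b] pa_pf_ps[of "pa a b"] by simp_all

definition qv :: "'a \<Rightarrow> 'k" where "qv c = (\<kappa> (pf (pf c)) - \<kappa> (ps (pf c))) / (\<kappa> (ps c) + 1)"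
definition qt :: "'a \<Rightarrow> 'a \<Rightarrow> 'a \<Rightarrow> 'a" where "qt p q d = pa (pa p q) (pr d)"
lemma val_quot [simp]: "val e (quot p q d) = qt (val e p) (val e q) (val e d)"
  by (simp add: quot_def qt_def)
lemma qt_N [simp]: "p \<in> N \<Longrightarrow> q \<in> N \<Longrightarrow> d \<in> N \<Longrightarrow> qt p q d \<in> N" by (simp add: qt_def)
lemma qv_qt [simp]: "p \<in> N \<Longrightarrow> q \<in> N \<Longrightarrow> d \<in> N \<Longrightarrow> 0 < \<kappa> d \<Longrightarrow> qv (qt p q d) = (\<kappa> p - \<kappa> q) / \<kappa> d"
  using \<kappa>_less[of Z0 d] by (simp add: qv_def qt_def \<kappa>_pr)

lemma sat_qless [simp]: "wt s \<Longrightarrow> wt t \<Longrightarrow> tyof s = Tn \<Longrightarrow> tyof t = Tn \<Longrightarrow> good e \<Longrightarrow>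
    sat e (s <\<^sub>Q t) \<longleftrightarrow> qv (val e s) < qv (val e t)"
  and sat_qleq [simp]: "wt s \<Longrightarrow> wt t \<Longrightarrow> tyof s = Tn \<Longrightarrow> tyof t = Tn \<Longrightarrow> good e \<Longrightarrow>
    sat e (s \<le>\<^sub>Q t) \<longleftrightarrow> qv (val e s) \<le> qv (val e t)"
proof -
  have *: "a * d + c' * b < c * b + a' * d \<longleftrightarrow> (a - a') / b < (c - c') / d"
    "a * d + c' * b \<le> c * b + a' * d \<longleftrightarrow> (a - a') / b \<le> (c - c') / d" if "0 < b" "0 < d"
    for a a' b c c' d :: 'k using that by (simp_all add: divide_simps algebra_simps)
  assume a: "wt s" "wt t" "tyof s = Tn" "tyof t = Tn" "good e"
  then have p: "0 < \<kappa> (ps (val e s)) + 1" "0 < \<kappa> (ps (val e t)) + 1" by simp_all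
  show "sat e (s <\<^sub>Q t) \<longleftrightarrow> qv (val e s) < qv (val e t)" "sat e (s \<le>\<^sub>Q t) \<longleftrightarrow> qv (val e s) \<le> qv (val e t)"
    using a by (simp_all add: qless_def qleq_def qpos_def qneg_def qden_def qv_def *[OF p])
qed

definition qpl :: "'a \<Rightarrow> 'a \<Rightarrow> 'a" where "qpl a b = ap (ap (cv qplus_tm) a) b"
definition qd :: "'a \<Rightarrow> 'a \<Rightarrow> 'a" where "qd a b = ap (ap (cv qdist_tm) a) b"
lemma val_qplus [simp]: "val e (qplus s t) = qpl (val e s) (val e t)"
  and val_qdist [simp]: "val e (qdist s t) = qd (val e s) (val e t)"
  by (simp_all add: qplus_def qpl_def qdist_def qd_def val_closed)
lemma qpl_N [simp]: "a \<in> N \<Longrightarrow> b \<in> N \<Longrightarrow> qpl a b \<in> N"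
  unfolding qpl_def by (rule ap_D cv_D | simp)+
lemma qv_qpl [simp]: "a \<in> N \<Longrightarrow> b \<in> N \<Longrightarrow> qv (qpl a b) = qv a + qv b"
proof -
  assume a: "a \<in> N" "b \<in> N"
  have p: "0 < \<kappa> (ps a) + 1" "0 < \<kappa> (ps b) + 1" using a by simp_all
  then have nz: "\<kappa> (ps a) + 1 \<noteq> 0" "\<kappa> (ps b) + 1 \<noteq> 0" by auto
  have "qpl a b = qt (pl (ti (pf (pf a)) (Sc' (ps b))) (ti (pf (pf b)) (Sc' (ps a))))
      (pl (ti (ps (pf a)) (Sc' (ps b))) (ti (ps (pf b)) (Sc' (ps a)))) (ti (Sc' (ps a)) (Sc' (ps b)))"
    using a by (simp add: qpl_def qplus_tm_def cv_def[of "lam _ _"] Let_def qpos_def qneg_def qden_def)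
  then have "qv (qpl a b) = (\<kappa> (pf (pf a)) * (\<kappa> (ps b) + 1) + \<kappa> (pf (pf b)) * (\<kappa> (ps a) + 1)
      - (\<kappa> (ps (pf a)) * (\<kappa> (ps b) + 1) + \<kappa> (ps (pf b)) * (\<kappa> (ps a) + 1)))
      / ((\<kappa> (ps a) + 1) * (\<kappa> (ps b) + 1))"
    using a p by simp
  then show ?thesis using nz by (simp add: qv_def[of a] qv_def[of b] divide_simps) (simp add: algebra_simps)
qed
lemma qv_qd [simp]: "a \<in> N \<Longrightarrow> b \<in> N \<Longrightarrow> qv (qd a b) = \<bar>qv a - qv b\<bar>"
proof -
  assume a: "a \<in> N" "b \<in> N"
  have p: "0 < \<kappa> (ps a) + 1" "0 < \<kappa> (ps b) + 1" using a by simp_all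
  then have nz: "\<kappa> (ps a) + 1 \<noteq> 0" "\<kappa> (ps b) + 1 \<noteq> 0" by auto
  let ?a = "pl (ti (pf (pf a)) (Sc' (ps b))) (ti (ps (pf b)) (Sc' (ps a)))"
  let ?b = "pl (ti (ps (pf a)) (Sc' (ps b))) (ti (pf (pf b)) (Sc' (ps a)))"
  have "qd a b = qt (pl (mo ?a ?b) (mo ?b ?a)) Z0 (ti (Sc' (ps a)) (Sc' (ps b)))"
    using a by (simp add: qd_def qdist_tm_def cv_def[of "lam _ _"] Let_def qpos_def qneg_def qden_def)
  \<comment> \<open>At least one of the two truncated differences vanishes, so their sum is the
    absolute value.\<close>
  moreover have "\<kappa> (pl (mo ?a ?b) (mo ?b ?a)) = \<bar>\<kappa> ?a - \<kappa> ?b\<bar>" using a by (simp add: abs_if max_def)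
  ultimately have "qv (qd a b) = \<bar>\<kappa> ?a - \<kappa> ?b\<bar> / ((\<kappa> (ps a) + 1) * (\<kappa> (ps b) + 1))"
    using a p by simp
  also have "\<dots> = \<bar>(\<kappa> ?a - \<kappa> ?b) / ((\<kappa> (ps a) + 1) * (\<kappa> (ps b) + 1))\<bar>"
    using p by (simp add: abs_mult)
  also have "(\<kappa> ?a - \<kappa> ?b) / ((\<kappa> (ps a) + 1) * (\<kappa> (ps b) + 1)) = qv a - qv b"
    using a nz by (simp add: qv_def divide_simps) (simp add: algebra_simps)
  finally show ?thesis .
qed

lemma val_inv [simp]: "val e (inv_pow2 t) = qt (Sc' Z0) Z0 (pw (val e t))"
  "val e (two_inv_pow2 t) = qt (Sc' (Sc' Z0)) Z0 (pw (val e t))"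
  by (simp_all add: inv_pow2_def two_inv_pow2_def)

section \<open>Real numbers\<close>

definition R :: "'a \<Rightarrow> 'a \<Rightarrow> 'k" where "R x n = qv (ap x n)"
definition e2 :: "'a \<Rightarrow> 'k" where "e2 n = 1 / \<kappa> (pw n)"

lemma e2_pos [simp]: "n \<in> N \<Longrightarrow> 0 < e2 n" by (simp add: e2_def)
lemma e2_Sc [simp]: "n \<in> N \<Longrightarrow> e2 (Sc' n) = e2 n / 2" by (simp add: e2_def)
lemma e2_mono: "n \<in> N \<Longrightarrow> m \<in> N \<Longrightarrow> \<kappa> n \<le> \<kappa> m \<Longrightarrow> e2 m \<le> e2 n"
  using pw_mono[of n m] by (simp add: e2_def frac_le)

definition bin :: "'a \<Rightarrow> bool" where "bin a \<longleftrightarrow> (\<forall>n\<in>N. \<kappa> (ap a n) \<le> 1)"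
definition rl :: "'a \<Rightarrow> bool" where "rl x \<longleftrightarrow> (\<forall>n\<in>N. \<forall>i\<in>N. \<bar>R x n - R x (pl n i)\<bar> < e2 n)"
text \<open>The margin 2 * 2^(-n) comes from the strict order of reals: single approximations to a
  point of the unit interval may lie outside it.\<close>

definition ui :: "'a \<Rightarrow> bool" where
  "ui x \<longleftrightarrow> rl x \<and> (\<forall>n\<in>N. - 2 * e2 n \<le> R x n \<and> R x n \<le> 1 + 2 * e2 n)"
text \<open>The approximations have index n + 1, from the shift in \<open>rdist\<close>, while the
  margin of the strict order keeps the index n.\<close>

definition apt :: "'a \<Rightarrow> 'a \<Rightarrow> 'a \<Rightarrow> bool" where
  "apt x z k \<longleftrightarrow> k \<noteq> Z0 \<and> (\<exists>n\<in>N. 1 / \<kappa> k + 2 * e2 n < \<bar>R x (Sc' n) - R z (Sc' n)\<bar>)"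
definition btree :: "'a \<Rightarrow> bool" where
  "btree T \<longleftrightarrow> bin T \<and>
    (\<forall>s\<in>D (Tseq Tn). \<forall>t\<in>D (Tseq Tn). ap T (cd (app Tn s t)) = Sc' Z0 \<longrightarrow> ap T (cd s) = Sc' Z0) \<and>
    (\<forall>s\<in>D (Tseq Tn). ap T (cd s) = Sc' Z0 \<longrightarrow> (\<forall>m\<in>N. me Tn m s \<longrightarrow> \<kappa> m \<le> 1))"

lemma sat_binary [simp]: "wt a \<Longrightarrow> tyof a = T1 \<Longrightarrow> good e \<Longrightarrow> sat e (binary a) \<longleftrightarrow> bin (val e a)"
  by (simp add: binary_def Let_def bin_def)

lemma sat_in_tree [simp]: "sat e (in_tree s T) \<longleftrightarrow> ap (val e T) (cd (val e s)) = Sc' Z0"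
  by (simp add: in_tree_def)

lemma sat_binary_tree [simp]: "wt a \<Longrightarrow> tyof a = T1 \<Longrightarrow> good e \<Longrightarrow> sat e (binary_tree a) \<longleftrightarrow> btree (val e a)"
  by (simp add: binary_tree_def Let_def btree_def)

lemma sat_approx1 [simp]: "wt a \<Longrightarrow> tyof a = T1 \<Longrightarrow> wt b \<Longrightarrow> tyof b = T1 \<Longrightarrow> good e \<Longrightarrow>
    sat e (a \<approx>\<^sub>1 b) \<longleftrightarrow> (\<forall>n\<in>N. st n \<longrightarrow> ap (val e a) n = ap (val e b) n)"
  by (simp add: approx1_def Let_def)

lemma sat_is_real [simp]: "wt a \<Longrightarrow> tyof a = T1 \<Longrightarrow> good e \<Longrightarrow> sat e (is_real a) \<longleftrightarrow> rl (val e a)"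
  by (simp add: is_real_def Let_def rl_def R_def e2_def)

lemma sat_rless [simp]: "wt a \<Longrightarrow> tyof a = T1 \<Longrightarrow> wt b \<Longrightarrow> tyof b = T1 \<Longrightarrow> good e \<Longrightarrow>
    sat e (a <\<^sub>R b) \<longleftrightarrow> (\<exists>n\<in>N. R (val e a) n + 2 * e2 n < R (val e b) n)"
  by (simp add: rless_def Let_def R_def e2_def)

lemma val_real_consts [simp]: "val e rzero = cv rzero" "val e rone = cv rone"
    "val e rdist_tm = cv rdist_tm" "val e rinv_tm = cv rinv_tm"
  by (simp_all add: val_closed)

lemma R_consts [simp]: "n \<in> N \<Longrightarrow> R (cv rzero) n = 0" "n \<in> N \<Longrightarrow> R (cv rone) n = 1"
  by (simp_all add: cv_def[of "lam _ _"] rzero_def rone_def R_def)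

lemma sat_unit_interval [simp]:
  "wt a \<Longrightarrow> tyof a = T1 \<Longrightarrow> good e \<Longrightarrow> sat e (unit_interval a) \<longleftrightarrow> ui (val e a)"
  by (simp add: unit_interval_def rleq_def ui_def not_less) (auto simp: algebra_simps)

lemma sat_approxR [simp]: "wt a \<Longrightarrow> tyof a = T1 \<Longrightarrow> wt b \<Longrightarrow> tyof b = T1 \<Longrightarrow> good e \<Longrightarrow>
    sat e (a \<approx>\<^sub>R b) \<longleftrightarrow> (\<forall>n\<in>N. st n \<longrightarrow> \<bar>R (val e a) n - R (val e b) n\<bar> \<le> 2 * e2 n)"
  by (simp add: approxR_def Let_def R_def e2_def)

lemma R_rdist: "wt s \<Longrightarrow> tyof s = T1 \<Longrightarrow> wt t \<Longrightarrow> tyof t = T1 \<Longrightarrow> good e \<Longrightarrow> n \<in> N \<Longrightarrow>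
    R (val e (rdist s t)) n = \<bar>R (val e s) (Sc' n) - R (val e t) (Sc' n)\<bar>"
  by (simp add: rdist_def rdist_tm_def[THEN arg_cong[of _ _ cv]] cv_def[of "lam _ _"] Let_def R_def)

lemma R_rinv: "wt s \<Longrightarrow> tyof s = Tn \<Longrightarrow> good e \<Longrightarrow> n \<in> N \<Longrightarrow> val e s \<noteq> Z0 \<Longrightarrow>
    R (val e (rinv s)) n = 1 / \<kappa> (val e s)"
proof -
  assume a: "wt s" "tyof s = Tn" "good e" "n \<in> N" "val e s \<noteq> Z0"
  then have "0 < \<kappa> (val e s)" by (simp add: less_le)
  then show ?thesis using a
    by (simp add: rinv_def rinv_tm_def[THEN arg_cong[of _ _ cv]] cv_def[of "lam _ _"] Let_def R_def)
qed

lemma sat_apart [simp]: "wt s \<Longrightarrow> tyof s = T1 \<Longrightarrow> wt t \<Longrightarrow> tyof t = T1 \<Longrightarrow> wt k \<Longrightarrow> tyof k = Tn \<Longrightarrow> good e \<Longrightarrow>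
    sat e (apart s t k) \<longleftrightarrow> apt (val e s) (val e t) (val e k)"
  by (auto simp: apart_def apt_def R_rdist R_rinv)

definition "stp \<longleftrightarrow> (\<forall>a\<in>D T1. bin a \<longrightarrow> (\<exists>b\<in>D T1. st b \<and> bin b \<and> (\<forall>n\<in>N. st n \<longrightarrow> ap a n = ap b n)))"
definition "stpR \<longleftrightarrow>
  (\<forall>x\<in>D T1. ui x \<longrightarrow> (\<exists>y\<in>D T1. st y \<and> ui y \<and> (\<forall>n\<in>N. st n \<longrightarrow> \<bar>R x n - R y n\<bar> \<le> 2 * e2 n)))"
definition "stpT \<longleftrightarrow>
  (\<forall>g\<in>D T2. st g \<longrightarrow> (\<exists>w\<in>D (Tseq T1). st w \<and> (\<exists>k\<in>N. st k \<and> (\<forall>T\<in>D T1. btree T \<longrightarrow>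
    (\<forall>a\<in>D T1. me T1 a w \<longrightarrow> ap T (cd (sg a (ap g a))) \<noteq> Sc' Z0) \<longrightarrow>
    (\<forall>b\<in>D T1. bin b \<longrightarrow> (\<exists>i\<in>N. \<kappa> i \<le> \<kappa> k \<and> ap T (cd (sg b i)) \<noteq> Sc' Z0))))))"
definition "stpC \<longleftrightarrow>
  (\<forall>g\<in>D T2. st g \<longrightarrow> (\<exists>w\<in>D (Tseq T1). st w \<and> (\<exists>k\<in>N. st k \<and> (\<forall>z\<in>D T1. rl z \<longrightarrow>
    (\<forall>y\<in>D T1. me T1 y w \<and> ui y \<longrightarrow> apt y z (ap g y)) \<longrightarrow> (\<forall>x\<in>D T1. ui x \<longrightarrow> apt x z k)))))"

lemma sat_principles: "good e \<Longrightarrow> sat e STP \<longleftrightarrow> stp" "good e \<Longrightarrow> sat e STP_R \<longleftrightarrow> stpR"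
  "good e \<Longrightarrow> sat e STP_tree \<longleftrightarrow> stpT" "good e \<Longrightarrow> sat e STP_cover \<longleftrightarrow> stpC"
  by (simp_all add: STP_def STP_R_def STP_tree_def STP_cover_def stp_def stpR_def stpT_def stpC_def Let_def)

end

context P_num
begin

text \<open>A constant function turns a standard number into a standard object of type 1 with this
  value at 0. This recovers the numerical half of an idealised statement.\<close>

definition cst :: "'a \<Rightarrow> 'a" where "cst k = ap (ci (Kc Tn Tn)) k"
lemma cst_D [simp]: "k \<in> N \<Longrightarrow> cst k \<in> D T1" unfolding cst_def by (rule ap_D[of _ Tn] ci_D' | simp)+
lemma ap_cst [simp]: "k \<in> N \<Longrightarrow> n \<in> N \<Longrightarrow> ap (cst k) n = k" by (simp add: cst_def K_eq)
lemma st_cst [simp]: "k \<in> N \<Longrightarrow> st k \<Longrightarrow> st (cst k)"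
  using st_val[of "Cn (Kc Tn Tn) \<cdot> v0" "eb((0, Tn) := k)"] by (simp add: cst_def)

section \<open>Binary trees\<close>

lemma stp_imp_stpT: assumes stp shows stpT
  unfolding stpT_def
proof (intro ballI impI, rule ccontr)
  fix g assume g: "g \<in> D T2" "st g"
  assume neg: "\<not> (\<exists>w\<in>D (Tseq T1). st w \<and> (\<exists>k\<in>N. st k \<and> (\<forall>T\<in>D T1. btree T \<longrightarrow>
    (\<forall>a\<in>D T1. me T1 a w \<longrightarrow> ap T (cd (sg a (ap g a))) \<noteq> Sc' Z0) \<longrightarrow>
    (\<forall>b\<in>D T1. bin b \<longrightarrow> (\<exists>i\<in>N. \<kappa> i \<le> \<kappa> k \<and> ap T (cd (sg b i)) \<noteq> Sc' Z0)))))"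
  let ?a = "(0, T1)" and ?T = "(1, T1)" and ?g = "(2, T2)" and ?b = "(3, T1)" and ?i = "(4, Tn)"
  \<comment> \<open>The variable a has two tasks: it is a sequence that leaves T at height g(a), and
    its value at 0 is a height up to which T contains some binary b.\<close>
  let ?\<phi> = "binary_tree (V ?T) \<and>\<^sub>f \<not>\<^sub>f (in_tree (seg (V ?a) (V ?g \<cdot> V ?a)) (V ?T)) \<and>\<^sub>f
    ex ?b (binary (V ?b) \<and>\<^sub>f all ?i ((V ?i \<le>\<^sub>0 V ?a \<cdot> zero) \<longrightarrow>\<^sub>f in_tree (seg (V ?b) (V ?i)) (V ?T)))"
  let ?e = "eb(?g := g)"
  let ?P = "\<lambda>T a. btree T \<and> ap T (cd (sg a (ap g a))) \<noteq> Sc' Z0 \<and>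
    (\<exists>b\<in>D T1. bin b \<and> (\<forall>i\<in>N. \<kappa> i \<le> \<kappa> (ap a Z0) \<longrightarrow> ap T (cd (sg b i)) = Sc' Z0))"
  have ex: "sat (?e(?T := T, ?a := a)) ?\<phi> \<longleftrightarrow> ?P T a" if "T \<in> D T1" "a \<in> D T1" for T a
    using that g by simp
  obtain T where T: "T \<in> D T1" "\<And>a. a \<in> D T1 \<Longrightarrow> st a \<Longrightarrow> ?P T a"
  proof (rule ideal[of ?\<phi> ?a ?T ?e])
    fix w assume w: "w \<in> D (Tseq (snd ?a))" "st w"
    from neg have "\<forall>w\<in>D (Tseq T1). st w \<longrightarrow> (\<forall>k\<in>N. st k \<longrightarrow> (\<exists>T\<in>D T1. btree T \<and>
        (\<forall>a\<in>D T1. me T1 a w \<longrightarrow> ap T (cd (sg a (ap g a))) \<noteq> Sc' Z0) \<and>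
        (\<exists>b\<in>D T1. bin b \<and> (\<forall>i\<in>N. \<kappa> i \<le> \<kappa> k \<longrightarrow> ap T (cd (sg b i)) = Sc' Z0))))"
      by simp
    from this[rule_format, of w "sm1 w"] w obtain T b where T: "T \<in> D T1" "btree T" "b \<in> D T1" "bin b"
      "\<forall>a\<in>D T1. me T1 a w \<longrightarrow> ap T (cd (sg a (ap g a))) \<noteq> Sc' Z0"
      "\<forall>i\<in>N. \<kappa> i \<le> \<kappa> (sm1 w) \<longrightarrow> ap T (cd (sg b i)) = Sc' Z0"
      by auto
    have "?P T a" if "a \<in> D T1" "me T1 a w" for a
      using T that w sm1_bound[of a w] by (auto intro: order_trans)
    then show "\<exists>T\<in>D (snd ?T). \<forall>a\<in>D (snd ?a). me (snd ?a) a w \<longrightarrow> sat (?e(?T := T, ?a := a)) ?\<phi>"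
      using T(1) ex by auto
  next
    fix T assume "T \<in> D (snd ?T)" "\<And>a. a \<in> D (snd ?a) \<Longrightarrow> st a \<Longrightarrow> sat (?e(?T := T, ?a := a)) ?\<phi>"
    then show thesis using that[of T] ex[of T] by simp
  qed (use g in simp_all)
  \<comment> \<open>So far b depends on the height. A second idealisation provides one b for all
    standard heights.\<close>
  let ?\<psi> = "binary (V ?b) \<and>\<^sub>f in_tree (seg (V ?b) (V ?i)) (V ?T)"
  obtain b where b: "b \<in> D T1" "\<And>i. i \<in> N \<Longrightarrow> st i \<Longrightarrow> bin b \<and> ap T (cd (sg b i)) = Sc' Z0"
  proof (rule ideal[of ?\<psi> ?i ?b "eb(?T := T)"])
    fix w assume w: "w \<in> D (Tseq (snd ?i))" "st w"
    \<comment> \<open>The constant function with value \<open>sm w\<close> is standard, and its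
      value at 0 bounds all heights listed in w.\<close>
    then obtain b where b: "b \<in> D T1" "bin b"
      "\<forall>i\<in>N. \<kappa> i \<le> \<kappa> (sm w) \<longrightarrow> ap T (cd (sg b i)) = Sc' Z0"
      using T(2)[of "cst (sm w)"] by auto
    have "ap T (cd (sg b i)) = Sc' Z0" if "i \<in> N" "me Tn i w" for i
      using b that w sm_bound[of i w] by simp
    then show "\<exists>b\<in>D (snd ?b). \<forall>i\<in>D (snd ?i). me (snd ?i) i w \<longrightarrow> sat (eb(?T := T, ?b := b, ?i := i)) ?\<psi>"
      using T(1) b by (intro bexI[of _ b]) simp_all
  next
    fix b assume "b \<in> D (snd ?b)" "\<And>a. a \<in> D (snd ?i) \<Longrightarrow> st a \<Longrightarrow> sat (eb(?T := T, ?b := b, ?i := a)) ?\<psi>"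
    then show thesis using that[of b] T(1) by simp
  qed (use T(1) in simp_all)
  have "bin b" using b(2)[of Z0] by simp
  then obtain c where c: "c \<in> D T1" "st c" "\<And>n. n \<in> N \<Longrightarrow> st n \<Longrightarrow> ap b n = ap c n"
    using assms b(1) unfolding stp_def by blast
  have gc: "ap g c \<in> N" "st (ap g c)" using c g by simp_all
  \<comment> \<open>All places up to the standard number g(c) are standard, so c agrees with b
    there.\<close>
  then have "sg c (ap g c) = sg b (ap g c)"
    using c b(1) st_below[OF gc] by (simp add: sg_eq)
  then show False using T(2)[OF c(1,2)] b(2)[OF gc] by simp
qed

text \<open>The cut at height k makes membership a bounded search, so that the characteristic
  function is given by a term of P; the bar concerns heights up to k. The code 0 is that of the
  empty sequence, which a tree must contain but which is no \<open>sg a i\<close>, as this has i + 1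
  entries.\<close>

lemma seg_tree:
  assumes a: "a \<in> D T1" "bin a" and k: "k \<in> N"
  obtains T where "T \<in> D T1" "btree T"
    "\<And>c. c \<in> N \<Longrightarrow> ap T c = Sc' Z0 \<longleftrightarrow> c = Z0 \<or> (\<exists>i\<in>N. \<kappa> i \<le> \<kappa> k \<and> cd (sg a i) = c)"
proof -
  let ?a = "(0, T1)" and ?k = "(1, Tn)" and ?c = "(2, Tn)" and ?r = "(3, Tn)" and ?i = "(4, Tn)" and ?n = "(5, Tn)"
  let ?s = "code (seg (V ?a) (V ?i))"
  \<comment> \<open>The recursion over i returns 1 once the code of \<open>sg a i\<close> equals c.
    Equality is tested by the sum of the two truncated differences, and k + 1 steps examine all i
    \<le> k.\<close>
  let ?Z = "lam ?r (lam ?i (ifz (plus (monus ?s (V ?c)) (monus (V ?c) ?s)) one (V ?r)))"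
  let ?t = "lam ?c (ifz (V ?c) one (nrec (suc (V ?k)) zero ?Z))"
  let ?e = "eb(?a := a, ?k := k)"
  define T where "T = val ?e ?t"
  define f where "f c n = rec' Tn n Z0 (val (eb(?a := a, ?c := c)) ?Z)" for c n
  have f_N [simp]: "f c n \<in> N" if "c \<in> N" "n \<in> N" for c n using that a by (simp add: f_def)
  have f_rec: "f c Z0 = Z0" "f c (Sc' n) = (if cd (sg a n) = c then Sc' Z0 else f c n)" if "c \<in> N" "n \<in> N" for c n
  proof -
    let ?x = "cd (sg a n)"
    have "pl (mo ?x c) (mo c ?x) \<in> N" using that a by simp
    then have "pl (mo ?x c) (mo c ?x) = Z0 \<longleftrightarrow> \<kappa> (pl (mo ?x c) (mo c ?x)) = 0"
      by (rule \<kappa>_eq_0[symmetric])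
    also have "\<dots> \<longleftrightarrow> \<kappa> ?x = \<kappa> c" using that a by (auto simp: max_def)
    also have "\<dots> \<longleftrightarrow> ?x = c" using \<kappa>_inj[of ?x c] that a by auto
    finally show "f c Z0 = Z0" "f c (Sc' n) = (if cd (sg a n) = c then Sc' Z0 else f c n)"
      using that a by (simp_all add: f_def iz_if)
  qed
  have f_char: "\<kappa> (f c n) \<le> 1 \<and> (f c n = Sc' Z0 \<longleftrightarrow> (\<exists>i\<in>N. \<kappa> i < \<kappa> n \<and> cd (sg a i) = c))"
    if "c \<in> N" "n \<in> N" for c n
  proof (rule indP[of "(nrec (V ?n) zero ?Z \<le>\<^sub>0 one) \<and>\<^sub>f ((nrec (V ?n) zero ?Z \<doteq> one) \<longleftrightarrow>\<^sub>f
      ex ?i ((V ?i <\<^sub>0 V ?n) \<and>\<^sub>f (?s \<doteq> V ?c)))" "eb(?a := a, ?c := c)" 5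
      "\<lambda>n. \<kappa> (f c n) \<le> 1 \<and> (f c n = Sc' Z0 \<longleftrightarrow> (\<exists>i\<in>N. \<kappa> i < \<kappa> n \<and> cd (sg a i) = c))"])
    show "\<kappa> (f c (Sc' n)) \<le> 1 \<and> (f c (Sc' n) = Sc' Z0 \<longleftrightarrow> (\<exists>i\<in>N. \<kappa> i < \<kappa> (Sc' n) \<and> cd (sg a i) = c))"
      if n: "n \<in> N" and IH: "\<kappa> (f c n) \<le> 1 \<and> (f c n = Sc' Z0 \<longleftrightarrow> (\<exists>i\<in>N. \<kappa> i < \<kappa> n \<and> cd (sg a i) = c))" for n
    proof (cases "cd (sg a n) = c")
      case True
      then show ?thesis using f_rec(2)[OF \<open>c \<in> N\<close> n] n by auto
    next
      case False
      have "\<kappa> i < \<kappa> n" if "i \<in> N" "\<kappa> i \<le> \<kappa> n" "cd (sg a i) = c" for i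
        using that n False \<kappa>_inj[of i n] by (auto simp: less_le)
      then have "(\<exists>i\<in>N. \<kappa> i < \<kappa> (Sc' n) \<and> cd (sg a i) = c) \<longleftrightarrow> (\<exists>i\<in>N. \<kappa> i < \<kappa> n \<and> cd (sg a i) = c)"
        using n less_imp_le by (simp, blast)
      moreover have "f c (Sc' n) = f c n" using f_rec(2)[OF \<open>c \<in> N\<close> n] False by simp
      ultimately show ?thesis using IH by simp
    qed
    show "\<kappa> (f c Z0) \<le> 1 \<and> (f c Z0 = Sc' Z0 \<longleftrightarrow> (\<exists>i\<in>N. \<kappa> i < \<kappa> Z0 \<and> cd (sg a i) = c))"
      using f_rec(1)[OF \<open>c \<in> N\<close> Z0_N] Sc'_neq[OF Z0_N] by auto
  qed (use that a in \<open>simp_all add: f_def\<close>)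
  have T: "T \<in> D T1" using a k by (simp add: T_def)
  have Tc: "ap T c = (if c = Z0 then Sc' Z0 else f c (Sc' k))" if "c \<in> N" for c
    using that a k f_rec(2)[OF that k] by (simp add: T_def f_def iz_if)
  have Tchar: "ap T c = Sc' Z0 \<longleftrightarrow> c = Z0 \<or> (\<exists>i\<in>N. \<kappa> i \<le> \<kappa> k \<and> cd (sg a i) = c)" if "c \<in> N" for c
    using Tc[OF that] f_char[OF that Sc'_N[OF k]] k by auto
  have Tseg: "s = nl Tn \<or> (\<exists>i\<in>N. \<kappa> i \<le> \<kappa> k \<and> sg a i = s)" if "s \<in> D (Tseq Tn)" "ap T (cd s) = Sc' Z0" for s
    using Tchar[of "cd s"] cd_inj[of s "nl Tn"] cd_inj[of _ s] that a by auto
  have "bin T" using Tc f_char k by (auto simp: bin_def)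
  moreover have "ap T (cd s) = Sc' Z0"
    if st: "s \<in> D (Tseq Tn)" "t \<in> D (Tseq Tn)" "ap T (cd (app Tn s t)) = Sc' Z0" for s t
    using st(1)
  proof (cases rule: seq_cases)
    case 1
    then show ?thesis using Tchar[of Z0] by simp
  next
    case (2 x v)
    \<comment> \<open>A nonempty prefix with m + 1 entries of a segment of a is the segment with
      last index m.\<close>
    let ?m = "ln Tn v"
    have m: "?m \<in> N" "ln Tn s = Sc' ?m" using 2 by simp_all
    have "\<kappa> (ln Tn (app Tn s t)) \<noteq> 0" using st m by (simp add: add_nonneg_eq_0_iff)
    then have "app Tn s t \<noteq> nl Tn" by auto
    then obtain i where i: "i \<in> N" "\<kappa> i \<le> \<kappa> k" "sg a i = app Tn s t" using Tseg[OF app_D[OF st(1,2)] st(3)] by blast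
    have "\<kappa> (ln Tn (app Tn s t)) = \<kappa> i + 1" using ln_sg[OF a(1) i(1)] i by simp
    then have mi: "\<kappa> ?m \<le> \<kappa> i" using st m \<kappa>_nonneg[OF ln_N[OF st(2)]] by (simp del: \<kappa>_nonneg)
    have "s = sg a ?m"
    proof (rule seq_ext[of _ Tn])
      fix j assume j: "j \<in> N" "\<kappa> j < \<kappa> (ln Tn s)"
      then have jm: "\<kappa> j \<le> \<kappa> ?m" using m by simp
      have "nt Tn s j = nt Tn (app Tn s t) j" using nt_app_left[OF st(1,2) j] by simp
      also have "\<dots> = nt Tn (sg a i) j" using i by simp
      also have "\<dots> = ap a j" by (rule nt_sg) (use a i j jm mi in auto)
      also have "\<dots> = nt Tn (sg a ?m) j" by (rule nt_sg[symmetric]) (use a m j jm in auto)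
      finally show "nt Tn s j = nt Tn (sg a ?m) j" .
    qed (use st a m in simp_all)
    then have "cd (sg a ?m) = cd s" by (rule arg_cong[of _ _ cd, OF sym])
    moreover have "\<kappa> ?m \<le> \<kappa> k" using mi i(2) by (rule order_trans)
    ultimately show ?thesis using Tchar[OF cd_N[OF st(1)]] m(1) by blast
  qed
  moreover have "\<kappa> m \<le> 1" if s: "s \<in> D (Tseq Tn)" "ap T (cd s) = Sc' Z0" "me Tn m s" for s m
  proof -
    from s obtain i where i: "i \<in> N" "sg a i = s" using Tseg[OF s(1,2)] by auto
    obtain j where j: "j \<in> N" "\<kappa> j < \<kappa> (ln Tn s)" "m = nt Tn s j" using s(3) by (auto simp: me_def)
    have "\<kappa> j \<le> \<kappa> i" using ln_sg[OF a(1) i(1)] i j by simp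
    then have "m = ap a j" using nt_sg[OF a(1) i(1) j(1)] i j by simp
    then show ?thesis using a j by (simp add: bin_def)
  qed
  ultimately have "btree T" unfolding btree_def by blast
  then show ?thesis using that[OF T] Tchar by blast
qed

text \<open>For truncated subtraction 1 - (1 - b(n)) is the minimum of 1 and b(n). A standard b that
  agrees with a binary sequence at standard places may exceed 1 elsewhere; this repairs it.\<close>

lemma truncate:
  assumes "b \<in> D T1" "st b"
  obtains c where "c \<in> D T1" "st c" "bin c" "\<And>n. n \<in> N \<Longrightarrow> \<kappa> (ap b n) \<le> 1 \<Longrightarrow> ap c n = ap b n"
proof -
  let ?t = "lam (0, Tn) (monus one (monus one (V (1, T1) \<cdot> v0)))"
  let ?c = "val (eb((1, T1) := b)) ?t"
  have ev: "ap ?c n = mo (Sc' Z0) (mo (Sc' Z0) (ap b n))" if "n \<in> N" for n using that assms by simp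
  show ?thesis
  proof (rule that[of ?c])
    show "bin ?c" using assms by (auto simp: bin_def ev max_def)
    show "ap ?c n = ap b n" if "n \<in> N" "\<kappa> (ap b n) \<le> 1" for n
      unfolding ev[OF that(1)] by (rule \<kappa>_inj) (use that assms in \<open>simp_all add: max_def\<close>)
    show "st ?c" by (rule st_val) (use assms in auto)
  qed (use assms in simp)
qed

text \<open>The sum turns the finite list of candidates produced by HAC-int into a single standard
  function that dominates them.\<close>

lemma bound_fun:
  assumes "F \<in> D (T1 \<rightarrow> Tseq Tn)" "st F"
  obtains g where "g \<in> D T2" "st g"
    "\<And>b n. b \<in> D T1 \<Longrightarrow> n \<in> N \<Longrightarrow> me Tn n (ap F b) \<Longrightarrow> \<kappa> n \<le> \<kappa> (ap g b)"
proof -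
  let ?F = "(1, T1 \<rightarrow> Tseq Tn)" and ?t = "lam (0, T1) (sum_tm \<cdot> (V (1, T1 \<rightarrow> Tseq Tn) \<cdot> V (0, T1)))"
  let ?g = "val (eb(?F := F)) ?t"
  have ev: "ap ?g b = sm (ap F b)" if "b \<in> D T1" for b using that assms by simp
  show ?thesis
  proof (rule that[of ?g])
    show "st ?g" by (rule st_val) (use assms in auto)
    show "\<kappa> n \<le> \<kappa> (ap ?g b)" if "b \<in> D T1" "n \<in> N" "me Tn n (ap F b)" for b n
      unfolding ev[OF that(1)] using that assms sm_bound ap_D by blast
  qed (use assms in simp)
qed

lemma stpT_imp_stp: assumes stpT shows stp
  unfolding stp_def
proof (intro ballI impI, rule ccontr)
  fix a assume a: "a \<in> D T1" "bin a"
  assume neg: "\<not> (\<exists>b\<in>D T1. st b \<and> bin b \<and> (\<forall>n\<in>N. st n \<longrightarrow> ap a n = ap b n))"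
  let ?b = "(0, T1)" and ?n = "(1, Tn)" and ?a = "(2, T1)"
  \<comment> \<open>This includes standard b that are not binary: HAC-int ranges over all of type 1,
    and the list w may contain such b. The truncation of a b that agreed with a would contradict
    \<open>neg\<close>.\<close>
  have diff: "\<exists>n\<in>N. st n \<and> ap a n \<noteq> ap b n" if b: "b \<in> D T1" "st b" for b
  proof (rule ccontr)
    assume n: "\<not> ?thesis"
    obtain c where c: "c \<in> D T1" "st c" "bin c" "\<And>n. n \<in> N \<Longrightarrow> \<kappa> (ap b n) \<le> 1 \<Longrightarrow> ap c n = ap b n"
      using truncate[OF b] by blast
    have "ap a n = ap c n" if "n \<in> N" "st n" for n
    proof -
      have "ap a n = ap b n" using n that by blast
      moreover have "\<kappa> (ap a n) \<le> 1" using a that by (simp add: bin_def)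
      ultimately show ?thesis using c(4)[OF that(1)] by simp
    qed
    then show False using neg c by blast
  qed
  let ?\<phi> = "\<not>\<^sub>f (V ?a \<cdot> V ?n \<doteq> V ?b \<cdot> V ?n)" and ?e = "eb(?a := a)"
  have ex: "sat (?e(?b := b, ?n := n)) ?\<phi> \<longleftrightarrow> ap a n \<noteq> ap b n" for b n by simp
  obtain F where F: "F \<in> D (T1 \<rightarrow> Tseq Tn)" "st F"
    "\<And>b. b \<in> D T1 \<Longrightarrow> st b \<Longrightarrow> \<exists>n\<in>N. me Tn n (ap F b) \<and> ap a n \<noteq> ap b n"
  proof (rule hac[of ?\<phi> ?b ?n ?e])
    show "\<exists>n\<in>D (snd ?n). st n \<and> sat (?e(?b := b, ?n := n)) ?\<phi>" if "b \<in> D (snd ?b)" "st b" for b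
      using diff[of b] that by auto
    fix F assume "F \<in> D (snd ?b \<rightarrow> Tseq (snd ?n))" "st F" "\<And>b. b \<in> D (snd ?b) \<Longrightarrow> st b \<Longrightarrow>
      \<exists>n\<in>D (snd ?n). me (snd ?n) n (ap F b) \<and> sat (?e(?b := b, ?n := n)) ?\<phi>"
    then show thesis using that[of F] by simp
  qed (use a in simp_all)
  obtain g where g: "g \<in> D T2" "st g"
    "\<And>b n. b \<in> D T1 \<Longrightarrow> n \<in> N \<Longrightarrow> me Tn n (ap F b) \<Longrightarrow> \<kappa> n \<le> \<kappa> (ap g b)"
    using bound_fun[OF F(1,2)] by blast
  obtain w k where w: "w \<in> D (Tseq T1)" "st w" "k \<in> N" and bar: "\<forall>T\<in>D T1. btree T \<longrightarrow>
    (\<forall>a\<in>D T1. me T1 a w \<longrightarrow> ap T (cd (sg a (ap g a))) \<noteq> Sc' Z0) \<longrightarrow>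
    (\<forall>b\<in>D T1. bin b \<longrightarrow> (\<exists>i\<in>N. \<kappa> i \<le> \<kappa> k \<and> ap T (cd (sg b i)) \<noteq> Sc' Z0))"
    using bspec[OF assms[unfolded stpT_def] g(1), THEN mp, OF g(2)]
    by (elim bexE conjE) (rule that; assumption)
  \<comment> \<open>The sequence a itself stays in this T up to height k, so the conclusion of the
    tree principle fails once its premise is verified.\<close>
  obtain T where T: "T \<in> D T1" "btree T"
    "\<And>c. c \<in> N \<Longrightarrow> ap T c = Sc' Z0 \<longleftrightarrow> c = Z0 \<or> (\<exists>i\<in>N. \<kappa> i \<le> \<kappa> k \<and> cd (sg a i) = c)"
    using seg_tree[OF a w(3)] by blast
  have "ap T (cd (sg b (ap g b))) \<noteq> Sc' Z0" if b: "b \<in> D T1" "me T1 b w" for b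
  proof
    let ?s = "sg b (ap g b)"
    have s: "ap g b \<in> N" "?s \<in> D (Tseq Tn)" using b g by simp_all
    have "st b" using st_me b w by blast
    then obtain n where n: "n \<in> N" "me Tn n (ap F b)" "ap a n \<noteq> ap b n" using F(3) b by blast
    assume "ap T (cd ?s) = Sc' Z0"
    then have "cd ?s = Z0 \<or> (\<exists>i\<in>N. cd (sg a i) = cd ?s)" using T(3)[of "cd ?s"] s by auto
    then show False
    proof
      assume "cd ?s = Z0"
      then have "?s = nl Tn" using cd_inj[of ?s "nl Tn"] s by simp
      then show False using ln_sg[OF b(1) s(1)] Sc'_neq[OF s(1)] by simp
    next
      assume "\<exists>i\<in>N. cd (sg a i) = cd ?s"
      then obtain i where "i \<in> N" "sg a i = ?s" using cd_inj[of _ ?s] s a by auto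
      then show False using sg_eq[of a b i "ap g b"] a b s n g(3)[OF b(1) n(1,2)] by auto
    qed
  qed
  then obtain i where "i \<in> N" "\<kappa> i \<le> \<kappa> k" "ap T (cd (sg a i)) \<noteq> Sc' Z0"
    using bar[rule_format, OF T(1,2)] a by blast
  then show False using T(3)[of "cd (sg a i)"] a by auto
qed

end

context P_num
begin

lemma pw_neq_Z0 [simp]: "a \<in> N \<Longrightarrow> pw a \<noteq> Z0" using pw_nz[of a] by force

section \<open>Reals given by digits\<close>

lemma rl_dist:
  assumes "rl x" "n \<in> N" "m \<in> N"
  shows "\<bar>R x n - R x m\<bar> < e2 n + e2 m"
proof -
  have key: "\<bar>R x n - R x m\<bar> < e2 n" if "n \<in> N" "m \<in> N" "\<kappa> n \<le> \<kappa> m" for n m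
  proof -
    from that obtain i where i: "i \<in> N" "\<kappa> m = \<kappa> n + \<kappa> i" by (rule \<kappa>_diff)
    have "m = pl n i" by (rule \<kappa>_inj) (use that i in simp_all)
    then show ?thesis using assms(1) that(1) i(1) by (simp add: rl_def)
  qed
  have p: "0 < e2 n" "0 < e2 m" using assms by simp_all
  show ?thesis
  proof (cases "\<kappa> n \<le> \<kappa> m")
    case True
    then show ?thesis using key[of n m] assms p by linarith
  next
    case False
    then have "\<bar>R x m - R x n\<bar> < e2 m" using key[of m n] assms by simp
    then show ?thesis using p abs_minus_commute[of "R x n" "R x m"] by linarith
  qed
qed

text \<open>Here s(n) is the number with base B digits b(0), ..., b(n - 1), leading digit first, so
  that s(n) / B^n are the partial sums of the expansion.\<close>

definition digits :: "'k \<Rightarrow> 'a \<Rightarrow> 'a \<Rightarrow> bool" where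
  "digits B b s \<longleftrightarrow> s \<in> D T1 \<and> ap s Z0 = Z0 \<and> (\<forall>n\<in>N. \<kappa> (ap s (Sc' n)) = B * \<kappa> (ap s n) + \<kappa> (ap b n))"

definition powers :: "'k \<Rightarrow> 'a \<Rightarrow> bool" where
  "powers B P \<longleftrightarrow> P \<in> D T1 \<and> \<kappa> (ap P Z0) = 1 \<and> (\<forall>n\<in>N. \<kappa> (ap P (Sc' n)) = B * \<kappa> (ap P n))"

lemma digits_ex:
  assumes "b \<in> D T1" "B \<in> N"
  obtains s where "digits (\<kappa> B) b s" "st b \<Longrightarrow> st B \<Longrightarrow> st s"
proof -
  let ?b = "(0, T1)" and ?B = "(1, Tn)" and ?n = "(2, Tn)" and ?r = "(3, Tn)" and ?i = "(4, Tn)"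
  let ?t = "lam ?n (nrec (V ?n) zero (lam ?r (lam ?i (plus (times (V ?B) (V ?r)) (V ?b \<cdot> V ?i)))))"
  let ?s = "val (eb(?b := b, ?B := B)) ?t"
  show ?thesis
  proof (rule that[of ?s])
    show "digits (\<kappa> B) b ?s" using assms by (simp add: digits_def)
    show "st ?s" if "st b" "st B" by (rule st_val) (use that assms in auto)
  qed
qed

lemma powers_pow2: "powers 2 (cv pow2_tm)"
  using pw_rec by (simp add: powers_def pw_def[symmetric] cv_D)

lemma powers_pos:
  assumes "powers B P" "1 \<le> B" "n \<in> N" shows "1 \<le> \<kappa> (ap P n)"
proof -
  have P: "P \<in> D T1" "\<kappa> (ap P Z0) = 1" "\<And>n. n \<in> N \<Longrightarrow> \<kappa> (ap P (Sc' n)) = B * \<kappa> (ap P n)"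
    using assms(1) by (auto simp: powers_def)
  show ?thesis
  proof (rule indP[of "one \<le>\<^sub>0 V (1, T1) \<cdot> v0" "eb((1, T1) := P)" 0 "\<lambda>n. 1 \<le> \<kappa> (ap P n)"])
    show "1 \<le> \<kappa> (ap P (Sc' n))" if "n \<in> N" "1 \<le> \<kappa> (ap P n)" for n
      unfolding P(3)[OF that(1)] using mult_mono[OF assms(2) that(2)] assms(2) by simp
  qed (use P assms in simp_all)
qed

lemma powers_add:
  assumes "powers B P" "n \<in> N" "i \<in> N" shows "\<kappa> (ap P (pl n i)) = \<kappa> (ap P n) * \<kappa> (ap P i)"
proof -
  have P: "P \<in> D T1" "\<kappa> (ap P Z0) = 1" "\<And>n. n \<in> N \<Longrightarrow> \<kappa> (ap P (Sc' n)) = B * \<kappa> (ap P n)"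
    using assms(1) by (auto simp: powers_def)
  show ?thesis
  proof (rule indP[of "V (1, T1) \<cdot> plus v2 v0 \<doteq> times (V (1, T1) \<cdot> v2) (V (1, T1) \<cdot> v0)"
        "eb((1, T1) := P, (2, Tn) := n)" 0 "\<lambda>i. \<kappa> (ap P (pl n i)) = \<kappa> (ap P n) * \<kappa> (ap P i)"])
    show "sat (eb((1, T1) := P, (2, Tn) := n, (0, Tn) := d)) (V (1, T1) \<cdot> plus v2 v0 \<doteq> times (V (1, T1) \<cdot> v2) (V (1, T1) \<cdot> v0))
      \<longleftrightarrow> \<kappa> (ap P (pl n d)) = \<kappa> (ap P n) * \<kappa> (ap P d)" if "d \<in> N" for d
      using that P(1) assms \<kappa>_eq[of "ap P (pl n d)" "ti (ap P n) (ap P d)"] by simp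
  qed (use P assms in \<open>simp_all add: pl_rec\<close>)
qed

text \<open>With digits at most 1 the partial sum \<open>s n / B ^ n\<close> increases by at most \<open>1 / ((B - 1) * B ^ n)\<close>.\<close>

lemma digits_bounds:
  assumes s: "digits B b s" and P: "powers B P" and B: "2 \<le> B" "B = \<kappa> B'" "B' \<in> N"
    and b: "b \<in> D T1" "bin b" and n: "n \<in> N" "i \<in> N"
  shows "\<kappa> (ap s n) / \<kappa> (ap P n) \<le> \<kappa> (ap s (pl n i)) / \<kappa> (ap P (pl n i))"
    and "\<kappa> (ap s (pl n i)) / \<kappa> (ap P (pl n i)) < (\<kappa> (ap s n) + 1 / (B - 1)) / \<kappa> (ap P n)"
proof -
  have s': "s \<in> D T1" "ap s Z0 = Z0" "\<And>n. n \<in> N \<Longrightarrow> \<kappa> (ap s (Sc' n)) = B * \<kappa> (ap s n) + \<kappa> (ap b n)"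
    using s by (auto simp: digits_def)
  have P': "P \<in> D T1" "\<kappa> (ap P Z0) = 1" "\<And>n. n \<in> N \<Longrightarrow> \<kappa> (ap P (Sc' n)) = B * \<kappa> (ap P n)"
    using P by (auto simp: powers_def)
  have pos: "1 \<le> \<kappa> (ap P n)" "1 \<le> \<kappa> (ap P i)" using powers_pos[OF P] B n by auto
  obtain C where C: "C \<in> N" "\<kappa> B' = 1 + \<kappa> C" using \<kappa>_diff[of "Sc' Z0" B'] B by auto
  have BC: "B = 1 + \<kappa> C" using C B by simp
  \<comment> \<open>With C = B - 1 the bounds become statements about numbers. The summand 1 makes
    the upper bound strict and carries the step: a digit at most 1 adds at most C to C * B * s, and
    C + 1 = B.\<close>
  have bnd: "\<kappa> (ap s n) * \<kappa> (ap P i) \<le> \<kappa> (ap s (pl n i)) \<and>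
      \<kappa> C * \<kappa> (ap s (pl n i)) + 1 \<le> (\<kappa> C * \<kappa> (ap s n) + 1) * \<kappa> (ap P i)"
  proof (rule indP[of "(times (V (1, T1) \<cdot> v2) (V (3, T1) \<cdot> v0) \<le>\<^sub>0 V (1, T1) \<cdot> plus v2 v0) \<and>\<^sub>f
      (suc (times (V (4, Tn)) (V (1, T1) \<cdot> plus v2 v0)) \<le>\<^sub>0
        times (suc (times (V (4, Tn)) (V (1, T1) \<cdot> v2))) (V (3, T1) \<cdot> v0))"
        "eb((1, T1) := s, (2, Tn) := n, (3, T1) := P, (4, Tn) := C)" 0
        "\<lambda>i. \<kappa> (ap s n) * \<kappa> (ap P i) \<le> \<kappa> (ap s (pl n i)) \<and>
      \<kappa> C * \<kappa> (ap s (pl n i)) + 1 \<le> (\<kappa> C * \<kappa> (ap s n) + 1) * \<kappa> (ap P i)"])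
    fix d assume d: "d \<in> N" and IH: "\<kappa> (ap s n) * \<kappa> (ap P d) \<le> \<kappa> (ap s (pl n d)) \<and>
      \<kappa> C * \<kappa> (ap s (pl n d)) + 1 \<le> (\<kappa> C * \<kappa> (ap s n) + 1) * \<kappa> (ap P d)"
    have e: "\<kappa> (ap s (pl n (Sc' d))) = B * \<kappa> (ap s (pl n d)) + \<kappa> (ap b (pl n d))"
      "\<kappa> (ap P (Sc' d)) = B * \<kappa> (ap P d)"
      using s'(3)[of "pl n d"] P'(3) d n by (simp_all add: pl_rec)
    have bd: "0 \<le> \<kappa> (ap b (pl n d))" "\<kappa> (ap b (pl n d)) \<le> 1" using b n d by (simp_all add: bin_def)
    have m1: "B * (\<kappa> (ap s n) * \<kappa> (ap P d)) \<le> B * \<kappa> (ap s (pl n d))"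
      using IH B(1) by (intro mult_left_mono) auto
    have m2: "B * (\<kappa> C * \<kappa> (ap s (pl n d)) + 1) \<le> B * ((\<kappa> C * \<kappa> (ap s n) + 1) * \<kappa> (ap P d))"
      using IH B(1) by (intro mult_left_mono) auto
    have m3: "\<kappa> C * \<kappa> (ap b (pl n d)) \<le> \<kappa> C * 1" using bd C by (intro mult_left_mono) auto
    have "\<kappa> C * (B * \<kappa> (ap s (pl n d)) + \<kappa> (ap b (pl n d))) + 1
        \<le> B * (\<kappa> C * \<kappa> (ap s (pl n d)) + 1)"
      using m3 unfolding BC by (simp add: algebra_simps)
    then show "\<kappa> (ap s n) * \<kappa> (ap P (Sc' d)) \<le> \<kappa> (ap s (pl n (Sc' d))) \<and>
      \<kappa> C * \<kappa> (ap s (pl n (Sc' d))) + 1 \<le> (\<kappa> C * \<kappa> (ap s n) + 1) * \<kappa> (ap P (Sc' d))"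
      unfolding e using m1 m2 bd by (simp add: mult.left_commute)
  qed (use s' P' C n in \<open>simp_all add: pl_rec\<close>)
  have a: "\<kappa> (ap P (pl n i)) = \<kappa> (ap P n) * \<kappa> (ap P i)" by (rule powers_add[OF P n])
  have p: "0 < \<kappa> (ap P n)" "0 < \<kappa> (ap P i)" using pos by linarith+
  show "\<kappa> (ap s n) / \<kappa> (ap P n) \<le> \<kappa> (ap s (pl n i)) / \<kappa> (ap P (pl n i))"
    using bnd p unfolding a by (simp add: divide_simps mult.commute mult.left_commute)
  have c: "1 \<le> \<kappa> C" using BC B by linarith
  have "\<kappa> C * \<kappa> (ap s (pl n i)) < (\<kappa> C * \<kappa> (ap s n) + 1) * \<kappa> (ap P i)" using bnd by linarith
  then have "\<kappa> (ap s (pl n i)) < (\<kappa> (ap s n) + 1 / \<kappa> C) * \<kappa> (ap P i)"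
    using c by (simp add: field_simps)
  then show "\<kappa> (ap s (pl n i)) / \<kappa> (ap P (pl n i)) < (\<kappa> (ap s n) + 1 / (B - 1)) / \<kappa> (ap P n)"
    using p unfolding a BC by (simp add: divide_simps mult.commute mult.left_commute)
qed

text \<open>The shift j secures the rate of convergence: from index n + j on, the partial sums vary
  by less than 1 / B^(n + j), which \<open>sh\<close> bounds by 2^(-n).\<close>

lemma digits_real:
  assumes s: "digits B b s" and P: "powers B P" and B: "2 \<le> B" "B = \<kappa> B'" "B' \<in> N"
    and b: "b \<in> D T1" "bin b" and sh: "\<And>n. n \<in> N \<Longrightarrow> 1 \<le> e2 n * \<kappa> (ap P (pl n j))" and j: "j \<in> N"
  obtains x where "x \<in> D T1" "\<And>n. n \<in> N \<Longrightarrow> R x n = \<kappa> (ap s (pl n j)) / \<kappa> (ap P (pl n j))" "ui x"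
    "st s \<Longrightarrow> st P \<Longrightarrow> st j \<Longrightarrow> st x"
proof -
  let ?t = "lam (0, Tn) (quot (V (1, T1) \<cdot> plus v0 (V (2, Tn))) zero (V (3, T1) \<cdot> plus v0 (V (2, Tn))))"
  define x where "x = val (eb((1, T1) := s, (2, Tn) := j, (3, T1) := P)) ?t"
  have D: "s \<in> D T1" "P \<in> D T1" "ap s Z0 = Z0" "\<kappa> (ap P Z0) = 1" using s P by (auto simp: digits_def powers_def)
  have pos: "1 \<le> \<kappa> (ap P n)" "0 < \<kappa> (ap P n)" if "n \<in> N" for n using powers_pos[OF P _ that] B by auto
  have x: "x \<in> D T1" using D j by (simp add: x_def)
  have Rx: "R x n = \<kappa> (ap s (pl n j)) / \<kappa> (ap P (pl n j))" if "n \<in> N" for n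
    using that D j pos(2)[of "pl n j"] by (simp add: R_def x_def)
  have B1: "1 / (B - 1) \<le> 1" using B by (simp add: divide_simps)
  have rl: "rl x" unfolding rl_def
  proof (intro ballI)
    fix n i assume n: "n \<in> N" "i \<in> N"
    let ?n = "pl n j"
    have e: "pl (pl n i) j = pl ?n i" using n j by (simp add: pl_ac)
    note bd = digits_bounds[OF s P B b pl_N[OF n(1) j] n(2)]
    have "\<kappa> (ap s (pl ?n i)) / \<kappa> (ap P (pl ?n i)) < (\<kappa> (ap s ?n) + 1) / \<kappa> (ap P ?n)"
      using bd(2) B1 pos(2)[OF pl_N[OF n(1) j]]
      by (elim less_le_trans) (simp add: divide_right_mono)
    moreover have "1 / \<kappa> (ap P ?n) \<le> e2 n"
      using sh[OF n(1)] pos(2)[OF pl_N[OF n(1) j]] by (simp add: pos_divide_le_eq)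
    ultimately show "\<bar>R x n - R x (pl n i)\<bar> < e2 n"
      using bd(1) n j by (simp add: Rx e add_divide_distrib abs_if)
  qed
  have ui: "ui x" unfolding ui_def
  proof (intro conjI ballI rl)
    fix n assume n: "n \<in> N"
    \<comment> \<open>Each partial sum is compared with the empty one, which is 0; this bounds it by
      1 / (B - 1) \<le> 1.\<close>
    have "pl Z0 (pl n j) = pl n j" using n j by (simp add: pl_Z0_left)
    then have "0 \<le> R x n" "R x n < 1 / (B - 1)"
      using digits_bounds[OF s P B b Z0_N pl_N[OF n j]] D n by (simp_all add: Rx)
    moreover have "0 < e2 n" using n by simp
    ultimately show "- 2 * e2 n \<le> R x n" "R x n \<le> 1 + 2 * e2 n" using B1 by linarith+
  qed
  show ?thesis
    by (rule that[of x, OF x Rx ui]) (auto intro!: st_val simp: D j x_def)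
qed

lemma two_N: "\<kappa> (Sc' (Sc' Z0)) = 2" by simp

section \<open>The standard part of a real in the unit interval\<close>

text \<open>The approximation x(M) may leave the unit interval by 2 * 2^(-M). In that case it is
  replaced by 0 or 1, at no greater cost.\<close>

lemma rational_near:
  assumes "ui x" "x \<in> D T1" "M \<in> N"
  obtains p d where "p \<in> N" "d \<in> N" "1 \<le> \<kappa> d" "\<kappa> p \<le> \<kappa> d" "\<bar>R x M - \<kappa> p / \<kappa> d\<bar> \<le> 2 * e2 M"
proof -
  let ?q = "ap x M" let ?u = "pf (pf ?q)" and ?v = "ps (pf ?q)" and ?d = "Sc' (ps ?q)"
  have N: "?q \<in> N" "?u \<in> N" "?v \<in> N" "?d \<in> N" using assms by simp_all
  have R: "R x M = (\<kappa> ?u - \<kappa> ?v) / \<kappa> ?d" using N by (simp add: R_def qv_def)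
  have d: "1 \<le> \<kappa> ?d" "0 < \<kappa> ?d" using N assms by simp_all
  have b: "- 2 * e2 M \<le> R x M" "R x M \<le> 1 + 2 * e2 M" "0 < e2 M" using assms by (auto simp: ui_def)
  consider "\<kappa> ?u \<le> \<kappa> ?v" | "\<kappa> ?d \<le> \<kappa> ?u - \<kappa> ?v" | "\<kappa> ?v < \<kappa> ?u" "\<kappa> ?u - \<kappa> ?v < \<kappa> ?d" by linarith
  then show ?thesis
  proof cases
    case 1
    then have "R x M \<le> 0" using d unfolding R by (simp add: divide_nonpos_pos)
    then show ?thesis using that[of Z0 "Sc' Z0"] b by simp
  next
    case 2
    then have "1 \<le> R x M" using d(2) unfolding R by (simp add: pos_le_divide_eq)
    then show ?thesis using that[of "Sc' Z0" "Sc' Z0"] b by simp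
  next
    case 3
    then have "\<kappa> (mo ?u ?v) = \<kappa> ?u - \<kappa> ?v" using N by simp
    then show ?thesis using that[of "mo ?u ?v" ?d] N d 3 b R by simp
  qed
qed

text \<open>For p < d the number c(n) is the integer part of 2^n * p / d. The invariant c(n) * d
  \<le> 2^n * p \<le> (c(n) + 1) * d is weak on the right in order to admit p = d, whose digits are
  all 1.\<close>

lemma binary_expansion:
  assumes p: "p \<in> N" and d: "d \<in> N" "1 \<le> \<kappa> d" and pd: "\<kappa> p \<le> \<kappa> d"
  obtains a c where "a \<in> D T1" "bin a" "digits 2 a c"
    "\<And>n. n \<in> N \<Longrightarrow> \<bar>\<kappa> (ap c n) / \<kappa> (pw n) - \<kappa> p / \<kappa> d\<bar> \<le> e2 n"
proof -
  let ?p = "(0, Tn)" and ?d = "(1, Tn)" and ?n = "(2, Tn)" and ?r = "(3, Tn)" and ?i = "(4, Tn)" and ?c = "(5, T1)"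
  \<comment> \<open>For truncated subtraction 1 - (u - v) is 1 if u \<le> v and 0 otherwise. The
    next digit is 1 iff (2 * r + 1) * d \<le> 2^(i+1) * p, that is, iff doubling r and adding 1 does
    not overshoot.\<close>
  let ?dig = "\<lambda>r i. monus one (monus (times (suc (plus r r)) (V ?d)) (times (pow2 (suc i)) (V ?p)))"
  let ?tc = "lam ?n (nrec (V ?n) zero (lam ?r (lam ?i (plus (plus (V ?r) (V ?r)) (?dig (V ?r) (V ?i))))))"
  let ?e = "eb(?p := p, ?d := d)"
  define c where "c = val ?e ?tc"
  have c: "c \<in> D T1" using p d by (simp add: c_def)
  let ?ta = "lam ?i (?dig (V ?c \<cdot> V ?i) (V ?i))"
  define a where "a = val (?e(?c := c)) ?ta"
  have a: "a \<in> D T1" using p d c by (simp add: a_def)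
  have a_eq: "\<kappa> (ap a n) = max 0 (1 - max 0 ((\<kappa> (ap c n) + \<kappa> (ap c n) + 1) * \<kappa> d - 2 * \<kappa> (pw n) * \<kappa> p))"
    if "n \<in> N" for n using that p d c by (simp add: a_def)
  have c0: "ap c Z0 = Z0" using p d by (simp add: c_def)
  have cS: "\<kappa> (ap c (Sc' n)) = 2 * \<kappa> (ap c n) + \<kappa> (ap a n)" if n: "n \<in> N" for n
  proof -
    define r where "r = rec' Tn n Z0 (val ?e (lam ?r (lam ?i (plus (plus (V ?r) (V ?r)) (?dig (V ?r) (V ?i))))))"
    have r: "r \<in> N" "ap c n = r" using n p d by (simp_all add: c_def r_def)
    have "ap c (Sc' n) = pl (pl r r) (mo (Sc' Z0) (mo (ti (Sc' (pl r r)) d) (ti (pw (Sc' n)) p)))"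
      using n p d r(1) by (simp add: c_def r_def)
    then show ?thesis using a_eq[OF n] r n p d by simp
  qed
  have bin: "bin a" using a_eq by (simp add: bin_def)
  have dg: "digits 2 a c" using c c0 cS by (simp add: digits_def)
  have step: "\<kappa> (ap c (Sc' n)) * \<kappa> d \<le> 2 * \<kappa> (pw n) * \<kappa> p \<and> 2 * \<kappa> (pw n) * \<kappa> p \<le> (\<kappa> (ap c (Sc' n)) + 1) * \<kappa> d"
    if n: "n \<in> N" and IH: "\<kappa> (ap c n) * \<kappa> d \<le> \<kappa> (pw n) * \<kappa> p \<and> \<kappa> (pw n) * \<kappa> p \<le> (\<kappa> (ap c n) + 1) * \<kappa> d" for n
  proof -
    let ?A = "(\<kappa> (ap c n) + \<kappa> (ap c n) + 1) * \<kappa> d" and ?B = "2 * \<kappa> (pw n) * \<kappa> p"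
    show ?thesis
    proof (cases "?A \<le> ?B")
      case True
      then have "\<kappa> (ap a n) = 1" using a_eq[OF n] by simp
      then show ?thesis using True IH by (simp add: cS[OF n] algebra_simps)
    next
      case False
      let ?x = "ti (Sc' (pl (ap c n) (ap c n))) d" and ?y = "ti (pw (Sc' n)) p"
      have "?x \<in> N" "?y \<in> N" "\<kappa> ?y < \<kappa> ?x" using False n p d c by simp_all
      \<comment> \<open>By discreteness the difference is at least 1, so the outer truncated
        subtraction gives 0.\<close>
      then have "\<kappa> ?y + 1 \<le> \<kappa> ?x" using \<kappa>_less by blast
      then have "?B + 1 \<le> ?A" using n p d c by simp
      then have "\<kappa> (ap a n) = 0" using a_eq[OF n] by simp
      then show ?thesis using False IH by (simp add: cS[OF n] algebra_simps)
    qed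
  qed
  have inv: "\<kappa> (ap c n) * \<kappa> d \<le> \<kappa> (pw n) * \<kappa> p \<and> \<kappa> (pw n) * \<kappa> p \<le> (\<kappa> (ap c n) + 1) * \<kappa> d" if n: "n \<in> N" for n
  proof (rule indP[of "(times (V ?c \<cdot> V ?n) (V ?d) \<le>\<^sub>0 times (pow2 (V ?n)) (V ?p)) \<and>\<^sub>f
      (times (pow2 (V ?n)) (V ?p) \<le>\<^sub>0 times (suc (V ?c \<cdot> V ?n)) (V ?d))" "?e(?c := c)" 2
      "\<lambda>n. \<kappa> (ap c n) * \<kappa> d \<le> \<kappa> (pw n) * \<kappa> p \<and> \<kappa> (pw n) * \<kappa> p \<le> (\<kappa> (ap c n) + 1) * \<kappa> d"])
    show "\<kappa> (ap c (Sc' n)) * \<kappa> d \<le> \<kappa> (pw (Sc' n)) * \<kappa> p \<and> \<kappa> (pw (Sc' n)) * \<kappa> p \<le> (\<kappa> (ap c (Sc' n)) + 1) * \<kappa> d"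
      if "n \<in> N" "\<kappa> (ap c n) * \<kappa> d \<le> \<kappa> (pw n) * \<kappa> p \<and> \<kappa> (pw n) * \<kappa> p \<le> (\<kappa> (ap c n) + 1) * \<kappa> d" for n
      using step[OF that] that(1) by simp
  qed (use n p d c c0 pd in simp_all)
  have "\<bar>\<kappa> (ap c n) / \<kappa> (pw n) - \<kappa> p / \<kappa> d\<bar> \<le> e2 n" if n: "n \<in> N" for n
  proof -
    have pos: "0 < \<kappa> (pw n)" "0 < \<kappa> d" using n d by auto
    have "\<kappa> (ap c n) / \<kappa> (pw n) \<le> \<kappa> p / \<kappa> d" "\<kappa> p / \<kappa> d \<le> (\<kappa> (ap c n) + 1) / \<kappa> (pw n)"
      using inv[OF n] pos by (simp_all add: divide_simps mult.commute)
    then show ?thesis by (simp add: e2_def add_divide_distrib abs_le_iff)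
  qed
  then show ?thesis using that[OF a bin dg] by blast
qed

text \<open>The digits are known to agree at standard places only, so the induction has to be
  external.\<close>

lemma digits_agree:
  assumes s: "digits B a s" and t: "digits B b t" and ab: "\<And>n. n \<in> N \<Longrightarrow> st n \<Longrightarrow> ap a n = ap b n"
    and n: "n \<in> N" "st n"
  shows "ap s n = ap t n"
proof (rule ext_indP[of "V (1, T1) \<cdot> v0 \<doteq> V (2, T1) \<cdot> v0" "eb((1, T1) := s, (2, T1) := t)" 0 "\<lambda>n. ap s n = ap t n"])
  have D: "s \<in> D T1" "t \<in> D T1" "ap s Z0 = ap t Z0" using s t by (auto simp: digits_def)
  then show "good (eb((1, T1) := s, (2, T1) := t))" "ap s Z0 = ap t Z0" by simp_all
  show "ap s (Sc' d) = ap t (Sc' d)" if "d \<in> N" "st d" "ap s d = ap t d" for d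
  proof (rule \<kappa>_inj)
    show "\<kappa> (ap s (Sc' d)) = \<kappa> (ap t (Sc' d))" using s t that ab[OF that(1,2)] by (simp add: digits_def)
  qed (use that D in simp_all)
qed (use n in simp_all)

lemma stp_imp_stpR: assumes stp shows stpR
  unfolding stpR_def
proof (intro ballI impI)
  fix x assume x: "x \<in> D T1" "ui x"
  \<comment> \<open>At an index M above all standard numbers, x(M) is within 2^(-n) of x(n) for
    every standard n, so a single rational near x(M) approximates x at all standard places.\<close>
  obtain M where M: "M \<in> N" "\<And>n. n \<in> N \<Longrightarrow> st n \<Longrightarrow> \<kappa> n \<le> \<kappa> M" using infinite_number by blast
  obtain p d where pd: "p \<in> N" "d \<in> N" "1 \<le> \<kappa> d" "\<kappa> p \<le> \<kappa> d" "\<bar>R x M - \<kappa> p / \<kappa> d\<bar> \<le> 2 * e2 M"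
    using rational_near[OF x(2,1) M(1)] by blast
  obtain a c where a: "a \<in> D T1" "bin a" "digits 2 a c"
    and ac: "\<And>n. n \<in> N \<Longrightarrow> \<bar>\<kappa> (ap c n) / \<kappa> (pw n) - \<kappa> p / \<kappa> d\<bar> \<le> e2 n"
    using binary_expansion[OF pd(1-4)] by blast
  obtain b where b: "b \<in> D T1" "st b" "bin b" "\<And>n. n \<in> N \<Longrightarrow> st n \<Longrightarrow> ap a n = ap b n"
    using assms a unfolding stp_def by blast
  \<comment> \<open>The shift by 2 makes the errors fit into 2 * 2^(-n): in units of 2^(-n), passing
    from x(n) to x(M) costs 1, from there to p / d at most 1/2, and the expansion at place n + 2 at
    most 1/4.\<close>
  let ?two = "Sc' (Sc' Z0)"
  obtain s where s: "digits 2 b s" "st s"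
    using digits_ex[OF b(1), of ?two] b(2) two_N by auto
  have sh: "1 \<le> e2 n * \<kappa> (ap (cv pow2_tm) (pl n ?two))" if "n \<in> N" for n
    using that by (simp add: pw_def[symmetric] e2_def pl_rec)
  obtain y where y: "y \<in> D T1" "ui y" "st y"
    and Ry: "\<And>n. n \<in> N \<Longrightarrow> R y n = \<kappa> (ap s (pl n ?two)) / \<kappa> (ap (cv pow2_tm) (pl n ?two))"
  proof (rule digits_real[OF s(1) powers_pow2 _ two_N[symmetric] _ b(1,3) sh])
    fix y assume y: "y \<in> D T1" "\<And>n. n \<in> N \<Longrightarrow> R y n = \<kappa> (ap s (pl n ?two)) / \<kappa> (ap (cv pow2_tm) (pl n ?two))"
      "ui y" "st s \<Longrightarrow> st (cv pow2_tm) \<Longrightarrow> st ?two \<Longrightarrow> st y"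
    have "st y" using y(4) s(2) st_cv[of pow2_tm] by simp
    then show thesis by (rule that[OF y(1,3) _ y(2)])
  qed simp_all
  have "\<bar>R x n - R y n\<bar> \<le> 2 * e2 n" if n: "n \<in> N" "st n" for n
  proof -
    let ?m = "pl n ?two"
    have m: "?m \<in> N" "st ?m" using n by simp_all
    have "R y n = \<kappa> (ap c ?m) / \<kappa> (pw ?m)"
      using digits_agree[OF a(3) s(1) b(4) m] Ry[OF n(1)] by (simp add: pw_def)
    then have 1: "\<bar>R y n - \<kappa> p / \<kappa> d\<bar> \<le> e2 ?m" using ac[OF m(1)] by simp
    have em: "e2 ?m = e2 n / 4" using n by (simp add: pl_rec)
    have "e2 M \<le> e2 ?m" using m M by (intro e2_mono) auto
    then have 2: "2 * e2 M \<le> e2 n / 2" using em by linarith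
    have le: "\<kappa> n \<le> \<kappa> M" using M(2)[OF n] .
    obtain i where i: "i \<in> N" "\<kappa> M = \<kappa> n + \<kappa> i" using \<kappa>_diff[OF n(1) M(1) le] by blast
    have "M = pl n i" by (rule \<kappa>_inj) (use i n M in simp_all)
    then have 3: "\<bar>R x n - R x M\<bar> < e2 n" using x n i by (simp add: ui_def rl_def)
    have "0 < e2 n" using n by simp
    then show ?thesis using 1 2 3 em pd(5) unfolding abs_le_iff abs_less_iff by linarith
  qed
  then show "\<exists>y\<in>D T1. st y \<and> ui y \<and> (\<forall>n\<in>N. st n \<longrightarrow> \<bar>R x n - R y n\<bar> \<le> 2 * e2 n)" using y by blast
qed

end

section \<open>Decoding base 4 digits: from standard parts of reals to those of binary
  sequences\<close>

definition qle_tm :: "tm \<Rightarrow> tm \<Rightarrow> tm" where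
  "qle_tm s t = monus one (monus (plus (times (qpos s) (qden t)) (times (qneg t) (qden s)))
     (plus (times (qpos t) (qden s)) (times (qneg s) (qden t))))"

lemma qle_tm_typed [simp]: "wt (qle_tm s t) \<longleftrightarrow> wt s \<and> wt t \<and> tyof s = Tn \<and> tyof t = Tn"
  "tyof (qle_tm s t) = Tn" "fvt (qle_tm s t) = fvt s \<union> fvt t"
  by (auto simp: qle_tm_def)

context P_num
begin

text \<open>The decoded digits are computed by a term of P, so the comparison of rationals is needed
  as a term and not only as a formula.\<close>

lemma val_qle_tm:
  assumes "wt s" "wt t" "tyof s = Tn" "tyof t = Tn" "good e"
  shows "val e (qle_tm s t) = (if qv (val e s) \<le> qv (val e t) then Sc' Z0 else Z0)"
proof -
  let ?m = "monus (plus (times (qpos s) (qden t)) (times (qneg t) (qden s)))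
     (plus (times (qpos t) (qden s)) (times (qneg s) (qden t)))"
  define z where "z = val e ?m"
  have z: "z \<in> N" unfolding z_def using assms by (intro val_D') simp_all
  have "z = Z0 \<longleftrightarrow> qv (val e s) \<le> qv (val e t)"
    using sat_qleq[OF assms] unfolding z_def qleq_def leq_def sat_Eq val_zero .
  moreover have "val e (qle_tm s t) = mo (Sc' Z0) z" unfolding qle_tm_def z_def val_monus val_one ..
  moreover have "mo (Sc' Z0) z = (if z = Z0 then Sc' Z0 else Z0)"
  proof (cases "z = Z0")
    case False
    then have "1 \<le> \<kappa> z" using \<kappa>_less[of Z0 z] z by (simp add: less_le)
    then show ?thesis using z False \<kappa>_eq_0[of "mo (Sc' Z0) z"] by simp
  qed (simp add: mo_rec)
  ultimately show ?thesis by simp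
qed

text \<open>The threshold \<open>(4 * t n + 1/2) / P (n + 1)\<close> lies in the gap between the reals whose base 4
  expansion continues \<open>t n\<close> with the digit 0 and those for which it continues with the digit 1.\<close>

lemma decode:
  assumes y: "y \<in> D T1" and P: "P \<in> D T1" "\<And>n. n \<in> N \<Longrightarrow> 0 < \<kappa> (ap P n)"
    and c: "c \<in> N" "st c"
  obtains b t where "b \<in> D T1" "bin b" "digits 4 b t" "st y \<Longrightarrow> st P \<Longrightarrow> st b"
    "\<And>n. n \<in> N \<Longrightarrow> ap b n =
      (if (8 * \<kappa> (ap t n) + 1) / (2 * \<kappa> (ap P (Sc' n))) \<le> R y (pl (pl n n) c) then Sc' Z0 else Z0)"
proof -
  let ?y = "(0, T1)" and ?P = "(1, T1)" and ?n = "(2, Tn)" and ?r = "(3, Tn)" and ?i = "(4, Tn)" and ?t = "(5, T1)"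
    and ?c = "(6, Tn)"
  \<comment> \<open>The threshold (4 * r + 1/2) / P(i + 1) is coded with numerator 8 * r + 1 and
    denominator 2 * P(i + 1). Reading y at place 2 * i + c keeps its error a fixed fraction of
    4^(-i).\<close>
  let ?dig = "\<lambda>r i. qle_tm (quot (suc (times (times two (times two two)) r)) zero (times two (V ?P \<cdot> suc i)))
     (V ?y \<cdot> plus (plus i i) (V ?c))"
  let ?Z = "lam ?r (lam ?i (plus (times (times two two) (V ?r)) (?dig (V ?r) (V ?i))))"
  let ?e = "eb(?y := y, ?P := P, ?c := c)"
  let ?tt = "lam ?n (nrec (V ?n) zero ?Z)" and ?tb = "lam ?i (?dig (V ?t \<cdot> V ?i) (V ?i))"
  define t where "t = val ?e ?tt"
  define b where "b = val (?e(?t := t)) ?tb"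
  have t: "t \<in> D T1" using y P c by (simp add: t_def)
  have b: "b \<in> D T1" using y P c t by (simp add: b_def)
  have dig: "val e (?dig s i) = (if (8 * \<kappa> (val e s) + 1) / (2 * \<kappa> (ap P (Sc' (val e i))))
      \<le> R y (pl (pl (val e i) (val e i)) c) then Sc' Z0 else Z0)"
    if "good e" "wt s" "wt i" "tyof s = Tn" "tyof i = Tn" "e ?P = P" "e ?y = y" "e ?c = c" for e s i
    by (subst val_qle_tm) (use that P y c in \<open>simp_all add: R_def\<close>)
  note dig = dig[unfolded One_nat_def]
  have beq: "ap b n = (if (8 * \<kappa> (ap t n) + 1) / (2 * \<kappa> (ap P (Sc' n))) \<le> R y (pl (pl n n) c)
      then Sc' Z0 else Z0)" if "n \<in> N" for n
    using that y P(1) c t by (simp add: b_def dig)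
  have "bin b" using beq by (simp add: bin_def)
  moreover have "digits 4 b t" unfolding digits_def
  proof (intro conjI ballI t)
    show "ap t Z0 = Z0" using y P c by (simp add: t_def)
    fix n assume n: "n \<in> N"
    define r where "r = rec' Tn n Z0 (val ?e ?Z)"
    have r: "r \<in> N" "ap t n = r" using n y P c by (simp_all add: t_def r_def)
    have "ap t (Sc' n) = ap (ap (val ?e ?Z) r) n" using n y P c by (simp add: t_def r_def)
    also have "\<dots> = pl (ti (ti (Sc' (Sc' Z0)) (Sc' (Sc' Z0))) r) (ap b n)"
      using n y P(1) c r beq[OF n] by (simp add: dig)
    finally show "\<kappa> (ap t (Sc' n)) = 4 * \<kappa> (ap t n) + \<kappa> (ap b n)" using n r b by simp
  qed
  moreover have "st b" if "st y" "st P"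
  proof -
    have "st t" unfolding t_def by (rule st_val) (use that y P c in auto)
    then show ?thesis unfolding b_def by (intro st_val) (use that y P c t in auto)
  qed
  ultimately show ?thesis using that[OF b _ _ _ beq] by blast
qed

lemma stpR_imp_stp: assumes stpR shows stp
  unfolding stp_def
proof (intro ballI impI)
  fix a assume a: "a \<in> D T1" "bin a"
  let ?two = "Sc' (Sc' Z0)"
  define four where "four = ti ?two ?two"
  have four: "four \<in> N" "\<kappa> four = 4" by (simp_all add: four_def)
  \<comment> \<open>At place 2 * n + 6 the distance 2 * 2^(-2n-6) allowed between x and y is one
    eighth of 4^(-n-1).\<close>
  define six where "six = pl ?two four"
  have six: "six \<in> N" "st six"
    using st_val[of "plus two (times two two)" eb] by (simp_all add: six_def four_def)
  let ?tP = "lam (0, Tn) (times (pow2 v0) (pow2 v0))"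
  define P where "P = val eb ?tP"
  have PD: "P \<in> D T1" "st P" unfolding P_def by (auto intro!: st_val)
  have Pn: "\<kappa> (ap P n) = \<kappa> (pw n) * \<kappa> (pw n)" if "n \<in> N" for n using that by (simp add: P_def)
  have P: "powers 4 P" using PD by (simp add: powers_def Pn)
  have Ppos: "0 < \<kappa> (ap P n)" if "n \<in> N" for n using that by (simp add: Pn)
  obtain s where s: "digits 4 a s" using digits_ex[OF a(1) four(1)] four(2) by metis
  have sD: "s \<in> D T1" using s by (simp add: digits_def)
  have sh: "1 \<le> e2 n * \<kappa> (ap P (pl n (Sc' Z0)))" if n: "n \<in> N" for n
  proof -
    have "\<kappa> (ap P (pl n (Sc' Z0))) = 4 * \<kappa> (pw n) * \<kappa> (pw n)" using n by (simp add: Pn)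
    then have "e2 n * \<kappa> (ap P (pl n (Sc' Z0))) = 4 * \<kappa> (pw n)" using n by (simp add: e2_def)
    then show ?thesis using pw_ge1[OF n] by linarith
  qed
  obtain x where x: "x \<in> D T1" "ui x"
    and Rx: "\<And>n. n \<in> N \<Longrightarrow> R x n = \<kappa> (ap s (pl n (Sc' Z0))) / \<kappa> (ap P (pl n (Sc' Z0)))"
  proof (rule digits_real[OF s P _ four(2)[symmetric] four(1) a sh])
    fix x assume "x \<in> D T1" "\<And>n. n \<in> N \<Longrightarrow> R x n = \<kappa> (ap s (pl n (Sc' Z0))) / \<kappa> (ap P (pl n (Sc' Z0)))" "ui x"
    then show thesis by (intro that[of x])
  qed simp_all
  obtain y where y: "y \<in> D T1" "st y" and xy: "\<And>n. n \<in> N \<Longrightarrow> st n \<Longrightarrow> \<bar>R x n - R y n\<bar> \<le> 2 * e2 n"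
    using assms x unfolding stpR_def by blast
  obtain b t where b: "b \<in> D T1" "bin b" "digits 4 b t" "st y \<Longrightarrow> st P \<Longrightarrow> st b"
    and beq: "\<And>n. n \<in> N \<Longrightarrow> ap b n =
      (if (8 * \<kappa> (ap t n) + 1) / (2 * \<kappa> (ap P (Sc' n))) \<le> R y (pl (pl n n) six) then Sc' Z0 else Z0)"
    using decode[OF y(1) PD(1) Ppos six] by metis
  have stb: "st b" using b(4) y(2) PD(2) by blast
  have tD: "t \<in> D T1" using b(3) by (simp add: digits_def)
  have key: "ap b n = ap a n" if n: "n \<in> N" "st n" and e: "ap t n = ap s n" for n
  proof -
    let ?m = "pl (pl n n) six" and ?i = "pl n six" and ?w = "\<kappa> (ap P (Sc' n))"
    define A where "A = \<kappa> (ap s n)"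
    have m: "?m \<in> N" "st ?m" "?i \<in> N" using n six by simp_all
    have w: "0 < ?w" "?w = 4 * \<kappa> (pw n) * \<kappa> (pw n)" using n Ppos by (simp_all add: Pn)
    have sS: "\<kappa> (ap s (Sc' n)) = 4 * A + \<kappa> (ap a n)" using s n by (simp add: digits_def A_def)
    \<comment> \<open>The value of x at place m = 2 * n + 6 is the partial sum with 2 * n + 7
      digits, one more because of the shift. Splitting this as (n + 1) + (n + 6) permits the
      comparison with the first n + 1 digits.\<close>
    have mi: "pl ?m (Sc' Z0) = pl (Sc' n) ?i" by (rule \<kappa>_inj) (use n six in simp_all)
    have B2: "(2::'k) \<le> 4" by simp
    have bd: "(4 * A + \<kappa> (ap a n)) / ?w \<le> R x ?m" "R x ?m < (4 * A + \<kappa> (ap a n) + 1 / 3) / ?w"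
      using digits_bounds[OF s P B2 four(2)[symmetric] four(1) a Sc'_N[OF n(1)] m(3)]
      unfolding Rx[OF m(1)] mi sS by simp_all
    have p6: "\<kappa> (pw six) = 64" by (simp add: six_def four_def ti_rec pl_rec)
    have "2 * e2 ?m = (1 / 8) / ?w" using n six(1) w(2) p6 by (simp add: e2_def field_simps)
    then have d: "\<bar>R x ?m - R y ?m\<bar> \<le> (1 / 8) / ?w" using xy[OF m(1,2)] by simp
    define X Y where "X = R x ?m * ?w" and "Y = R y ?m * ?w"
    have "4 * A + \<kappa> (ap a n) \<le> X" "X < 4 * A + \<kappa> (ap a n) + 1 / 3"
      using bd w(1) by (simp_all add: X_def pos_divide_le_eq pos_less_divide_eq)
    moreover have "\<bar>X - Y\<bar> \<le> 1 / 8"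
    proof -
      have "\<bar>X - Y\<bar> = \<bar>R x ?m - R y ?m\<bar> * ?w" using w(1) by (simp add: X_def Y_def abs_mult flip: left_diff_distrib)
      then show ?thesis using d w(1) by (simp add: pos_le_divide_eq)
    qed
    \<comment> \<open>After scaling by 4^(n+1), digit 0 keeps Y - 4 * A below 1/3 + 1/8 = 11/24,
      while digit 1 keeps it at 7/8 or above. The test at 1/2 tells them apart.\<close>
    ultimately have lo: "4 * A + \<kappa> (ap a n) - 1 / 8 \<le> Y" and hi: "Y < 4 * A + \<kappa> (ap a n) + 11 / 24"
      by linarith+
    have test: "(8 * \<kappa> (ap t n) + 1) / (2 * ?w) \<le> R y ?m \<longleftrightarrow> 4 * A + 1 / 2 \<le> Y"
      using w(1) e by (simp add: Y_def A_def pos_divide_le_eq field_simps)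
    have "ap a n \<in> N" using a n by simp
    then show ?thesis
    proof (cases rule: N_cases)
      case 1
      then have "\<not> 4 * A + 1 / 2 \<le> Y" using hi by simp
      then show ?thesis using 1 beq[OF n(1)] test by simp
    next
      case (2 c)
      then have "\<kappa> c \<le> 0" using a n by (force simp: bin_def dest: bspec[of _ _ n])
      then have an: "ap a n = Sc' Z0" using 2 by simp
      then have "4 * A + 1 / 2 \<le> Y" using lo by simp
      then show ?thesis using an beq[OF n(1)] test by simp
    qed
  qed
  \<comment> \<open>By external induction: if the partial sums agree at d, then \<open>key\<close>
    makes the decoded digit at d correct, and the partial sums agree at d + 1.\<close>
  have ts: "ap t n = ap s n" if n: "n \<in> N" "st n" for n
  proof (rule ext_indP[of "V (1, T1) \<cdot> v0 \<doteq> V (2, T1) \<cdot> v0" "eb((1, T1) := t, (2, T1) := s)" 0 "\<lambda>n. ap t n = ap s n"])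
    show "ap t (Sc' d) = ap s (Sc' d)" if d: "d \<in> N" "st d" "ap t d = ap s d" for d
    proof (rule \<kappa>_inj)
      show "\<kappa> (ap t (Sc' d)) = \<kappa> (ap s (Sc' d))" using s b(3) d key[OF d] by (simp add: digits_def)
    qed (use d tD sD in simp_all)
  qed (use n tD sD s b(3) in \<open>simp_all add: digits_def\<close>)
  have "ap a n = ap b n" if "n \<in> N" "st n" for n using key[OF that ts[OF that]] by simp
  then show "\<exists>b\<in>D T1. st b \<and> bin b \<and> (\<forall>n\<in>N. st n \<longrightarrow> ap a n = ap b n)" using b stb by blast
qed

section \<open>Coverings of the unit interval\<close>

text \<open>This allows finitely many bounds to be replaced by their sum. The convention for 1/0
  makes k positive.\<close>

lemma apt_mono: "apt x z k \<Longrightarrow> k \<in> N \<Longrightarrow> k' \<in> N \<Longrightarrow> \<kappa> k \<le> \<kappa> k' \<Longrightarrow> apt x z k'"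
proof -
  assume a: "apt x z k" and k: "k \<in> N" "k' \<in> N" "\<kappa> k \<le> \<kappa> k'"
  then have p: "0 < \<kappa> k" by (simp add: apt_def less_le)
  then have "1 / \<kappa> k' \<le> 1 / \<kappa> k" using k by (simp add: frac_le)
  moreover have "k' \<noteq> Z0" using p k by auto
  ultimately show ?thesis using a unfolding apt_def by (meson add_right_mono le_less_trans)
qed

lemma stpR_imp_stpC: assumes stpR shows stpC
  unfolding stpC_def
proof (intro ballI impI, rule ccontr)
  fix g assume g: "g \<in> D T2" "st g"
  assume neg: "\<not> (\<exists>w\<in>D (Tseq T1). st w \<and> (\<exists>k\<in>N. st k \<and> (\<forall>z\<in>D T1. rl z \<longrightarrow>
    (\<forall>y\<in>D T1. me T1 y w \<and> ui y \<longrightarrow> apt y z (ap g y)) \<longrightarrow> (\<forall>x\<in>D T1. ui x \<longrightarrow> apt x z k))))"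
  let ?y = "(0, T1)" and ?z = "(1, T1)" and ?g = "(2, T2)" and ?x = "(3, T1)" and ?k = "(4, Tn)"
  \<comment> \<open>As with trees, y has two tasks: if it lies in the unit interval, it is a centre
    apart from z, and its value at 0 is a bound for which some x of the interval is not apart from
    z.\<close>
  let ?\<phi> = "is_real (V ?z) \<and>\<^sub>f (unit_interval (V ?y) \<longrightarrow>\<^sub>f apart (V ?y) (V ?z) (V ?g \<cdot> V ?y)) \<and>\<^sub>f
    ex ?x (unit_interval (V ?x) \<and>\<^sub>f \<not>\<^sub>f (apart (V ?x) (V ?z) (V ?y \<cdot> zero)))"
  let ?e = "eb(?g := g)"
  let ?P = "\<lambda>z y. rl z \<and> (ui y \<longrightarrow> apt y z (ap g y)) \<and> (\<exists>x\<in>D T1. ui x \<and> \<not> apt x z (ap y Z0))"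
  have ex: "sat (?e(?z := z, ?y := y)) ?\<phi> \<longleftrightarrow> ?P z y" if "z \<in> D T1" "y \<in> D T1" for z y
    using that g by simp
  obtain z where z: "z \<in> D T1" "\<And>y. y \<in> D T1 \<Longrightarrow> st y \<Longrightarrow> ?P z y"
  proof (rule ideal[of ?\<phi> ?y ?z ?e])
    fix w assume w: "w \<in> D (Tseq (snd ?y))" "st w"
    from neg have "\<forall>w\<in>D (Tseq T1). st w \<longrightarrow> (\<forall>k\<in>N. st k \<longrightarrow> (\<exists>z\<in>D T1. rl z \<and>
        (\<forall>y\<in>D T1. me T1 y w \<and> ui y \<longrightarrow> apt y z (ap g y)) \<and> (\<exists>x\<in>D T1. ui x \<and> \<not> apt x z k)))"
      by simp
    from this[rule_format, of w "sm1 w"] w obtain z x where z: "z \<in> D T1" "rl z" "x \<in> D T1" "ui x"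
      "\<forall>y\<in>D T1. me T1 y w \<and> ui y \<longrightarrow> apt y z (ap g y)" "\<not> apt x z (sm1 w)"
      by auto
    have "?P z y" if "y \<in> D T1" "me T1 y w" for y
    proof -
      have "\<not> apt x z (ap y Z0)"
        using z(6) apt_mono[of x z "ap y Z0" "sm1 w"] sm1_bound[of y w] that w by auto
      then show ?thesis using z that by blast
    qed
    then show "\<exists>z\<in>D (snd ?z). \<forall>y\<in>D (snd ?y). me (snd ?y) y w \<longrightarrow> sat (?e(?z := z, ?y := y)) ?\<phi>"
      using z(1) ex by auto
  next
    fix z assume "z \<in> D (snd ?z)" "\<And>a. a \<in> D (snd ?y) \<Longrightarrow> st a \<Longrightarrow> sat (?e(?z := z, ?y := a)) ?\<phi>"
    then show thesis using that[of z] ex[of z] by simp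
  qed (use g in simp_all)
  \<comment> \<open>The second idealisation provides one point x of the unit interval that is not
    apart from z for any standard k.\<close>
  let ?\<psi> = "unit_interval (V ?x) \<and>\<^sub>f \<not>\<^sub>f (apart (V ?x) (V ?z) (V ?k))"
  obtain x where x: "x \<in> D T1" "\<And>k. k \<in> N \<Longrightarrow> st k \<Longrightarrow> ui x \<and> \<not> apt x z k"
  proof (rule ideal[of ?\<psi> ?k ?x "eb(?z := z)"])
    fix w assume w: "w \<in> D (Tseq (snd ?k))" "st w"
    then obtain x where x: "x \<in> D T1" "ui x" "\<not> apt x z (sm w)"
      using z(2)[of "cst (sm w)"] by auto
    have "\<not> apt x z k" if "k \<in> N" "me Tn k w" for k
      using x apt_mono[of x z k "sm w"] that w sm_bound[of k w] by auto
    then show "\<exists>x\<in>D (snd ?x). \<forall>k\<in>D (snd ?k). me (snd ?k) k w \<longrightarrow> sat (eb(?z := z, ?x := x, ?k := k)) ?\<psi>"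
      using z(1) x by (intro bexI[of _ x]) simp_all
  next
    fix x assume "x \<in> D (snd ?x)" "\<And>a. a \<in> D (snd ?k) \<Longrightarrow> st a \<Longrightarrow> sat (eb(?z := z, ?x := x, ?k := a)) ?\<psi>"
    then show thesis using that[of x] z(1) by simp
  qed (use z(1) in simp_all)
  have "ui x" using x(2)[of Z0] by simp
  then obtain y where y: "y \<in> D T1" "st y" "ui y" "\<And>n. n \<in> N \<Longrightarrow> st n \<Longrightarrow> \<bar>R x n - R y n\<bar> \<le> 2 * e2 n"
    using assms x(1) unfolding stpR_def by blast
  define G where "G = ap g y"
  have G: "G \<in> N" "st G" using y g by (simp_all add: G_def)
  have "apt y z G" and rlz: "rl z" using z(2)[OF y(1,2)] y(3) by (auto simp: G_def)
  then obtain n where G0: "G \<noteq> Z0" and n: "n \<in> N" "1 / \<kappa> G + 2 * e2 n < \<bar>R y (Sc' n) - R z (Sc' n)\<bar>"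
    by (auto simp: apt_def)
  have Gp: "0 < \<kappa> G" using G G0 by (simp add: less_le)
  \<comment> \<open>The error terms with index q add up to 4 * 2^(-q) in the final estimate. Since
    2^G \<ge> G, the choice q = G + 3 makes this at most 1 / (2 * G).\<close>
  define q where "q = pl G (Sc' (Sc' (Sc' Z0)))"
  have q: "q \<in> N" "st q" using G by (simp_all add: q_def)
  have "\<kappa> G \<le> \<kappa> (pw G)" using pw_ge[OF G(1)] by linarith
  moreover have "\<kappa> (pw q) = 8 * \<kappa> (pw G)" using G by (simp add: q_def)
  ultimately have "8 * \<kappa> G \<le> \<kappa> (pw q)" by linarith
  then have "1 / \<kappa> (pw q) \<le> 1 / (8 * \<kappa> G)" using Gp by (intro frac_le) auto
  then have eq: "4 * e2 q \<le> 1 / (2 * \<kappa> G)" using Gp by (simp add: e2_def field_simps)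
  let ?m = "Sc' q"
  have m: "?m \<in> N" "st ?m" using q by simp_all
  \<comment> \<open>Testing x against the bound 2 * G leaves half of 1 / G for the errors.\<close>
  have "pl G G \<noteq> Z0" using pl_eq_Z0[of G G] G G0 by auto
  then have "\<bar>R x ?m - R z ?m\<bar> \<le> 1 / (2 * \<kappa> G) + 2 * e2 q"
    using x(2)[of "pl G G"] G q by (auto simp: apt_def not_less)
  moreover have "\<bar>R x ?m - R y ?m\<bar> \<le> e2 q" using y(4)[OF m] q by simp
  moreover have "\<bar>R y (Sc' n) - R y ?m\<bar> < e2 n / 2 + e2 q / 2" "\<bar>R z (Sc' n) - R z ?m\<bar> < e2 n / 2 + e2 q / 2"
    using rl_dist[of y "Sc' n" ?m] rl_dist[of z "Sc' n" ?m] y(3) rlz n m q by (simp_all add: ui_def)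
  moreover have "0 < e2 n" using n by simp
  moreover have "1 / \<kappa> G = 1 / (2 * \<kappa> G) + 1 / (2 * \<kappa> G)" using Gp by (simp add: field_simps)
  ultimately show False using n(2) eq by linarith
qed

text \<open>The same real with halved errors. In a proof of |x(n) - y(n)| \<le> 2 * 2^(-n), the
  errors of x and y at place n alone could otherwise exhaust the bound.\<close>

lemma shift_real:
  assumes y: "y \<in> D T1" "st y" "ui y"
  obtains y' where "y' \<in> D T1" "st y'" "ui y'" "\<And>n. n \<in> N \<Longrightarrow> R y' n = R y (Sc' n)"
proof -
  let ?t = "lam (0, Tn) (V (1, T1) \<cdot> suc v0)"
  define y' where "y' = val (eb((1, T1) := y)) ?t"
  have D: "y' \<in> D T1" using y by (simp add: y'_def)
  have R: "R y' n = R y (Sc' n)" if "n \<in> N" for n using that y by (simp add: y'_def R_def)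
  have rl: "rl y'" unfolding rl_def
  proof (intro ballI)
    fix n i assume n: "n \<in> N" "i \<in> N"
    have "\<bar>R y (Sc' n) - R y (pl (Sc' n) i)\<bar> < e2 (Sc' n)"
      using y(3) Sc'_N[OF n(1)] n(2) unfolding ui_def rl_def by blast
    moreover have "e2 (Sc' n) \<le> e2 n" using n by simp
    ultimately have "\<bar>R y (Sc' n) - R y (pl (Sc' n) i)\<bar> < e2 n" by (rule less_le_trans)
    then show "\<bar>R y' n - R y' (pl n i)\<bar> < e2 n" using n by (simp add: R pl_Sc_left)
  qed
  have "ui y'" unfolding ui_def
  proof (intro conjI ballI rl)
    fix n assume n: "n \<in> N"
    have "- 2 * e2 (Sc' n) \<le> R y (Sc' n)" "R y (Sc' n) \<le> 1 + 2 * e2 (Sc' n)"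
      using y(3) Sc'_N[OF n] unfolding ui_def by blast+
    moreover have "e2 (Sc' n) \<le> e2 n" using n by simp
    ultimately show "- 2 * e2 n \<le> R y' n" "R y' n \<le> 1 + 2 * e2 n" unfolding R[OF n] by linarith+
  qed
  moreover have "st y'" unfolding y'_def by (rule st_val) (use y in auto)
  ultimately show ?thesis using that[OF D] R by blast
qed

lemma stpC_imp_stpR: assumes stpC shows stpR
  unfolding stpR_def
proof (intro ballI impI, rule ccontr)
  fix x assume x: "x \<in> D T1" "ui x"
  assume neg: "\<not> (\<exists>y\<in>D T1. st y \<and> ui y \<and> (\<forall>n\<in>N. st n \<longrightarrow> \<bar>R x n - R y n\<bar> \<le> 2 * e2 n))"
  have rlx: "rl x" using x by (simp add: ui_def)
  have sep: "\<exists>n\<in>N. st n \<and> apt y x n" if y: "y \<in> D T1" "st y" "ui y" for y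
  proof (rule ccontr)
    assume near: "\<not> ?thesis"
    obtain y' where y': "y' \<in> D T1" "st y'" "ui y'" "\<And>n. n \<in> N \<Longrightarrow> R y' n = R y (Sc' n)"
      using shift_real[OF y] by blast
    have "\<bar>R x n - R y' n\<bar> \<le> 2 * e2 n" if n: "n \<in> N" "st n" for n
    proof -
      \<comment> \<open>In units of 2^(-n), 1 / k and 2 * 2^(-j) are 1/4 each. The errors of x at n
        and of y' at n contribute less than 1 and 1/2, so the total stays below 2.\<close>
      define k where "k = pw (Sc' (Sc' n))"
      define j where "j = Sc' (Sc' (Sc' n))"
      have k: "k \<in> N" "st k" "k \<noteq> Z0" "1 / \<kappa> k = e2 n / 4"
        using n e2_Sc[of "Sc' n"] by (simp_all add: k_def e2_def)
      have j: "j \<in> N" "e2 j = e2 n / 8" using n by (simp_all add: j_def)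
      have p: "0 < e2 n" using n by simp
      have "\<not> apt y x k" using near k by blast
      then have "\<bar>R y (Sc' j) - R x (Sc' j)\<bar> \<le> 1 / \<kappa> k + 2 * e2 j"
        using k j by (auto simp: apt_def not_less)
      moreover have "\<bar>R x n - R x (pl n (Sc' (Sc' (Sc' (Sc' Z0)))))\<bar> < e2 n"
        using rlx n by (simp add: rl_def)
      moreover have "pl n (Sc' (Sc' (Sc' (Sc' Z0)))) = Sc' j" using n by (simp add: j_def pl_rec)
      moreover have "\<bar>R y (Sc' n) - R y (pl (Sc' n) (Sc' (Sc' (Sc' Z0))))\<bar> < e2 (Sc' n)"
        using y(3) Sc'_N[OF n(1)] unfolding ui_def rl_def by simp
      moreover have "pl (Sc' n) (Sc' (Sc' (Sc' Z0))) = Sc' j" using n by (simp add: j_def pl_rec)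
      moreover have "e2 (Sc' n) = e2 n / 2" using n by simp
      ultimately show ?thesis using y'(4)[OF n(1)] k(4) j(2) p unfolding abs_le_iff abs_less_iff by simp
    qed
    then show False using neg y' by blast
  qed
  let ?y = "(0, T1)" and ?n = "(1, Tn)" and ?x = "(2, T1)"
  let ?\<phi> = "unit_interval (V ?y) \<longrightarrow>\<^sub>f apart (V ?y) (V ?x) (V ?n)" and ?e = "eb(?x := x)"
  have ex: "sat (?e(?y := y, ?n := n)) ?\<phi> \<longleftrightarrow> (ui y \<longrightarrow> apt y x n)" if "y \<in> D T1" "n \<in> N" for y n
    using that x by simp
  obtain F where F: "F \<in> D (T1 \<rightarrow> Tseq Tn)" "st F"
    "\<And>y. y \<in> D T1 \<Longrightarrow> st y \<Longrightarrow> \<exists>n\<in>N. me Tn n (ap F y) \<and> (ui y \<longrightarrow> apt y x n)"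
  proof (rule hac[of ?\<phi> ?y ?n ?e])
    show "\<exists>n\<in>D (snd ?n). st n \<and> sat (?e(?y := y, ?n := n)) ?\<phi>" if y: "y \<in> D (snd ?y)" "st y" for y
    proof (cases "ui y")
      case True
      then show ?thesis using sep[of y] y ex[of y] by auto
    next
      case False
      \<comment> \<open>HAC-int asks for a value at every standard object of type 1; outside the
        unit interval the default is 0.\<close>
      then show ?thesis using ex[of y Z0] y by (intro bexI[of _ Z0]) simp_all
    qed
    fix F assume F: "F \<in> D (snd ?y \<rightarrow> Tseq (snd ?n))" "st F" "\<And>b. b \<in> D (snd ?y) \<Longrightarrow> st b \<Longrightarrow>
      \<exists>n\<in>D (snd ?n). me (snd ?n) n (ap F b) \<and> sat (?e(?y := b, ?n := n)) ?\<phi>"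
    have "\<exists>n\<in>N. me Tn n (ap F y) \<and> (ui y \<longrightarrow> apt y x n)" if "y \<in> D T1" "st y" for y
      using F(3)[of y] that ex[OF that(1)] by auto
    then show thesis using that[of F] F(1,2) by simp
  qed (use x in simp_all)
  obtain g where g: "g \<in> D T2" "st g"
    "\<And>b n. b \<in> D T1 \<Longrightarrow> n \<in> N \<Longrightarrow> me Tn n (ap F b) \<Longrightarrow> \<kappa> n \<le> \<kappa> (ap g b)"
    using bound_fun[OF F(1,2)] by blast
  obtain w k where w: "w \<in> D (Tseq T1)" "st w" "k \<in> N" and cov: "\<forall>z\<in>D T1. rl z \<longrightarrow>
    (\<forall>y\<in>D T1. me T1 y w \<and> ui y \<longrightarrow> apt y z (ap g y)) \<longrightarrow> (\<forall>x\<in>D T1. ui x \<longrightarrow> apt x z k)"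
    using bspec[OF assms[unfolded stpC_def] g(1), THEN mp, OF g(2)]
    by (elim bexE conjE) (rule that; assumption)
  have "apt y x (ap g y)" if y: "y \<in> D T1" "me T1 y w" "ui y" for y
  proof -
    have "st y" using st_me y w by blast
    then obtain n where n: "n \<in> N" "me Tn n (ap F y)" "apt y x n" using F(3) y by blast
    then show ?thesis using apt_mono[OF n(3,1), of "ap g y"] g(1) g(3)[OF y(1) n(1,2)] y(1) by simp
  qed
  \<comment> \<open>The covering is applied with z = x, and x would then have positive distance from
    itself.\<close>
  then have "apt x x k" using cov x rlx by blast
  then obtain n where "n \<in> N" "1 / \<kappa> k + 2 * e2 n < 0" by (auto simp: apt_def)
  moreover have "0 \<le> 1 / \<kappa> k" "0 < e2 n" using w(3) \<open>n \<in> N\<close> by simp_all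
  ultimately show False by linarith
qed

end

section \<open>The numbers of a countermodel as a type\<close>

text \<open>The arithmetic of the model has to become the arithmetic of a type, for which the ordered field
  of fractions exists. Since a type cannot depend on a model fixed in a proof, \<open>hn_ops\<close> chooses a
  countermodel of the theorem globally, if there is one, and some arithmetic on \<open>nat\<close> otherwise.\<close>

type_synonym nat_ops = "nat \<times> nat \<times> (nat \<Rightarrow> nat \<Rightarrow> nat) \<times> (nat \<Rightarrow> nat \<Rightarrow> nat)"

text \<open>These laws make the arithmetic an instance of \<open>natlike\<close>, with the order
  defined by differences: the last clause gives linearity, while cancellation and p a b = z
  \<longrightarrow> b = z give antisymmetry.\<close>

definition nat_structure :: "nat_ops \<Rightarrow> bool" where
  "nat_structure = (\<lambda>(z, u, p, t).
    (\<forall>a b c. p (p a b) c = p a (p b c)) \<and> (\<forall>a b. p a b = p b a) \<and> (\<forall>a. p z a = a) \<and>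
    (\<forall>a b c. t (t a b) c = t a (t b c)) \<and> (\<forall>a b. t a b = t b a) \<and> (\<forall>a. t u a = a) \<and>
    (\<forall>a b c. t (p a b) c = p (t a c) (t b c)) \<and> (\<forall>a. t z a = z) \<and> z \<noteq> u \<and>
    (\<forall>a b c. p a c = p b c \<longrightarrow> a = b) \<and> (\<forall>a b. p a b = z \<longrightarrow> b = z) \<and>
    (\<forall>a b. t a b = z \<longrightarrow> a = z \<or> b = z) \<and> (\<forall>a b. \<exists>c. p a c = b \<or> p b c = a))"

lemma nat_structure_nat: "nat_structure (0, 1, (+), (*))"
  unfolding nat_structure_def by (auto simp: algebra_simps) (metis le_add_diff_inverse nat_le_linear)

context P_model
begin

definition transported :: "(nat \<Rightarrow> 'a) \<Rightarrow> nat_ops \<Rightarrow> bool" where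
  "transported f = (\<lambda>(z, u, p, t). f z = Z0 \<and> f u = Sc' Z0 \<and>
    (\<forall>a b. f (p a b) = pl (f a) (f b)) \<and> (\<forall>a b. f (t a b) = ti (f a) (f b)))"

lemma transported_ex:
  assumes "bij_betw f UNIV N" shows "\<exists>s. transported f s"
proof -
  have inv: "f (inv_into UNIV f a) = a" if "a \<in> N" for a
    using that assms by (intro f_inv_into_f) (auto simp: bij_betw_def)
  have f: "f n \<in> N" for n using assms by (auto simp: bij_betw_def)
  show ?thesis unfolding transported_def
    by (rule exI[of _ "(inv_into UNIV f Z0, inv_into UNIV f (Sc' Z0),
        \<lambda>a b. inv_into UNIV f (pl (f a) (f b)), \<lambda>a b. inv_into UNIV f (ti (f a) (f b)))"])
      (simp add: inv f)
qed

lemma transported_structure: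
  assumes bij: "bij_betw f UNIV N" and tr: "transported f s" shows "nat_structure s"
proof -
  obtain z u p t where s: "s = (z, u, p, t)" by (cases s)
  have f [simp]: "f n \<in> N" for n using bij by (auto simp: bij_betw_def)
  have inj: "a = b \<longleftrightarrow> f a = f b" for a b using bij by (auto simp: bij_betw_def inj_on_def)
  have sur: "\<exists>n. f n = a" if "a \<in> N" for a using bij that by (auto simp: bij_betw_def image_iff dest!: equalityD2)
  have e: "f z = Z0" "f u = Sc' Z0" "f (p a b) = pl (f a) (f b)" "f (t a b) = ti (f a) (f b)" for a b
    using tr by (auto simp: s transported_def)
  have tot: "\<exists>c. f (p a c) = f b \<or> f (p b c) = f a" for a b
    using pl_total[of "f a" "f b"] sur unfolding e by (metis f)
  show ?thesis unfolding s nat_structure_def prod.case inj[of _ _] e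
  proof (intro conjI allI impI)
    show "pl (pl (f a) (f b)) (f c) = pl (f a) (pl (f b) (f c))" for a b c by (simp add: pl_assoc)
    show "pl (f a) (f b) = pl (f b) (f a)" for a b by (simp add: pl_commute)
    show "pl Z0 (f a) = f a" for a by (simp add: pl_Z0_left)
    show "ti (ti (f a) (f b)) (f c) = ti (f a) (ti (f b) (f c))" for a b c by (simp add: ti_assoc)
    show "ti (f a) (f b) = ti (f b) (f a)" for a b by (simp add: ti_commute)
    show "ti (Sc' Z0) (f a) = f a" for a by (simp add: ti_one)
    show "ti (pl (f a) (f b)) (f c) = pl (ti (f a) (f c)) (ti (f b) (f c))" for a b c by (simp add: ti_distrib)
    show "ti Z0 (f a) = Z0" for a by (simp add: ti_Z0_left)
    show "Z0 \<noteq> Sc' Z0" using Sc'_neq[OF Z0_N] by metis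
    show "f a = f b" if "pl (f a) (f c) = pl (f b) (f c)" for a b c
      using that pl_cancel[of "f a" "f b" "f c"] by simp
    show "f b = Z0" if "pl (f a) (f b) = Z0" for a b using that pl_eq_Z0[of "f a" "f b"] by simp
    show "f a = Z0 \<or> f b = Z0" if "ti (f a) (f b) = Z0" for a b using that ti_eq_Z0[of "f a" "f b"] by simp
    show "\<exists>c. pl (f a) (f c) = f b \<or> pl (f b) (f c) = f a" for a b using tot[of a b] unfolding e .
  qed
qed

end

text \<open>One formula for all three equivalences, so that a single global choice of a countermodel
  serves them all.\<close>

definition equivalences :: fm where
  "equivalences = ((STP \<longleftrightarrow>\<^sub>f STP_R) \<and>\<^sub>f (STP \<longleftrightarrow>\<^sub>f STP_tree) \<and>\<^sub>f (STP \<longleftrightarrow>\<^sub>f STP_cover))"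

definition countermodel_ops :: "nat_ops \<Rightarrow> bool" where
  "countermodel_ops s \<longleftrightarrow> (\<exists>(D :: ty \<Rightarrow> tm set set) ap ci st e f.
    P_model D ap ci st \<and> tstruct.good D e \<and> \<not> tstruct.sat D ap ci st e equivalences \<and>
    bij_betw f UNIV (D Tn) \<and> P_model.transported ap ci f s)"

definition hn_ops :: nat_ops where
  "hn_ops = (SOME s. nat_structure s \<and> ((\<exists>s. countermodel_ops s) \<longrightarrow> countermodel_ops s))"

lemma countermodel_ops_structure: "countermodel_ops s \<Longrightarrow> nat_structure s"
  unfolding countermodel_ops_def using P_model.transported_structure by blast

lemma hn_ops: "nat_structure hn_ops" "\<exists>s. countermodel_ops s \<Longrightarrow> countermodel_ops hn_ops"
proof -
  have "\<exists>s. nat_structure s \<and> ((\<exists>s. countermodel_ops s) \<longrightarrow> countermodel_ops s)"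
    using nat_structure_nat countermodel_ops_structure by blast
  then have "nat_structure hn_ops \<and> ((\<exists>s. countermodel_ops s) \<longrightarrow> countermodel_ops hn_ops)"
    unfolding hn_ops_def by (rule someI_ex)
  then show "nat_structure hn_ops" "\<exists>s. countermodel_ops s \<Longrightarrow> countermodel_ops hn_ops" by auto
qed

text \<open>A fresh copy of \<open>nat\<close>, since \<open>nat\<close> already carries its own
  arithmetic instances.\<close>

datatype hn = Hn (un_hn: nat)

instantiation hn :: natlike
begin

definition zero_hn :: hn where "0 = Hn (fst hn_ops)"
definition one_hn :: hn where "1 = Hn (fst (snd hn_ops))"
definition plus_hn :: "hn \<Rightarrow> hn \<Rightarrow> hn" where "a + b = Hn (fst (snd (snd hn_ops)) (un_hn a) (un_hn b))"
definition times_hn :: "hn \<Rightarrow> hn \<Rightarrow> hn" where "a * b = Hn (snd (snd (snd hn_ops)) (un_hn a) (un_hn b))"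
definition less_eq_hn :: "hn \<Rightarrow> hn \<Rightarrow> bool" where "(a :: hn) \<le> b \<longleftrightarrow> (\<exists>c. b = a + c)"
definition less_hn :: "hn \<Rightarrow> hn \<Rightarrow> bool" where "(a :: hn) < b \<longleftrightarrow> a \<le> b \<and> \<not> b \<le> a"

instance
proof
  obtain z u p t where s: "hn_ops = (z, u, p, t)" by (cases hn_ops)
  note st = hn_ops(1)[unfolded s nat_structure_def prod.case]
  note defs = zero_hn_def one_hn_def plus_hn_def times_hn_def s fst_conv snd_conv
  have ax: "p (p a b) c = p a (p b c)" "p a b = p b a" "p z a = a" "t (t a b) c = t a (t b c)" "t a b = t b a"
    "t u a = a" "t (p a b) c = p (t a c) (t b c)" "t z a = z" "z \<noteq> u" "p a c = p b c \<Longrightarrow> a = b"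
    "p a b = z \<Longrightarrow> b = z" "t a b = z \<Longrightarrow> a = z \<or> b = z" "\<exists>c. p a c = b \<or> p b c = a" for a b c
    using st by (elim conjE; metis)+
  fix a b c :: hn
  show assoc: "a + b + c = a + (b + c)" for a b c :: hn by (simp add: defs ax(1))
  show comm: "a + b = b + a" for a b :: hn by (simp add: defs ax(2))
  show zero: "0 + a = a" for a :: hn by (simp add: defs ax(3))
  show "a * b * c = a * (b * c)" by (simp add: defs ax(4))
  show "a * b = b * a" by (simp add: defs ax(5))
  show "1 * a = a" by (simp add: defs ax(6))
  show "(a + b) * c = a * c + b * c" by (simp add: defs ax(7))
  show "0 * a = 0" by (simp add: defs ax(8))
  show "a * 0 = 0" by (simp add: defs ax(8) ax(5)[of _ z])
  show "(0 :: hn) \<noteq> 1" by (simp add: defs ax(9))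
  show cancel: "a = b" if "a + c = b + c" for a b c :: hn
    using that ax(10) by (simp add: defs hn.expand)
  have pos: "b = 0" if "a + b = 0" for a b :: hn using that ax(11) by (cases b) (auto simp: defs)
  show "a = 0 \<or> b = 0" if "a * b = 0" using that ax(12) by (cases a; cases b) (auto simp: defs)
  show "a \<le> b \<longleftrightarrow> (\<exists>c. b = a + c)" by (rule less_eq_hn_def)
  show "a < b \<longleftrightarrow> a \<le> b \<and> \<not> b \<le> a" by (rule less_hn_def)
  show "a \<le> a" unfolding less_eq_hn_def using zero[of a] comm[of a 0] by metis
  show "a \<le> b \<Longrightarrow> b \<le> c \<Longrightarrow> a \<le> c" unfolding less_eq_hn_def using assoc by metis
  show "a = b" if "a \<le> b" "b \<le> a"
  proof -
    from that obtain c d where c: "b = a + c" and d: "a = b + d" unfolding less_eq_hn_def by blast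
    have "(c + d) + a = 0 + a" using c d zero assoc comm by metis
    then have "d = 0" using cancel pos by blast
    then show ?thesis using d zero comm by metis
  qed
  show "a \<le> b \<or> b \<le> a"
  proof -
    obtain d where "p (un_hn a) d = un_hn b \<or> p (un_hn b) d = un_hn a" using ax(13) by blast
    then have "b = a + Hn d \<or> a = b + Hn d" by (auto simp: defs hn.expand)
    then show ?thesis unfolding less_eq_hn_def by blast
  qed
qed

end

text \<open>If there were a countermodel, the one behind \<open>hn_ops\<close> would have its
  numbers isomorphic to \<open>hn\<close>. The fractions over \<open>hn\<close> then supply the
  embedding \<kappa>, and the arguments in \<open>P_num\<close> make the equivalences true in that
  very model.\<close>

lemma countermodel_hn_false: "\<not> countermodel_ops s"
proof
  assume "countermodel_ops s"
  then have "countermodel_ops hn_ops" using hn_ops(2) by blast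
  then obtain D :: "ty \<Rightarrow> tm set set" and ap ci st e f where
    M: "P_model D ap ci st" and e: "tstruct.good D e" "\<not> tstruct.sat D ap ci st e equivalences"
    and f: "bij_betw f UNIV (D Tn)" "P_model.transported ap ci f hn_ops"
    unfolding countermodel_ops_def by blast
  interpret P_model D ap ci st by (rule M)
  have fN: "f n \<in> N" for n using f(1) by (auto simp: bij_betw_def)
  define g where "g a = Hn (inv_into UNIV f a)" for a
  have g: "g (f n) = Hn n" for n using f(1) by (simp add: g_def bij_betw_def)
  have ex: "\<exists>n. a = f n" if "a \<in> N" for a using f(1) that by (auto simp: bij_betw_def)
  obtain z u p t where s: "hn_ops = (z, u, p, t)" by (cases hn_ops)
  have tr: "f z = Z0" "f u = Sc' Z0" "f (p a b) = pl (f a) (f b)" "f (t a b) = ti (f a) (f b)" for a b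
    using f(2) by (auto simp: s transported_def)
  have g0: "g Z0 = 0" "g (Sc' Z0) = 1"
    using g[of z] g[of u] tr(1,2) by (simp_all add: zero_hn_def one_hn_def s)
  have gp: "g (pl a b) = g a + g b" "g (ti a b) = g a * g b" if "a \<in> N" "b \<in> N" for a b
  proof -
    from ex[OF that(1)] ex[OF that(2)] obtain n m where "a = f n" "b = f m" by blast
    then show "g (pl a b) = g a + g b" "g (ti a b) = g a * g b"
      by (simp_all add: tr[symmetric] g plus_hn_def times_hn_def s)
  qed
  have gi: "a = b" if "a \<in> N" "b \<in> N" "g a = g b" for a b
    using ex[OF that(1)] ex[OF that(2)] that(3) by (auto simp: g)
  have gS: "g (Sc' a) = g a + 1" if "a \<in> N" for a
    using gp(1)[OF that Sc'_N[OF Z0_N]] that by (simp add: g0 pl_rec)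
  have pos: "0 \<le> emb x" for x :: hn
    using emb_simps(6)[of 0 x] le_iff_ex_add[of 0 x] by (simp add: emb_simps)
  interpret P_num D ap ci st "\<lambda>a. emb (g a)"
    by standard (simp_all add: emb_simps(1-5) g0 gS gp gi pos)
  have "stp \<longleftrightarrow> stpR" "stp \<longleftrightarrow> stpT" "stp \<longleftrightarrow> stpC"
    using stp_imp_stpR stpR_imp_stp stp_imp_stpT stpT_imp_stp stpR_imp_stpC stpC_imp_stpR by blast+
  then have "sat e equivalences" using e(1) by (simp add: equivalences_def sat_principles)
  then show False using e(2) by blast
qed

lemma wff_principles: "wff STP" "wff STP_R" "wff STP_tree" "wff STP_cover"
  by (simp_all add: STP_def STP_R_def STP_tree_def STP_cover_def Let_def)

lemma sat_equivalences:
  fixes D :: "ty \<Rightarrow> tm set set"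
  assumes M: "P_model D ap ci st" and c: "countable (D Tn)" and e: "tstruct.good D e"
  shows "tstruct.sat D ap ci st e equivalences"
proof -
  interpret P_model D ap ci st by (rule M)
  have f: "bij_betw (from_nat_into N) UNIV N" using c N_infinite by (rule bij_betw_from_nat_into)
  obtain s where "transported (from_nat_into N) s" using transported_ex[OF f] by blast
  then show ?thesis
    using countermodel_hn_false[of s] M e f unfolding countermodel_ops_def by blast
qed

theorem theorem4p4:
  shows "({} \<turnstile>\<^sub>P (STP \<longleftrightarrow>\<^sub>f STP_R))
       \<and> ({} \<turnstile>\<^sub>P (STP \<longleftrightarrow>\<^sub>f STP_tree))
       \<and> ({} \<turnstile>\<^sub>P (STP \<longleftrightarrow>\<^sub>f STP_cover))"
proof -
  have d: "{} \<turnstile>\<^sub>P \<phi>" if \<phi>: "\<phi> \<in> {STP \<longleftrightarrow>\<^sub>f STP_R, STP \<longleftrightarrow>\<^sub>f STP_tree, STP \<longleftrightarrow>\<^sub>f STP_cover}" for \<phi>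
  proof (rule completeness)
    show "wff \<phi>" using \<phi> wff_principles by auto
    fix D :: "ty \<Rightarrow> tm set set" and ap ci st e
    assume M: "P_model D ap ci st" and c: "countable (D Tn)" and e: "tstruct.good D e"
    interpret P_model D ap ci st by (rule M)
    show "sat e \<phi>" using sat_equivalences[OF M c e] \<phi> by (auto simp: equivalences_def)
  qed
  show ?thesis by (intro conjI d) simp_all
qed

end
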